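(* Let $\mathcal{C}$ be the set of all corner-interval minors of the $m\times n$ matrix $M$. Then the Hilbert-Poincaré polynomial of $S/I(\mathcal{C})$ is $$P_{S/I(\mathcal{C})}(z)=\sum_{t=1}^{m-1}P_{S/I_2(M_{t,1})}(z)\,\bigl(z(1-z)^{n(t-1)}\bigr)+z(1-z)^{(m-1)(n-1)}+(1-z)^{m}.$$
   Context: $K$ is a field, $M=(x_{ij})$ is an $m\times n$ matrix of indeterminates and $S=K[x_{ij}\mid i\in[m],j\in[n]]$ with the standard grading. A corner-interval minor of $M$ is a 2-minor $[a_1,a_2|b_1,b_2]$ ($a_1<a_2$, $b_1<b_2$) with $b_1=1$; for a set $\mathcal{C}$ of 2-minors, $I(\mathcal{C})=(x_{a_1b_1}x_{a_2b_2}-x_{a_1b_2}x_{a_2b_1}\mid[a_1,a_2|b_1,b_2]\in\mathcal{C})\subset S$. $M_{t,1}$ denotes the submatrix of $M$ consisting of rows $t,\dots,m$ and all columns $1,\dots,n$, and $I_2(M_{t,1})\subset S$ is the ideal generated by all 2-minors of $M_{t,1}$. For a finitely generated graded $S$-module $N$ with graded Betti numbers $\beta_{i,j}(N)$ over $S$, the Hilbert-Poincaré polynomial of $N$ is $P_N(z)=\sum_{i,j}(-1)^i\beta_{i,j}(N)z^j$.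
   Formalization: The summand z(1-z)^{(m-1)(n-1)} is corrected to z(1-z)^{n(m-1)}, since the printed formula fails for every m ≥ 2 (for m=n=2 it gives 1-z^3 instead of 1-z^2); m,n ≥ 1 is assumed. *)

theory Defs
  imports
    "HOL-Algebra.QuotRing"
    "HOL-Algebra.Module"
    "HOL-Library.Poly_Mapping"
    "HOL-Computational_Algebra.Polynomial"
begin

section \<open>The standard graded polynomial ring\<close>

text \<open>
  A monomial is a finitely supported exponent function \<open>'x \<Rightarrow>\<^sub>0 nat\<close>, a polynomial a finitely
  supported coefficient function on monomials; the product of \<^typ>\<open>('x \<Rightarrow>\<^sub>0 nat) \<Rightarrow>\<^sub>0 'a\<close>
  is convolution.
\<close>

type_synonym ('x, 'a) mpoly = "('x \<Rightarrow>\<^sub>0 nat) \<Rightarrow>\<^sub>0 'a"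

definition indet :: "'x \<Rightarrow> ('x, 'a::field) mpoly" where
  "indet x = Poly_Mapping.single (Poly_Mapping.single x 1) 1"

definition poly_ring :: "'x set \<Rightarrow> ('x, 'a::field) mpoly ring" where
  "poly_ring V =
     \<lparr> carrier = {p. \<forall>t\<in>Poly_Mapping.keys p. Poly_Mapping.keys t \<subseteq> V}, monoid.mult = (*), one = 1, zero = 0, add = (+) \<rparr>"

definition monom_degree :: "('x \<Rightarrow>\<^sub>0 nat) \<Rightarrow> nat" where
  "monom_degree t = (\<Sum>x\<in>Poly_Mapping.keys t. Poly_Mapping.lookup t x)"

definition homogeneous_part :: "'x set \<Rightarrow> nat \<Rightarrow> ('x, 'a::field) mpoly set" where
  "homogeneous_part V j = {p \<in> carrier (poly_ring V). \<forall>t\<in>Poly_Mapping.keys p. monom_degree t = j}"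


section \<open>Graded modules\<close>

text \<open>
  Modules over the polynomial ring are modules in the sense of HOL-Algebra (where the fields
  \<open>mult\<close> and \<open>one\<close> of the record are irrelevant), together with the family of their homogeneous
  components. Only gradings by natural numbers are considered, so that the
  Hilbert--Poincare polynomial is a polynomial rather than a Laurent polynomial.
\<close>

record ('s, 'b) graded_module = "('s, 'b) module" +
  component :: "nat \<Rightarrow> 'b set"

definition graded_quotient ::
  "'x set \<Rightarrow> ('x, 'a::field) mpoly set \<Rightarrow> (('x, 'a) mpoly, ('x, 'a) mpoly set) graded_module" where
  "graded_quotient V I =
     (let S = poly_ring V; Q = S Quot I in
      \<lparr> carrier = carrier Q, monoid.mult = monoid.mult Q, one = one Q, zero = zero Q, add = add Q,
        module.smult = (\<lambda>f c. (I +>\<^bsub>S\<^esub> f) \<otimes>\<^bsub>Q\<^esub> c),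
        component = (\<lambda>j. (\<lambda>f. I +>\<^bsub>S\<^esub> f) ` homogeneous_part V j) \<rparr>)"


section \<open>Minimal graded free resolutions and graded Betti numbers\<close>

text \<open>
  An augmented complex \<open>\<dots> \<rightarrow> F\<^sub>2 \<rightarrow> F\<^sub>1 \<rightarrow> F\<^sub>0 \<rightarrow> N\<close> of graded free modules of finite rank with
  chosen homogeneous bases: \<open>F\<^sub>i\<close> has rank \<open>rank F i\<close>, its \<open>k\<close>-th basis element has degree
  \<open>shift F i k\<close>, so \<open>F\<^sub>i\<close> is the direct sum of the modules \<open>S(- shift F i k)\<close>. The row
  \<open>diff F i k\<close> is the image in \<open>F\<^sub>i\<close> of the \<open>k\<close>-th basis element of \<open>F\<^bsub>i+1\<^esub>\<close>, and
  \<open>aug F k\<close> is the image in \<open>N\<close> of the \<open>k\<close>-th basis element of \<open>F\<^sub>0\<close>.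
\<close>

record ('s, 'b) free_complex =
  rank :: "nat \<Rightarrow> nat"
  shift :: "nat \<Rightarrow> nat \<Rightarrow> nat"
  diff :: "nat \<Rightarrow> nat \<Rightarrow> nat \<Rightarrow> 's"
  aug :: "nat \<Rightarrow> 'b"

text \<open>The free module of rank \<open>r\<close>; coordinate vectors are padded by zeros.\<close>

definition free_module :: "'x set \<Rightarrow> nat \<Rightarrow> (nat \<Rightarrow> ('x, 'a::field) mpoly) set" where
  "free_module V r = {v. (\<forall>k<r. v k \<in> carrier (poly_ring V)) \<and> (\<forall>k\<ge>r. v k = 0)}"

definition boundary ::
  "(('x, 'a::field) mpoly, 'b) free_complex \<Rightarrow> nat
     \<Rightarrow> (nat \<Rightarrow> ('x, 'a) mpoly) \<Rightarrow> (nat \<Rightarrow> ('x, 'a) mpoly)" where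
  "boundary F i v = (\<lambda>l. \<Sum>k<rank F (Suc i). v k * diff F i k l)"

definition augmentation ::
  "(('x, 'a::field) mpoly, 'b) graded_module \<Rightarrow> (('x, 'a) mpoly, 'b) free_complex
     \<Rightarrow> (nat \<Rightarrow> ('x, 'a) mpoly) \<Rightarrow> 'b" where
  "augmentation N F v = (\<Oplus>\<^bsub>N\<^esub>k\<in>{..<rank F 0}. v k \<odot>\<^bsub>N\<^esub> aug F k)"

definition graded_free_resolution ::
  "'x set \<Rightarrow> (('x, 'a::field) mpoly, 'b) graded_module
     \<Rightarrow> (('x, 'a) mpoly, 'b) free_complex \<Rightarrow> bool" where
  "graded_free_resolution V N F \<longleftrightarrow>
     \<comment> \<open>all maps are well defined and homogeneous of degree 0\<close>
     (\<forall>k<rank F 0. aug F k \<in> component N (shift F 0 k)) \<and>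
     (\<forall>i. \<forall>k<rank F (Suc i). diff F i k \<in> free_module V (rank F i)) \<and>
     (\<forall>i. \<forall>k<rank F (Suc i). \<forall>l<rank F i. \<forall>t\<in>Poly_Mapping.keys (diff F i k l).
        monom_degree t + shift F i l = shift F (Suc i) k) \<and>
     \<comment> \<open>exactness at \<open>N\<close>, at \<open>F\<^sub>0\<close> and at \<open>F\<^bsub>i+1\<^esub>\<close>\<close>
     augmentation N F ` free_module V (rank F 0) = carrier N \<and>
     {v \<in> free_module V (rank F 0). augmentation N F v = \<zero>\<^bsub>N\<^esub>}
       = boundary F 0 ` free_module V (rank F 1) \<and>
     (\<forall>i. {v \<in> free_module V (rank F (Suc i)). boundary F i v = (\<lambda>l. 0)}
       = boundary F (Suc i) ` free_module V (rank F (Suc (Suc i))))"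

text \<open>
  Minimality: the image of every differential lies in \<open>\<mm>F\<^sub>i\<close>, where \<open>\<mm>\<close> is the ideal
  generated by the indeterminates, i.e. no entry of a differential has a constant term.
\<close>

definition minimal_graded_free_resolution ::
  "'x set \<Rightarrow> (('x, 'a::field) mpoly, 'b) graded_module
     \<Rightarrow> (('x, 'a) mpoly, 'b) free_complex \<Rightarrow> bool" where
  "minimal_graded_free_resolution V N F \<longleftrightarrow>
     graded_free_resolution V N F \<and>
     (\<forall>i. \<forall>k<rank F (Suc i). \<forall>l<rank F i. Poly_Mapping.lookup (diff F i k l) 0 = 0)"

text \<open>
  For a finitely generated graded module over a polynomial ring in finitely many indeterminates
  a minimal graded free resolution exists and is unique up to isomorphism, so the following
  number does not depend on the choice of \<open>F\<close>.
\<close>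

definition graded_betti ::
  "'x set \<Rightarrow> (('x, 'a::field) mpoly, 'b) graded_module \<Rightarrow> nat \<Rightarrow> nat \<Rightarrow> nat" where
  "graded_betti V N i j =
     (let F = (SOME F. minimal_graded_free_resolution V N F)
      in card {k. k < rank F i \<and> shift F i k = j})"

text \<open>In the situation above the index set is finite by Hilbert's syzygy theorem.\<close>

definition hilbert_poincare ::
  "'x set \<Rightarrow> (('x, 'a::field) mpoly, 'b) graded_module \<Rightarrow> int poly" where
  "hilbert_poincare V N =
     (\<Sum>(i, j) \<in> {(i, j). graded_betti V N i j \<noteq> 0}.
        Polynomial.monom ((- 1) ^ i * int (graded_betti V N i j)) j)"


section \<open>Ideals of 2-minors\<close>

text \<open>The generic matrix has rows \<open>1, \<dots>, m\<close> and columns \<open>1, \<dots>, n\<close>; its entries are the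
  indeterminates \<open>indet (i, j)\<close>. The minor \<open>[a\<^sub>1,a\<^sub>2|b\<^sub>1,b\<^sub>2]\<close> is the tuple \<open>(a\<^sub>1, a\<^sub>2, b\<^sub>1, b\<^sub>2)\<close>.\<close>

definition matrix_vars :: "nat \<Rightarrow> nat \<Rightarrow> (nat \<times> nat) set" where
  "matrix_vars m n = {1..m} \<times> {1..n}"

definition two_minors :: "nat set \<Rightarrow> nat set \<Rightarrow> (nat \<times> nat \<times> nat \<times> nat) set" where
  "two_minors A B =
     {(a1, a2, b1, b2). a1 \<in> A \<and> a2 \<in> A \<and> a1 < a2 \<and> b1 \<in> B \<and> b2 \<in> B \<and> b1 < b2}"

definition corner_interval_minors :: "nat \<Rightarrow> nat \<Rightarrow> (nat \<times> nat \<times> nat \<times> nat) set" where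
  "corner_interval_minors m n = {(a1, a2, b1, b2) \<in> two_minors {1..m} {1..n}. b1 = 1}"

definition minor :: "nat \<times> nat \<times> nat \<times> nat \<Rightarrow> (nat \<times> nat, 'a::field) mpoly" where
  "minor = (\<lambda>(a1, a2, b1, b2).
     indet (a1, b1) * indet (a2, b2) - indet (a1, b2) * indet (a2, b1))"

definition minor_ideal ::
  "nat \<Rightarrow> nat \<Rightarrow> (nat \<times> nat \<times> nat \<times> nat) set \<Rightarrow> (nat \<times> nat, 'a::field) mpoly set" where
  "minor_ideal m n C = Idl\<^bsub>poly_ring (matrix_vars m n)\<^esub> (minor ` C)"

text \<open>The ideal \<open>I\<^sub>2(M\<^bsub>t,1\<^esub>)\<close>, taken in the ring of all \<open>m n\<close> indeterminates.\<close>

definition I2_lower :: "nat \<Rightarrow> nat \<Rightarrow> nat \<Rightarrow> (nat \<times> nat, 'a::field) mpoly set" where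
  "I2_lower m n t = minor_ideal m n (two_minors {t..m} {1..n})"

text \<open>
  Pitfall: in the published formula the summand for the last entry of the first column is
  \<open>z(1-z)^((m-1)(n-1))\<close>. That version is false for all \<open>m \<ge> 2\<close>: for \<open>m = n = 2\<close> the ideal is
  generated by one quadric, so the left-hand side is \<open>1 - z^2\<close>, while the printed right-hand side
  is \<open>1 - z^3\<close>. The correct exponent is \<open>n(m-1)\<close>, since the colon ideal
  \<open>(I(C), x\<^bsub>11\<^esub>, \<dots>, x\<^bsub>m-1,1\<^esub>) : x\<^bsub>m1\<^esub>\<close> is generated by all \<open>n(m-1)\<close> indeterminates
  of the first \<open>m - 1\<close> rows; this is the exponent \<open>n(t-1)\<close> of the other summands at \<open>t = m\<close>.
\<close>

end

theory Submission
  imports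
    Defs
    "HOL-Library.Function_Algebras"
    "HOL-Library.Product_Lexorder"
    "HOL-Computational_Algebra.Polynomial_FPS"
begin

text \<open>
  Every minimal graded free resolution over \<open>S\<close> has length at most the number \<open>m n\<close> of
  indeterminates, so the Hilbert--Poincare polynomial of a graded module is its Hilbert series times
  \<open>(1 - z)\<close> to the power \<open>m n\<close>. An ideal generated by differences of monomials of the same degree
  identifies monomials, so the Hilbert function of its residue class ring counts classes of monomials.
  For the corner-interval minors, a class without indeterminates of the first column is a
  singleton, which gives the summand \<open>(1 - z)\<close> to the power \<open>m\<close>. In any other class let \<open>t\<close> be the
  first row that occurs; the class contains some \<open>x\<^sub>t\<^sub>1 w\<close> with \<open>w\<close> a monomial in the rows from \<open>t\<close> on,
  and \<open>w\<close> is determined exactly up to the relations of \<open>I\<^sub>2(M\<^sub>t\<^sub>,\<^sub>1)\<close>.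
\<close>

section \<open>Dimensions of vector spaces\<close>

text \<open>\<open>graded_betti\<close> reads its numbers off a resolution picked by
  \<open>SOME\<close>, and \<open>hilbert_poincare\<close> sums over all index pairs with a nonzero
  value. Nothing can be computed before a minimal resolution is known to exist and its length is
  bounded. The bound serves twice: it makes the index set finite, and it makes the telescoping sum
  of dimensions end. After that only Hilbert functions matter, so colon ideals and mapping cones are
  replaced by counting classes of monomials. The Hilbert series of \<open>S\<close> is itself the
  series of classes for an empty set of minors; hence every power of \<open>1 - fps_X\<close> comes
  from the same operation, the removal of indeterminates that occur in no relation. The factor
  \<open>z\<close> is the degree of the distinguished entry of the first column in row
  \<open>t\<close>. The factor with exponent \<open>n * (t - 1)\<close> removes the rows above
  \<open>t\<close>, which are free modulo the minors of the lower rows. For \<open>t = m\<close> a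
  single row remains and there are no minors, which is why that summand is a bare power.\<close>

lemma (in vector_space) dim_eq_card_coordinates:
  assumes fin: "finite M" and mem: "\<And>m. m \<in> M \<Longrightarrow> b m \<in> U"
    and repr: "\<And>u. u \<in> U \<Longrightarrow> \<exists>c. u = (\<Sum>m\<in>M. scale (c m) (b m))"
    and coord: "\<And>c m. m \<in> M \<Longrightarrow> \<phi> m (\<Sum>m\<in>M. scale (c m) (b m)) = c m"
  shows "dim U = card M" "U \<subseteq> span (b ` M)"
proof -
  have inj: "inj_on b M"
  proof (rule inj_onI)
    fix m m' assume m: "m \<in> M" "m' \<in> M" "b m = b m'"
    have *: "b k = (\<Sum>l\<in>M. scale (if l = k then 1 else 0) (b l))" if "k \<in> M" for k
    proof -
      have "(\<Sum>l\<in>M. scale (if l = k then 1 else 0) (b l)) = (\<Sum>l\<in>M. if l = k then b l else 0)"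
        by (rule sum.cong) auto
      then show ?thesis using that fin by (simp add: sum.delta)
    qed
    \<comment> \<open>Reading off the coefficient at \<open>m\<close> separates the vectors
      \<open>b m\<close>; the same evaluation gives independence below.\<close>
    have 1: "\<phi> m (b m) = 1" using coord[OF m(1), of "\<lambda>l. if l = m then 1 else 0"] *[OF m(1)] by simp
    have 2: "\<phi> m (b m') = (if m = m' then 1 else 0)"
      using coord[OF m(1), of "\<lambda>l. if l = m' then 1 else 0"] *[OF m(2)] by simp
    show "m = m'" using 1 2 m(3) by (metis zero_neq_one)
  qed
  have ind: "independent (b ` M)"
  proof (rule independent_if_scalars_zero)
    show "finite (b ` M)" using fin by simp
  next
    fix f x assume s: "(\<Sum>x\<in>b ` M. scale (f x) x) = 0" and "x \<in> b ` M"
    then obtain m where m: "m \<in> M" "x = b m" by auto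
    have "(\<Sum>m\<in>M. scale (f (b m)) (b m)) = 0" using s inj by (simp add: sum.reindex)
    then have "\<phi> m 0 = f (b m)" using coord[OF m(1), of "\<lambda>m. f (b m)"] by simp
    moreover have "\<phi> m 0 = 0" using coord[OF m(1), of "\<lambda>m. 0"] by simp
    ultimately show "f x = 0" using m by simp
  qed
  show sp: "U \<subseteq> span (b ` M)"
  proof
    fix u assume "u \<in> U"
    then obtain c where "u = (\<Sum>m\<in>M. scale (c m) (b m))" using repr by blast
    then show "u \<in> span (b ` M)" by (simp add: span_sum span_scale span_base)
  qed
  show "dim U = card M"
    using basis_card_eq_dim[OF _ sp ind] mem card_image[OF inj] by (simp add: image_subset_iff)
qed

text \<open>The ambient spaces used later are infinite-dimensional, so finiteness is demanded of
  \<open>U\<close> alone. A basis \<open>B\<close> of the kernel is extended to a basis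
  \<open>C\<close> of \<open>U\<close>, and \<open>f\<close> maps \<open>C - B\<close> bijectively
  to a basis of the image.\<close>

lemma (in vector_space_pair) rank_nullity:
  assumes lf: "Vector_Spaces.linear s1 s2 f" and U: "vs1.subspace U"
    and fin: "finite A" "U \<subseteq> vs1.span A"
  shows "vs1.dim U = vs1.dim {u \<in> U. f u = 0} + vs2.dim (f ` U)"
proof -
  interpret f: Vector_Spaces.linear s1 s2 f by fact
  let ?K = "{u \<in> U. f u = 0}"
  have subK: "vs1.subspace ?K"
    using U by (auto simp: vs1.subspace_def f.add f.scale f.zero)
  obtain B where B: "B \<subseteq> ?K" "vs1.independent B" "?K \<subseteq> vs1.span B"
    using vs1.maximal_independent_subset[of ?K] by auto
  obtain C where C: "B \<subseteq> C" "C \<subseteq> U" "vs1.independent C" "U \<subseteq> vs1.span C"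
    using vs1.maximal_independent_subset_extend[of B U] B by auto
  have finC: "finite C" using vs1.independent_span_bound[OF fin(1) C(3)] C(2) fin(2) by auto
  let ?D = "C - B"
  have spB: "vs1.span B \<subseteq> ?K" using B(1) subK by (simp add: vs1.span_minimal)
  \<comment> \<open>A combination of \<open>C - B\<close> killed by \<open>f\<close> lies in the
    span of \<open>B\<close>; subtracting its expansion there gives a relation within the
    independent set \<open>C\<close>.\<close>
  have key: "\<forall>x\<in>?D. g x = 0" if "f (\<Sum>x\<in>?D. s1 (g x) x) = 0" for g
  proof -
    let ?v = "\<Sum>x\<in>?D. s1 (g x) x"
    have "?v \<in> U" using C(2) U by (intro vs1.subspace_sum vs1.subspace_scale) auto
    then have "?v \<in> vs1.span B" using that B(3) by blast
    then obtain h where h: "?v = (\<Sum>x\<in>B. s1 (h x) x)"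
      using vs1.span_finite[of B] finC C(1) finite_subset by (auto simp: image_iff)
    have "(\<Sum>x\<in>C. s1 (if x \<in> B then - h x else g x) x) = 
          (\<Sum>x\<in>?D. s1 (if x \<in> B then - h x else g x) x) + (\<Sum>x\<in>B. s1 (if x \<in> B then - h x else g x) x)"
      by (rule sum.subset_diff[OF C(1) finC])
    also have "(\<Sum>x\<in>?D. s1 (if x \<in> B then - h x else g x) x) = ?v" by (rule sum.cong) auto
    also have "(\<Sum>x\<in>B. s1 (if x \<in> B then - h x else g x) x) = - ?v"
      by (simp add: h sum_negf)
    finally have "(\<Sum>x\<in>C. s1 (if x \<in> B then - h x else g x) x) = 0" by simp
    then have "\<forall>x\<in>C. (if x \<in> B then - h x else g x) = 0"
      using vs1.independentD[OF C(3) finC subset_refl, of "\<lambda>x. if x \<in> B then - h x else g x"] by blast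
    then show ?thesis by auto
  qed
  have inj: "inj_on f ?D"
  proof (rule inj_onI, rule ccontr)
    fix x y assume xy: "x \<in> ?D" "y \<in> ?D" "f x = f y" "x \<noteq> y"
    let ?g = "\<lambda>z. if z = x then 1 else if z = y then - 1 else (0::'a)"
    have "(\<Sum>z\<in>?D. s1 (?g z) z) = (\<Sum>z\<in>{x,y}. s1 (?g z) z)"
      by (rule sum.mono_neutral_right) (use finC xy in auto)
    then have "f (\<Sum>z\<in>?D. s1 (?g z) z) = 0" using xy by (simp add: f.diff)
    from bspec[OF key[OF this] xy(1)] have "?g x = 0" .
    then show False by simp
  qed
  have ind: "vs2.independent (f ` ?D)"
  proof (rule vs2.independent_if_scalars_zero)
    show "finite (f ` ?D)" using finC by simp
  next
    fix g x assume s: "(\<Sum>x\<in>f ` ?D. s2 (g x) x) = 0" and x: "x \<in> f ` ?D"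
    have "f (\<Sum>x\<in>?D. s1 (g (f x)) x) = 0"
      using s inj by (simp add: sum.reindex f.sum f.scale)
    then show "g x = 0" using key[of "\<lambda>x. g (f x)"] x by blast
  qed
  have sp: "f ` U \<subseteq> vs2.span (f ` ?D)"
  proof
    fix y assume "y \<in> f ` U"
    then obtain u where u: "u \<in> U" "y = f u" by auto
    then obtain h where h: "u = (\<Sum>x\<in>C. s1 (h x) x)"
      using vs1.span_finite[OF finC] C(4) by (auto simp: image_iff)
    have "f u = (\<Sum>x\<in>C. s2 (h x) (f x))" by (simp add: h f.sum f.scale)
    also have "\<dots> = (\<Sum>x\<in>?D. s2 (h x) (f x))"
      by (rule sum.mono_neutral_right) (use finC B(1) in auto)
    also have "\<dots> \<in> vs2.span (f ` ?D)" by (intro vs2.span_sum vs2.span_scale vs2.span_base) auto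
    finally show "y \<in> vs2.span (f ` ?D)" using u by simp
  qed
  have "vs1.dim U = card C" using vs1.basis_card_eq_dim[OF C(2,4,3)] by simp
  moreover have "vs1.dim ?K = card B" using vs1.basis_card_eq_dim[OF B(1,3,2)] by simp
  moreover have "vs2.dim (f ` U) = card ?D"
    using vs2.basis_card_eq_dim[OF image_mono sp ind] C(2) card_image[OF inj] by (metis Diff_subset subset_trans)
  ultimately show ?thesis
    using card_Diff_subset[of B C] C(1) finC card_mono[OF finC C(1)] finite_subset[OF C(1) finC] by simp
qed

section \<open>Polynomials as finitely supported functions\<close>

abbreviation keys :: "('b \<Rightarrow>\<^sub>0 'c::zero) \<Rightarrow> 'b set" where "keys \<equiv> Poly_Mapping.keys"
abbreviation lookup :: "('b \<Rightarrow>\<^sub>0 'c::zero) \<Rightarrow> 'b \<Rightarrow> 'c" where "lookup \<equiv> Poly_Mapping.lookup"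
abbreviation single :: "'b \<Rightarrow> 'c \<Rightarrow> ('b \<Rightarrow>\<^sub>0 'c::zero)" where "single \<equiv> Poly_Mapping.single"
abbreviation polys :: "'x set \<Rightarrow> ('x, 'a::field) mpoly set" where "polys V \<equiv> carrier (poly_ring V)"

lemma polys_iff: "p \<in> polys V \<longleftrightarrow> (\<forall>t\<in>keys p. keys t \<subseteq> V)"
  by (simp add: poly_ring_def)

lemma keys_plus_nat: "keys (s + t) = keys s \<union> keys (t :: 'x \<Rightarrow>\<^sub>0 nat)"
  by (auto simp: in_keys_iff lookup_add)

lemma polys_zero [simp]: "0 \<in> polys V" by (simp add: polys_iff)
lemma polys_one [simp]: "1 \<in> polys V" by (simp add: polys_iff)

lemma polys_add: "p \<in> polys V \<Longrightarrow> q \<in> polys V \<Longrightarrow> p + q \<in> polys V"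
  using keys_add[of p q] by (auto simp: polys_iff)

lemma keys_uminus [simp]: "keys (- p :: 'b \<Rightarrow>\<^sub>0 'a::ab_group_add) = keys p"
  by (auto simp: in_keys_iff)

lemma polys_uminus: "p \<in> polys V \<Longrightarrow> - p \<in> polys V"
  by (auto simp: polys_iff)

lemma polys_diff: "p \<in> polys V \<Longrightarrow> q \<in> polys V \<Longrightarrow> p - q \<in> polys V"
  using polys_add[of p V "- q"] polys_uminus[of q V] by simp

lemma polys_mult: "p \<in> polys V \<Longrightarrow> q \<in> polys V \<Longrightarrow> p * q \<in> polys V"
  using keys_mult[of p q] by (fastforce simp: polys_iff keys_plus_nat)

lemma polys_sum: "(\<And>i. i \<in> A \<Longrightarrow> f i \<in> polys V) \<Longrightarrow> sum f A \<in> polys V"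
  by (induction A rule: infinite_finite_induct) (auto intro: polys_add)

lemma polys_single: "keys t \<subseteq> V \<Longrightarrow> single t c \<in> polys V"
  by (auto simp: polys_iff)

lemma sum_singles: "(\<Sum>t\<in>keys p. single t (lookup p t)) = p"
  by (rule poly_mapping_eqI)
    (simp add: lookup_sum lookup_single when_def sum.delta' in_keys_iff cong: if_cong)

lemma lookup_single_mult: "lookup (single s c * p) (s + t) = c * lookup (p :: ('x, 'a::field) mpoly) t"
proof -
  have "single s c * p = (\<Sum>u\<in>keys p. single (s + u) (c * lookup p u))"
    by (subst sum_singles[of p, symmetric]) (simp add: sum_distrib_left mult_single)
  then show ?thesis
    by (simp add: lookup_sum lookup_single when_def sum.delta' in_keys_iff cong: if_cong)
qed

lemma lookup_single_zero_mult [simp]: "lookup (single 0 c * p) t = c * lookup (p :: ('x, 'a::field) mpoly) t"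
  using lookup_single_mult[of 0 c p t] by simp

lemma keys_single_mult_subset: "keys (single s c * (p :: ('x, 'a::field) mpoly)) \<subseteq> (\<lambda>t. s + t) ` keys p"
  using keys_mult[of "single s c" p] by (auto split: if_splits)

lemma keys_scale_subset: "keys (single 0 c * (p :: ('x, 'a::field) mpoly)) \<subseteq> keys p"
  using keys_single_mult_subset[of 0 c p] by simp

subsection \<open>Restriction of a polynomial to a set of monomials\<close>

text \<open>One operation covers two uses: homogeneous components, with \<open>P\<close> a condition
  on the degree, and setting indeterminates to zero, with \<open>P\<close> saying that none of them
  occurs.\<close>

lift_definition part :: "('b \<Rightarrow> bool) \<Rightarrow> ('b \<Rightarrow>\<^sub>0 'c::zero) \<Rightarrow> 'b \<Rightarrow>\<^sub>0 'c"
  is "\<lambda>P f t. if P t then f t else 0"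
  by (rule finite_subset) auto

lemma lookup_part: "lookup (part P p) t = (if P t then lookup p t else 0)"
  by transfer simp

lemma keys_part: "keys (part P p) = {t \<in> keys p. P t}"
  by (auto simp: in_keys_iff lookup_part split: if_splits)

lemma part_zero [simp]: "part P 0 = 0"
  by (rule poly_mapping_eqI) (simp add: lookup_part)

lemma part_add: "part P (p + q) = part P p + part P (q :: 'b \<Rightarrow>\<^sub>0 'c::monoid_add)"
  by (rule poly_mapping_eqI) (simp add: lookup_part lookup_add)

lemma part_diff: "part P (p - q) = part P p - part P (q :: 'b \<Rightarrow>\<^sub>0 'c::ab_group_add)"
  by (rule poly_mapping_eqI) (simp add: lookup_part lookup_minus)

lemma part_sum: "part P (sum f A) = (\<Sum>i\<in>A. part P (f i :: 'b \<Rightarrow>\<^sub>0 'c::comm_monoid_add))"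
  by (rule poly_mapping_eqI) (simp add: lookup_part lookup_sum)

lemma part_split: "p = part P p + part (\<lambda>t. \<not> P t) (p :: 'b \<Rightarrow>\<^sub>0 'c::monoid_add)"
  by (rule poly_mapping_eqI) (simp add: lookup_part lookup_add)

lemma part_id: "(\<And>t. t \<in> keys p \<Longrightarrow> P t) \<Longrightarrow> part P p = p"
  by (rule poly_mapping_eqI) (auto simp: lookup_part in_keys_iff)

lemma part_eq_zero: "(\<And>t. t \<in> keys p \<Longrightarrow> \<not> P t) \<Longrightarrow> part P p = 0"
  by (rule poly_mapping_eqI) (auto simp: lookup_part in_keys_iff)

lemma part_part: "part P (part Q p) = part (\<lambda>t. P t \<and> Q t) p"
  by (rule poly_mapping_eqI) (simp add: lookup_part)

lemma part_polys: "p \<in> polys V \<Longrightarrow> part P p \<in> polys V"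
  by (auto simp: polys_iff keys_part)

text \<open>Meant for homogeneous \<open>q\<close>: a component of the product then comes from a
  single component of \<open>p\<close>, shifted by the degree of \<open>q\<close>.\<close>

lemma part_mult_right:
  assumes "\<And>s t. t \<in> keys q \<Longrightarrow> P (s + t) \<longleftrightarrow> Q s"
  shows "part P (p * q) = part Q p * (q :: ('x, 'a::field) mpoly)"
proof -
  have "part P (part Q p * q) = part Q p * q"
    by (rule part_id) (use keys_mult[of "part Q p" q] assms in \<open>auto simp: keys_part\<close>)
  moreover have "part P (part (\<lambda>t. \<not> Q t) p * q) = 0"
    by (rule part_eq_zero) (use keys_mult[of "part (\<lambda>t. \<not> Q t) p" q] assms in \<open>auto simp: keys_part\<close>)
  moreover have "p * q = part Q p * q + part (\<lambda>t. \<not> Q t) p * q"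
    by (metis part_split distrib_right)
  ultimately show ?thesis by (metis part_add add.right_neutral)
qed

text \<open>The condition says that the monomials violating \<open>P\<close> absorb multiplication
  while the others are closed under it, so \<open>part P\<close> is the projection modulo an ideal
  spanned by monomials.\<close>

lemma part_mult_hom:
  assumes "\<And>s t. P (s + t) \<longleftrightarrow> P s \<and> P t"
  shows "part P (p * q) = part P p * part P (q :: ('x, 'a::field) mpoly)"
proof -
  let ?N = "part (\<lambda>t. \<not> P t)"
  have "part P (part P p * part P q) = part P p * part P q"
    by (rule part_id) (use keys_mult[of "part P p" "part P q"] assms in \<open>auto simp: keys_part\<close>)
  moreover have "part P (part P p * ?N q) = 0"
    by (rule part_eq_zero) (use keys_mult[of "part P p" "?N q"] assms in \<open>auto simp: keys_part\<close>)
  moreover have "part P (?N p * q) = 0"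
    by (rule part_eq_zero) (use keys_mult[of "?N p" q] assms in \<open>auto simp: keys_part\<close>)
  moreover have "p * q = part P p * part P q + part P p * ?N q + ?N p * q"
    by (metis part_split distrib_right distrib_left)
  ultimately show ?thesis by (metis part_add add.right_neutral)
qed

subsection \<open>Monomials\<close>

lemma monom_degree_superset:
  assumes "finite A" "keys t \<subseteq> A"
  shows "monom_degree t = (\<Sum>x\<in>A. lookup t x)"
  unfolding monom_degree_def
  by (rule sum.mono_neutral_left) (use assms in \<open>auto simp: in_keys_iff\<close>)

lemma monom_degree_zero [simp]: "monom_degree 0 = 0"
  by (simp add: monom_degree_def)

lemma monom_degree_add: "monom_degree (s + t) = monom_degree s + monom_degree t"
proof -
  have "monom_degree u = (\<Sum>x\<in>keys s \<union> keys t. lookup u x)" if "u \<in> {s, t, s + t}" for u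
    using that by (intro monom_degree_superset) (auto simp: keys_plus_nat)
  then show ?thesis by (simp add: lookup_add sum.distrib)
qed

lemma monom_degree_eq_zero [simp]: "monom_degree t = 0 \<longleftrightarrow> t = 0"
  by (auto simp: monom_degree_def in_keys_iff intro: poly_mapping_eqI)

lemma monom_degree_single [simp]: "monom_degree (single x k) = k"
  by (simp add: monom_degree_def)

definition monoms :: "'x set \<Rightarrow> nat \<Rightarrow> ('x \<Rightarrow>\<^sub>0 nat) set" where
  "monoms V d = {t. keys t \<subseteq> V \<and> monom_degree t = d}"

lemma lookup_le_monom_degree: "lookup t x \<le> monom_degree t"
  unfolding monom_degree_def
  by (cases "x \<in> keys t") (auto simp: in_keys_iff intro: member_le_sum)

lemma finite_monoms: assumes "finite V" shows "finite (monoms V d)"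
proof -
  have "inj_on lookup (monoms V d)" by (auto intro!: inj_onI poly_mapping_eqI)
  moreover have "lookup ` monoms V d \<subseteq> {f. \<forall>x. (x \<in> V \<longrightarrow> f x \<in> {0..d}) \<and> (x \<notin> V \<longrightarrow> f x = 0)}"
    using lookup_le_monom_degree by (fastforce simp: monoms_def in_keys_iff)
  moreover have "finite {f. \<forall>x. (x \<in> V \<longrightarrow> f x \<in> {0..d}) \<and> (x \<notin> V \<longrightarrow> f x = (0::nat))}"
    using assms by (intro finite_set_of_finite_funs) auto
  ultimately show ?thesis by (meson finite_imageD finite_subset)
qed

lemma monom_split:
  assumes "x \<in> keys t" shows "\<exists>s. t = single x 1 + (s :: 'x \<Rightarrow>\<^sub>0 nat)"
proof
  show "t = single x 1 + (t - single x 1)"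
    using assms by (intro poly_mapping_eqI) (auto simp: lookup_add lookup_minus lookup_single when_def in_keys_iff)
qed

lemma indet_mult_eq_zero:
  assumes "indet x * p = 0" shows "p = (0 :: ('x, 'a::field) mpoly)"
  using assms lookup_single_mult[of "single x 1" 1 p] by (auto simp: indet_def intro: poly_mapping_eqI)

lemma indet_dvd:
  assumes p: "p \<in> polys V" and x: "\<And>t. t \<in> keys p \<Longrightarrow> x \<in> keys t"
  shows "\<exists>q\<in>polys V. p = indet x * (q :: ('x, 'a::field) mpoly)"
proof
  let ?q = "\<Sum>t\<in>keys p. single (t - single x 1) (lookup p t)"
  have eq: "single x 1 + (t - single x 1) = t" if "t \<in> keys p" for t
    using x[OF that] by (intro poly_mapping_eqI) (auto simp: lookup_add lookup_minus lookup_single when_def in_keys_iff)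
  have "indet x * ?q = (\<Sum>t\<in>keys p. single t (lookup p t))"
    unfolding indet_def sum_distrib_left by (rule sum.cong) (auto simp: mult_single eq simp del: One_nat_def)
  then show "p = indet x * ?q" by (simp add: sum_singles)
  show "?q \<in> polys V"
  proof (rule polys_sum, rule polys_single)
    fix t assume t: "t \<in> keys p"
    then have "keys t \<subseteq> V" using p by (auto simp: polys_iff)
    then show "keys (t - single x 1) \<subseteq> V" using eq[OF t] keys_plus_nat by (metis le_sup_iff)
  qed
qed

subsection \<open>The polynomial ring and free modules\<close>

lemma poly_ring_simps [simp]:
  "monoid.mult (poly_ring V) = (*)" "one (poly_ring V) = 1" "zero (poly_ring V) = 0" "add (poly_ring V) = (+)"
  by (simp_all add: poly_ring_def)

lemma poly_ring_cring: "cring (poly_ring V :: ('x, 'a::field) mpoly ring)"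
proof (rule cringI)
  show "abelian_group (poly_ring V :: ('x, 'a) mpoly ring)"
  proof (rule abelian_groupI)
    fix x assume "x \<in> polys V"
    then show "\<exists>y\<in>polys V. y \<oplus>\<^bsub>poly_ring V\<^esub> x = \<zero>\<^bsub>poly_ring V\<^esub>"
      by (intro bexI[of _ "- x"]) (simp_all add: polys_uminus)
  qed (simp_all add: polys_add ac_simps)
  show "comm_monoid (poly_ring V :: ('x, 'a) mpoly ring)"
    by (rule comm_monoidI) (simp_all add: polys_mult ac_simps)
qed (simp add: distrib_right)

text \<open>The ground field acts through constant polynomials on the full function type, so free
  modules and their graded pieces are subspaces of one vector space.\<close>

definition vscale :: "'a::field \<Rightarrow> (nat \<Rightarrow> ('x, 'a) mpoly) \<Rightarrow> nat \<Rightarrow> ('x, 'a) mpoly" where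
  "vscale c v = (\<lambda>k. single 0 c * v k)"

lemma vector_space_vscale: "vector_space (vscale :: 'a::field \<Rightarrow> (nat \<Rightarrow> ('x, 'a) mpoly) \<Rightarrow> _)"
  by unfold_locales
    (auto simp: vscale_def fun_eq_iff algebra_simps single_add mult_single simp flip: mult.assoc)

lemma vector_space_fun: "vector_space (\<lambda>(a::'a::field) (f :: 'b \<Rightarrow> 'a) x. a * f x)"
  by unfold_locales (auto simp: fun_eq_iff algebra_simps)

lemma free_module_zero [simp]: "0 \<in> free_module V r" "(\<lambda>l. 0) \<in> free_module V r"
  by (auto simp: free_module_def)

lemma free_module_add: "v \<in> free_module V r \<Longrightarrow> w \<in> free_module V r \<Longrightarrow> v + w \<in> free_module V r"
  by (auto simp: free_module_def intro: polys_add)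

lemma free_module_diff: "v \<in> free_module V r \<Longrightarrow> w \<in> free_module V r \<Longrightarrow> v - w \<in> free_module V r"
  by (auto simp: free_module_def intro: polys_diff)

lemma free_module_mult:
  "p \<in> polys V \<Longrightarrow> v \<in> free_module V r \<Longrightarrow> (\<lambda>k. p * v k) \<in> free_module V r"
  by (auto simp: free_module_def intro: polys_mult)

lemma free_module_polys: "v \<in> free_module V r \<Longrightarrow> v k \<in> polys V"
  by (cases "k < r") (auto simp: free_module_def)

section \<open>Graded submodules of free modules are finitely generated\<close>

lemma mono_subsequence_nat:
  fixes \<phi> :: "nat \<Rightarrow> nat"
  shows "\<exists>g::nat \<Rightarrow> nat. strict_mono g \<and> mono (\<lambda>n. \<phi> (g n))"
proof -
  obtain g :: "nat \<Rightarrow> nat" where g: "strict_mono g" "monoseq (\<lambda>n. \<phi> (g n))"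
    using seq_monosub by blast
  show ?thesis
  proof (cases "incseq (\<lambda>n. \<phi> (g n))")
    case True
    then show ?thesis using g by blast
  next
    case False
    then have dec: "decseq (\<lambda>n. \<phi> (g n))" using g(2) by (simp add: monoseq_iff)
    \<comment> \<open>A decreasing sequence of natural numbers is constant from a position of its
      minimum on.\<close>
    define N where "N = (ARG_MIN (\<lambda>n. \<phi> (g n)) n. True)"
    have N: "\<phi> (g N) \<le> \<phi> (g n)" for n unfolding N_def by (rule arg_min_nat_le) simp
    have const: "\<phi> (g (N + n)) = \<phi> (g N)" for n
      using N[of "N + n"] decseqD[OF dec, of N "N + n"] by simp
    have "strict_mono (\<lambda>n. g (N + n))" using g(1) by (simp add: strict_mono_def)
    then show ?thesis using const by (intro exI[of _ "\<lambda>n. g (N + n)"]) (simp add: mono_def)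
  qed
qed

lemma mono_common_subsequence:
  fixes \<Phi> :: "(nat \<Rightarrow> nat) set"
  assumes "finite \<Phi>"
  shows "\<exists>g::nat \<Rightarrow> nat. strict_mono g \<and> (\<forall>\<phi>\<in>\<Phi>. mono (\<lambda>n. \<phi> (g n)))"
  using assms
proof (induction \<Phi> rule: finite_induct)
  case empty
  show ?case by (intro exI[of _ id]) (simp add: strict_mono_def)
next
  case (insert \<phi> \<Phi>)
  then obtain g :: "nat \<Rightarrow> nat" where g: "strict_mono g" "\<forall>\<phi>\<in>\<Phi>. mono (\<lambda>n. \<phi> (g n))" by blast
  obtain h :: "nat \<Rightarrow> nat" where h: "strict_mono h" "mono (\<lambda>n. \<phi> (g (h n)))"
    using mono_subsequence_nat[of "\<lambda>n. \<phi> (g n)"] by blast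
  have "strict_mono (\<lambda>n. g (h n))" using g(1) h(1) by (simp add: strict_mono_def)
  moreover have "mono (\<lambda>n. \<psi> (g (h n)))" if "\<psi> \<in> \<Phi>" for \<psi>
    using g(2) that strict_mono_mono[OF h(1)] by (simp add: mono_def)
  ultimately show ?case using h(2) by (intro exI[of _ "\<lambda>n. g (h n)"]) auto
qed

text \<open>If no finite set sufficed, one could choose an infinite sequence in which no term is a
  multiple of an earlier one in the same position. A subsequence along which all exponents increase
  contradicts this.\<close>

lemma dickson:
  fixes L :: "(nat \<times> ('x \<Rightarrow>\<^sub>0 nat)) set"
  assumes V: "finite V" and L: "\<And>k t. (k, t) \<in> L \<Longrightarrow> k < r \<and> keys t \<subseteq> V"
  shows "\<exists>L0\<subseteq>L. finite L0 \<and> (\<forall>(k, t)\<in>L. \<exists>t0 w. (k, t0) \<in> L0 \<and> t = t0 + w)"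
proof (rule ccontr)
  assume neg: "\<not> ?thesis"
  define cov where "cov A m \<longleftrightarrow> (\<exists>t0 w. (fst m, t0) \<in> A \<and> snd m = t0 + w)"
    for A and m :: "nat \<times> ('x \<Rightarrow>\<^sub>0 nat)"
  have ex: "\<exists>m\<in>L. \<not> cov A m" if "A \<subseteq> L" "finite A" for A
  proof (rule ccontr)
    assume "\<not> ?thesis"
    then have "cov A m" if "m \<in> L" for m using that by blast
    then have "\<forall>(k, t)\<in>L. \<exists>t0 w. (k, t0) \<in> A \<and> t = t0 + w" unfolding cov_def by fastforce
    then show False using neg that by blast
  qed
  have "\<exists>A. \<forall>n::nat. (A n \<subseteq> L \<and> finite (A n)) \<and> (\<exists>m\<in>L. \<not> cov (A n) m \<and> A (Suc n) = insert m (A n))"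
  proof (rule dependent_nat_choice)
    show "\<exists>A\<subseteq>L. finite A" by blast
  next
    fix A and n :: nat assume A: "A \<subseteq> L \<and> finite A"
    then obtain m where "m \<in> L" "\<not> cov A m" using ex by blast
    with A show "\<exists>B. (B \<subseteq> L \<and> finite B) \<and> (\<exists>m\<in>L. \<not> cov A m \<and> B = insert m A)"
      by (intro exI[of _ "insert m A"]) auto
  qed
  then obtain A where A: "\<And>n::nat. \<exists>m\<in>L. \<not> cov (A n) m \<and> A (Suc n) = insert m (A n)" by blast
  then obtain m where m: "\<And>n. m n \<in> L" "\<And>n. \<not> cov (A n) (m n)" "\<And>n. A (Suc n) = insert (m n) (A n)"
    by metis
  have monoA: "incseq A" by (rule incseq_SucI) (auto simp: m(3))
  have mA: "m i \<in> A j" if "i < j" for i j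
    using that m(3)[of i] monoD[OF monoA, of "Suc i" j] by auto
  \<comment> \<open>Positions are below \<open>r\<close>, so making both the position and its
    complement in \<open>r\<close> nondecreasing forces equal positions.\<close>
  let ?\<Phi> = "insert (\<lambda>n. fst (m n)) (insert (\<lambda>n. r - fst (m n)) ((\<lambda>x n. lookup (snd (m n)) x) ` V))"
  obtain g :: "nat \<Rightarrow> nat" where g: "strict_mono g" "\<forall>\<phi>\<in>?\<Phi>. mono (\<lambda>n. \<phi> (g n))"
    using mono_common_subsequence[of ?\<Phi>] V by auto
  have lt: "g 0 < g 1" using g(1) by (simp add: strict_mono_def)
  have fk: "fst (m n) < r" "keys (snd (m n)) \<subseteq> V" for n
    using L[of "fst (m n)" "snd (m n)"] m(1)[of n] by auto
  have "fst (m (g 0)) \<le> fst (m (g 1))" "r - fst (m (g 0)) \<le> r - fst (m (g 1))"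
    using g(2) by (auto simp: mono_def)
  then have 1: "fst (m (g 0)) = fst (m (g 1))" using fk(1)[of "g 0"] fk(1)[of "g 1"] by linarith
  have le: "lookup (snd (m (g 0))) x \<le> lookup (snd (m (g 1))) x" for x
  proof (cases "x \<in> V")
    case True
    then have "(\<lambda>n. lookup (snd (m n)) x) \<in> ?\<Phi>" by simp
    then have "mono (\<lambda>n. lookup (snd (m (g n))) x)" by (rule bspec[OF g(2)])
    then show ?thesis by (simp add: mono_def)
  next
    case False
    then have "x \<notin> keys (snd (m (g 0)))" using fk(2) by blast
    then show ?thesis by (simp add: in_keys_iff)
  qed
  have 2: "snd (m (g 1)) = snd (m (g 0)) + (snd (m (g 1)) - snd (m (g 0)))"
    by (rule poly_mapping_eqI) (use le in \<open>simp add: lookup_add lookup_minus\<close>)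
  have "cov (A (g 1)) (m (g 1))"
    unfolding cov_def using mA[OF lt] 1 2 by (metis prod.collapse)
  then show False using m(2) by blast
qed

section \<open>Homogeneous vectors, graded submodules and their generators\<close>

definition vec_homogeneous :: "(nat \<Rightarrow> nat) \<Rightarrow> nat \<Rightarrow> (nat \<Rightarrow> ('x, 'a::field) mpoly) \<Rightarrow> bool" where
  "vec_homogeneous s d v \<longleftrightarrow> (\<forall>k. \<forall>t\<in>keys (v k). monom_degree t + s k = d)"

definition vec_part :: "(nat \<Rightarrow> nat) \<Rightarrow> nat \<Rightarrow> (nat \<Rightarrow> ('x, 'a::field) mpoly) \<Rightarrow> nat \<Rightarrow> ('x, 'a) mpoly" where
  "vec_part s d v = (\<lambda>k. part (\<lambda>t. monom_degree t + s k = d) (v k))"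

text \<open>\<open>s k\<close> is the degree of the basis element \<open>k\<close>. Gradedness is
  closure under components, since the zero vector is homogeneous of every degree and a component may
  vanish.\<close>

definition graded_submodule ::
  "'x set \<Rightarrow> nat \<Rightarrow> (nat \<Rightarrow> nat) \<Rightarrow> (nat \<Rightarrow> ('x, 'a::field) mpoly) set \<Rightarrow> bool" where
  "graded_submodule V r s U \<longleftrightarrow> U \<subseteq> free_module V r \<and> 0 \<in> U \<and> (\<forall>v\<in>U. \<forall>w\<in>U. v + w \<in> U)
     \<and> (\<forall>p\<in>polys V. \<forall>v\<in>U. (\<lambda>k. p * v k) \<in> U) \<and> (\<forall>v\<in>U. \<forall>d. vec_part s d v \<in> U)"

text \<open>The index set is arbitrary so that generators may be given as a set, with
  \<open>D\<close> the identity, or as a numbered list; \<open>gen_reindex\<close> passes between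
  the two.\<close>

definition gen :: "'x set \<Rightarrow> 'i set \<Rightarrow> ('i \<Rightarrow> nat \<Rightarrow> ('x, 'a::field) mpoly) \<Rightarrow> (nat \<Rightarrow> ('x, 'a) mpoly) set" where
  "gen V K D = {(\<lambda>l. \<Sum>k\<in>K. c k * D k l) | c. \<forall>k\<in>K. c k \<in> polys V}"

lemma vec_homogeneous_vec_part: "vec_homogeneous s d (vec_part s d v)"
  by (auto simp: vec_homogeneous_def vec_part_def keys_part)

lemma vec_part_homogeneous: "vec_homogeneous s d v \<Longrightarrow> vec_part s d v = v"
  by (auto simp: vec_homogeneous_def vec_part_def fun_eq_iff intro!: part_id)

lemma vec_homogeneous_add:
  "vec_homogeneous s d v \<Longrightarrow> vec_homogeneous s d w \<Longrightarrow> vec_homogeneous s d (v + w)"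
  using keys_add by (fastforce simp: vec_homogeneous_def)

lemma vec_homogeneous_zero [simp]: "vec_homogeneous s d 0" "vec_homogeneous s d (\<lambda>k. 0)"
  by (simp_all add: vec_homogeneous_def)

lemma vec_homogeneous_monom_mult:
  assumes "vec_homogeneous s e v" "monom_degree w + e = d"
  shows "vec_homogeneous s d (\<lambda>k. single w c * v k)"
  unfolding vec_homogeneous_def
proof (intro allI ballI)
  fix k t assume "t \<in> keys (single w c * v k)"
  then obtain u where "t = w + u" "u \<in> keys (v k)" using keys_single_mult_subset by blast
  then show "monom_degree t + s k = d" using assms by (auto simp: vec_homogeneous_def monom_degree_add)
qed

lemma gen_add: "v \<in> gen V K D \<Longrightarrow> w \<in> gen V K D \<Longrightarrow> v + w \<in> gen V K D"
proof -
  assume "v \<in> gen V K D" "w \<in> gen V K D"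
  then obtain c d where "v = (\<lambda>l. \<Sum>k\<in>K. c k * D k l)" "\<forall>k\<in>K. c k \<in> polys V"
    "w = (\<lambda>l. \<Sum>k\<in>K. d k * D k l)" "\<forall>k\<in>K. d k \<in> polys V" unfolding gen_def by blast
  then show ?thesis unfolding gen_def
    by (intro CollectI exI[of _ "\<lambda>k. c k + d k"]) (auto simp: fun_eq_iff sum.distrib distrib_right polys_add)
qed

lemma gen_mult: "p \<in> polys V \<Longrightarrow> v \<in> gen V K D \<Longrightarrow> (\<lambda>l. p * v l) \<in> gen V K D"
proof -
  assume "p \<in> polys V" "v \<in> gen V K D"
  then obtain c where "v = (\<lambda>l. \<Sum>k\<in>K. c k * D k l)" "\<forall>k\<in>K. c k \<in> polys V" unfolding gen_def by blast
  with \<open>p \<in> polys V\<close> show ?thesis unfolding gen_def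
    by (intro CollectI exI[of _ "\<lambda>k. p * c k"]) (auto simp: fun_eq_iff sum_distrib_left mult.assoc polys_mult)
qed

lemma gen_zero [simp]: "0 \<in> gen V K D"
  unfolding gen_def by (intro CollectI exI[of _ "\<lambda>k. 0"]) (auto simp: fun_eq_iff)

lemma gen_sum: "(\<And>i. i \<in> I \<Longrightarrow> f i \<in> gen V K D) \<Longrightarrow> sum f I \<in> gen V K D"
  by (induction I rule: infinite_finite_induct) (auto intro: gen_add)

lemma gen_base: "finite K \<Longrightarrow> k \<in> K \<Longrightarrow> D k \<in> gen V K D"
  unfolding gen_def
proof (intro CollectI exI[of _ "\<lambda>j. if j = k then 1 else 0"] conjI)
  assume k: "finite K" "k \<in> K"
  have "(\<Sum>j\<in>K. (if j = k then 1 else 0) * D j l) = (\<Sum>j\<in>K. if j = k then D j l else 0)" for l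
    by (rule sum.cong) auto
  then show "D k = (\<lambda>l. \<Sum>j\<in>K. (if j = k then 1 else 0) * D j l)" using k by (simp add: fun_eq_iff)
qed auto

lemma gen_reindex: "bij_betw h K G \<Longrightarrow> gen V K (\<lambda>k. D (h k)) = gen V G D"
proof -
  assume h: "bij_betw h K G"
  show ?thesis
  proof (intro equalityI subsetI)
    fix v assume "v \<in> gen V K (\<lambda>k. D (h k))"
    then obtain c where c: "v = (\<lambda>l. \<Sum>k\<in>K. c k * D (h k) l)" "\<forall>k\<in>K. c k \<in> polys V" unfolding gen_def by blast
    let ?i = "the_inv_into K h"
    have "(\<Sum>g\<in>G. c (?i g) * D g l) = v l" for l
    proof -
      have "(\<Sum>g\<in>G. c (?i g) * D g l) = (\<Sum>k\<in>K. c (?i (h k)) * D (h k) l)"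
        by (rule sum.reindex_bij_betw[OF h, symmetric])
      also have "\<dots> = v l"
        unfolding c(1) by (rule sum.cong) (use h in \<open>auto simp: bij_betw_def the_inv_into_f_f\<close>)
      finally show ?thesis .
    qed
    then have "v = (\<lambda>l. \<Sum>g\<in>G. c (?i g) * D g l)" by auto
    moreover have "\<forall>g\<in>G. c (?i g) \<in> polys V" using c(2) h by (auto simp: bij_betw_def the_inv_into_f_f)
    ultimately show "v \<in> gen V G D" unfolding gen_def by (intro CollectI exI[of _ "\<lambda>g. c (?i g)"]) simp
  next
    fix v assume "v \<in> gen V G D"
    then obtain c where c: "v = (\<lambda>l. \<Sum>g\<in>G. c g * D g l)" "\<forall>g\<in>G. c g \<in> polys V" unfolding gen_def by blast
    have "v = (\<lambda>l. \<Sum>k\<in>K. c (h k) * D (h k) l)"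
      unfolding c(1) by (rule ext, rule sum.reindex_bij_betw[OF h, symmetric])
    moreover have "\<forall>k\<in>K. c (h k) \<in> polys V" using c(2) h by (auto simp: bij_betw_def)
    ultimately show "v \<in> gen V K (\<lambda>k. D (h k))" unfolding gen_def by (intro CollectI exI[of _ "\<lambda>k. c (h k)"]) simp
  qed
qed

lemma gen_subset:
  assumes "graded_submodule V r s U" "\<And>k. k \<in> K \<Longrightarrow> D k \<in> U" "finite K"
  shows "gen V K D \<subseteq> U"
proof
  fix v assume "v \<in> gen V K D"
  then obtain c where c: "v = (\<lambda>l. \<Sum>k\<in>K. c k * D k l)" "\<forall>k\<in>K. c k \<in> polys V" unfolding gen_def by blast
  have "(\<lambda>l. \<Sum>k\<in>K'. c k * D k l) \<in> U" if "finite K'" "K' \<subseteq> K" for K'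
    using that
  proof (induction K' rule: finite_induct)
    case empty
    then show ?case using assms(1) by (simp add: graded_submodule_def zero_fun_def)
  next
    case (insert k K')
    have "(\<lambda>l. \<Sum>k\<in>insert k K'. c k * D k l) = (\<lambda>l. c k * D k l) + (\<lambda>l. \<Sum>k\<in>K'. c k * D k l)"
      using insert by (auto simp: fun_eq_iff)
    moreover have "(\<lambda>l. c k * D k l) \<in> U" using assms c(2) insert.prems by (auto simp: graded_submodule_def)
    ultimately show ?case using insert assms(1) by (auto simp: graded_submodule_def)
  qed
  then show "v \<in> U" using c(1) assms(3) by blast
qed

text \<open>Termination measure of the division algorithm below: it drops when the leading term
  drops.\<close>

lemma card_atMost_less:
  fixes a b :: "'b::order"
  assumes "finite M" "a < b" "b \<in> M"
  shows "card {m \<in> M. m \<le> a} < card {m \<in> M. m \<le> b}"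
proof (rule psubset_card_mono)
  have "b \<notin> {m \<in> M. m \<le> a}" "b \<in> {m \<in> M. m \<le> b}" using assms by auto
  moreover have "{m \<in> M. m \<le> a} \<subseteq> {m \<in> M. m \<le> b}" using assms(2) by auto
  ultimately show "{m \<in> M. m \<le> a} \<subset> {m \<in> M. m \<le> b}" by blast
qed (use assms in simp)

definition vec_supp :: "(nat \<Rightarrow> ('x, 'a::field) mpoly) \<Rightarrow> (nat \<times> ('x \<Rightarrow>\<^sub>0 nat)) set" where
  "vec_supp v = {(k, t). t \<in> keys (v k)}"

lemma finite_vec_supp: assumes "v \<in> free_module V r" shows "finite (vec_supp v)"
proof (rule finite_subset)
  show "vec_supp v \<subseteq> (SIGMA k:{..<r}. keys (v k))"
    using assms by (force simp: vec_supp_def free_module_def not_le)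
qed auto

lemma vec_supp_empty [simp]: "vec_supp v = {} \<longleftrightarrow> v = 0"
proof
  assume e: "vec_supp v = {}"
  have "v k = 0" for k by (rule poly_mapping_eqI) (use e in \<open>auto simp: vec_supp_def in_keys_iff\<close>)
  then show "v = 0" by (simp add: fun_eq_iff)
qed (simp add: vec_supp_def)

lemma sum_fun_apply: "(\<Sum>i\<in>I. f i) x = (\<Sum>i\<in>I. f i x)"
  by (induction I rule: infinite_finite_induct) auto

lemma vec_sum_parts:
  assumes "finite (vec_supp v)"
  shows "v = (\<Sum>d\<in>(\<lambda>(k, t). monom_degree t + s k) ` vec_supp v. vec_part s d v)"
proof (rule ext, rule poly_mapping_eqI)
  fix k t
  let ?D = "(\<lambda>(k, t). monom_degree t + s k) ` vec_supp v"
  have fin: "finite ?D" using assms by simp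
  have "lookup ((\<Sum>d\<in>?D. vec_part s d v) k) t = (\<Sum>d\<in>?D. if monom_degree t + s k = d then lookup (v k) t else 0)"
    by (simp add: sum_fun_apply lookup_sum vec_part_def lookup_part)
  also have "\<dots> = (if monom_degree t + s k \<in> ?D then lookup (v k) t else 0)"
    using fin by simp
  also have "\<dots> = lookup (v k) t"
    by (auto simp: vec_supp_def in_keys_iff image_iff)
  finally show "lookup (v k) t = lookup ((\<Sum>d\<in>?D. vec_part s d v) k) t" by simp
qed

text \<open>Division with remainder by a Groebner basis, for the lexicographic order on pairs of a position
  and a monomial.\<close>

lemma graded_submodule_finitely_generated:
  fixes U :: "(nat \<Rightarrow> ('x::linorder, 'a::field) mpoly) set"
  assumes V: "finite V" and U: "graded_submodule V r s U"
  shows "\<exists>G. finite G \<and> G \<subseteq> U \<and> (\<forall>g\<in>G. \<exists>d. vec_homogeneous s d g) \<and> U = gen V G (\<lambda>g. g)"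
proof -
  define H where "H = {v \<in> U. v \<noteq> 0 \<and> (\<exists>d. vec_homogeneous s d v)}"
  define lead where "lead v = Max (vec_supp v)" for v :: "nat \<Rightarrow> ('x, 'a) mpoly"
  have UF: "U \<subseteq> free_module V r" using U by (simp add: graded_submodule_def)
  have fins: "finite (vec_supp v)" if "v \<in> U" for v using finite_vec_supp UF that by blast
  have lead: "lead v \<in> vec_supp v" "\<And>m. m \<in> vec_supp v \<Longrightarrow> m \<le> lead v" if "v \<in> U" "v \<noteq> 0" for v
    using that fins[OF that(1)] by (auto simp: lead_def intro!: Max_in)
  have suppV: "k < r \<and> keys t \<subseteq> V" if "v \<in> U" "(k, t) \<in> vec_supp v" for v k t
    using that UF by (cases "k < r") (auto simp: vec_supp_def free_module_def polys_iff)
  \<comment> \<open>Dickson's lemma, applied to the leading terms of all nonzero homogeneous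
    elements; \<open>G\<close> then takes one element for each term in \<open>L0\<close>.\<close>
  obtain L0 where L0: "L0 \<subseteq> lead ` H" "finite L0" "\<forall>(k, t)\<in>lead ` H. \<exists>t0 w. (k, t0) \<in> L0 \<and> t = t0 + w"
  proof -
    have "k < r \<and> keys t \<subseteq> V" if kt: "(k, t) \<in> lead ` H" for k t
    proof -
      obtain v where "v \<in> U" "v \<noteq> 0" "lead v = (k, t)" using kt by (auto simp: H_def)
      then show ?thesis using suppV[of v k t] lead(1)[of v] by simp
    qed
    from dickson[OF V this] show ?thesis using that by blast
  qed
  obtain G where G: "G \<subseteq> H" "finite G" "L0 = lead ` G"
    using finite_subset_image[OF L0(2,1)] by blast
  have GU: "G \<subseteq> U" using G(1) by (auto simp: H_def)
  let ?gen = "gen V G (\<lambda>g. g)"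
  have finM: "finite ({..<r} \<times> (\<Union>e\<le>d. monoms V e))" for d using finite_monoms[OF V] by simp
  \<comment> \<open>The measure counts the candidates for terms up to the leading one. They are
    finite in number: shifts are natural numbers, so the monomials in a vector of degree
    \<open>d\<close> have degree at most \<open>d\<close>.\<close>
  have hom: "v \<in> ?gen" if "v \<in> U" "vec_homogeneous s d v" for v d
    using that
  proof (induction "card {m \<in> {..<r} \<times> (\<Union>e\<le>d. monoms V e). m \<le> lead v}" arbitrary: v rule: less_induct)
    case less
    show ?case
    proof (cases "v = 0")
      case False
      let ?M = "{..<r} \<times> (\<Union>e\<le>d. monoms V e)"
      obtain k t where kt: "lead v = (k, t)" by fastforce
      have "v \<in> H" using less False by (auto simp: H_def)
      then obtain t0 w where tw: "(k, t0) \<in> L0" "t = t0 + w" using L0(3) kt by force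
      then obtain g where g: "g \<in> G" "lead g = (k, t0)" using G(3) by force
      have gU: "g \<in> U" "g \<noteq> 0" using g(1) G(1) by (auto simp: H_def)
      obtain e where e: "vec_homogeneous s e g" using g(1) G(1) by (auto simp: H_def)
      have kg: "t0 \<in> keys (g k)" using lead(1)[OF gU] g(2) by (simp add: vec_supp_def)
      have kv: "t \<in> keys (v k)" using lead(1)[OF less.prems(1) False] kt by (simp add: vec_supp_def)
      have deg: "monom_degree w + e = d"
      proof -
        have "monom_degree t0 + s k = e" "monom_degree t + s k = d"
          using kg kv e less.prems(2) by (auto simp: vec_homogeneous_def)
        then show ?thesis using tw(2) by (simp add: monom_degree_add)
      qed
      have keyst: "keys t \<subseteq> V" using suppV[OF less.prems(1), of k t] kv by (simp add: vec_supp_def)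
      \<comment> \<open>This factor cancels the leading coefficient of \<open>v\<close>. Adding
        \<open>w\<close> preserves the order of monomials, so no larger term appears.\<close>
      define c where "c = - (lookup (v k) t / lookup (g k) t0)"
      let ?h = "\<lambda>l. single w c * g l"
      have wV: "single w c \<in> polys V" using keyst tw(2) by (intro polys_single) (simp add: keys_plus_nat)
      have hU: "?h \<in> U" using U gU(1) wV by (simp add: graded_submodule_def)
      let ?v = "v + ?h"
      have vU: "?v \<in> U" using U hU less.prems(1) by (simp add: graded_submodule_def)
      have vh: "vec_homogeneous s d ?v"
        using vec_homogeneous_add[OF less.prems(2) vec_homogeneous_monom_mult[OF e deg]] .
      have hgen: "(\<lambda>l. single w (- c) * g l) \<in> ?gen"
      proof -
        have "single w (- c) \<in> polys V" using wV by (simp add: single_uminus polys_uminus)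
        then show ?thesis using gen_mult[OF _ gen_base[OF G(2) g(1), of "\<lambda>g. g"]] by blast
      qed
      have "?v \<in> ?gen"
      proof (cases "?v = 0")
        case vnz: False
        have "lookup (?v k) t = 0"
          using kg lookup_single_mult[of w c "g k" t0] tw(2) by (simp add: lookup_add c_def in_keys_iff add.commute)
        then have ne: "lead ?v \<noteq> (k, t)" using lead(1)[OF vU vnz] by (auto simp: vec_supp_def in_keys_iff)
        have "m \<le> (k, t)" if m: "m \<in> vec_supp ?v" for m
        proof -
          obtain l u where lu: "m = (l, u)" by fastforce
          then consider "u \<in> keys (v l)" | "u \<in> keys (?h l)"
            using m keys_add[of "v l" "?h l"] by (auto simp: vec_supp_def)
          then show ?thesis
          proof cases
            case 1
            then show ?thesis using lead(2)[OF less.prems(1) False, of m] kt lu by (simp add: vec_supp_def)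
          next
            case 2
            then obtain u' where u': "u = w + u'" "u' \<in> keys (g l)" using keys_single_mult_subset by blast
            then have "(l, u') \<le> (k, t0)" using lead(2)[OF gU, of "(l, u')"] g(2) by (simp add: vec_supp_def)
            then show ?thesis using tw(2) u'(1) lu by (auto simp: add.commute intro: add_left_mono)
          qed
        qed
        then have lt: "lead ?v < lead v" using ne lead(1)[OF vU vnz] kt by (metis order.not_eq_order_implies_strict)
        have "lead v \<in> ?M"
        proof -
          have "monom_degree t + s k = d" using kv less.prems(2) by (auto simp: vec_homogeneous_def)
          moreover have "k < r" using suppV[OF less.prems(1), of k t] kv by (simp add: vec_supp_def)
          ultimately show ?thesis using keyst kt by (auto simp: monoms_def)
        qed
        with lt finM have "card {m \<in> ?M. m \<le> lead ?v} < card {m \<in> ?M. m \<le> lead v}"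
          by (intro card_atMost_less)
        then show ?thesis by (rule less.hyps[OF _ vU vh])
      qed simp
      then have "?v + (\<lambda>l. single w (- c) * g l) \<in> ?gen" using hgen by (rule gen_add)
      also have "?v + (\<lambda>l. single w (- c) * g l) = v" by (simp add: fun_eq_iff single_uminus)
      finally show ?thesis .
    qed simp
  qed
  have "U \<subseteq> ?gen"
  proof
    fix v assume v: "v \<in> U"
    have part: "vec_part s d v \<in> ?gen" for d
    proof (rule hom)
      show "vec_part s d v \<in> U" using v U by (simp add: graded_submodule_def)
    qed (rule vec_homogeneous_vec_part)
    have "(\<Sum>d\<in>(\<lambda>(k, t). monom_degree t + s k) ` vec_supp v. vec_part s d v) \<in> ?gen"
      by (rule gen_sum, rule part)
    then show "v \<in> ?gen" by (rule ssubst[OF vec_sum_parts[OF fins[OF v], of s], where P = "\<lambda>w. w \<in> ?gen"])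
  qed
  moreover have "?gen \<subseteq> U" by (rule gen_subset[OF U _ G(2)]) (use GU in blast)
  ultimately have "U = ?gen" by blast
  moreover have "\<forall>g\<in>G. \<exists>d. vec_homogeneous s d g" using G(1) by (auto simp: H_def)
  ultimately show ?thesis using G(2) GU by blast
qed

text \<open>A homogeneous generating set of least cardinality is taken. A homogeneous relation with
  a nonzero constant coefficient would express one generator by the others. The clause on relations
  becomes the minimality of the next differential.\<close>

lemma minimal_homogeneous_generators:
  fixes U :: "(nat \<Rightarrow> ('x::linorder, 'a::field) mpoly) set"
  assumes V: "finite V" and U: "graded_submodule V r s U"
  shows "\<exists>r' s' D. (\<forall>k<r'. D k \<in> U \<and> vec_homogeneous s (s' k) (D k)) \<and> U = gen V {..<r'} D \<and>
    (\<forall>c\<in>free_module V r'. \<forall>e. vec_homogeneous s' e c \<longrightarrow> (\<forall>l. (\<Sum>k<r'. c k * D k l) = 0) \<longrightarrow>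
        (\<forall>k<r'. lookup (c k) 0 = 0))"
proof -
  define P where "P G \<longleftrightarrow> finite G \<and> G \<subseteq> U \<and> (\<forall>g\<in>G. \<exists>d. vec_homogeneous s d g) \<and> U = gen V G (\<lambda>g. g)" for G
  have "\<exists>G. P G" using graded_submodule_finitely_generated[OF V U] unfolding P_def .
  then obtain G where G: "P G" and Gmin: "\<And>G'. P G' \<Longrightarrow> card G \<le> card G'"
    using arg_min_natI[of P _ card] arg_min_nat_le[of P _ card] by blast
  have finG: "finite G" using G by (simp add: P_def)
  obtain D where D: "bij_betw D {..<card G} G"
    using ex_bij_betw_nat_finite[OF finG] by (auto simp: atLeast0LessThan)
  have Dk: "D k \<in> G" if "k < card G" for k using D that by (auto simp: bij_betw_def)
  then have "\<forall>k. \<exists>d. k < card G \<longrightarrow> vec_homogeneous s d (D k)" using G by (auto simp: P_def)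
  then obtain s' where s': "\<And>k. k < card G \<Longrightarrow> vec_homogeneous s (s' k) (D k)" by metis
  have "lookup (c k0) 0 = 0"
    if c: "c \<in> free_module V (card G)" "vec_homogeneous s' e c" "\<forall>l. (\<Sum>k<card G. c k * D k l) = 0"
      and k0: "k0 < card G" for c e k0
  proof (rule ccontr)
    assume nz: "lookup (c k0) 0 \<noteq> 0"
    let ?a = "lookup (c k0) 0" and ?K = "{..<card G} - {k0}"
    \<comment> \<open>A homogeneous entry with a constant term is a constant, here nonzero and thus
      a unit, so the relation can be solved for \<open>D k0\<close>.\<close>
    have "0 \<in> keys (c k0)" using nz by (simp add: in_keys_iff)
    then have "s' k0 = e" using c(2) by (force simp: vec_homogeneous_def)
    then have "t = 0" if "t \<in> keys (c k0)" for t using c(2) that by (force simp: vec_homogeneous_def)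
    then have ck0: "c k0 = single 0 ?a"
      by (intro poly_mapping_eqI) (auto simp: lookup_single when_def in_keys_iff)
    have sum0: "(\<Sum>k\<in>?K. c k * D k l) = - (c k0 * D k0 l)" for l
      using c(3) k0 sum.remove[of "{..<card G}" k0 "\<lambda>k. c k * D k l"]
      by (simp add: eq_neg_iff_add_eq_0 add.commute)
    let ?i = "single 0 (- inverse ?a)"
    have Dk0: "D k0 = (\<lambda>l. \<Sum>k\<in>?K. (?i * c k) * D k l)"
    proof
      fix l
      have "(\<Sum>k\<in>?K. (?i * c k) * D k l) = ?i * (\<Sum>k\<in>?K. c k * D k l)"
        by (simp add: sum_distrib_left mult.assoc)
      also have "\<dots> = (- ?i * c k0) * D k0 l" by (simp add: sum0 mult.assoc)
      also have "- ?i * c k0 = 1" by (subst ck0) (use nz in \<open>simp add: mult_single flip: single_uminus\<close>)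
      finally show "D k0 l = (\<Sum>k\<in>?K. (?i * c k) * D k l)" by simp
    qed
    have gK: "D k0 \<in> gen V ?K D"
      unfolding gen_def using Dk0 c(1) free_module_polys
      by (intro CollectI exI[of _ "\<lambda>k. ?i * c k"]) (auto intro!: polys_mult polys_single)
    have "bij_betw D ?K (G - {D k0})"
      using D k0 by (auto simp: bij_betw_def inj_on_def)
    then have re: "gen V ?K D = gen V (G - {D k0}) (\<lambda>g. g)" using gen_reindex[of D ?K _ V "\<lambda>g. g"] by simp
    have "U \<subseteq> gen V ?K D"
    proof
      fix u assume "u \<in> U"
      then have "u \<in> gen V {..<card G} D" using G gen_reindex[OF D, of V "\<lambda>g. g"] by (simp add: P_def)
      then obtain b where b: "u = (\<lambda>l. \<Sum>k<card G. b k * D k l)" "\<forall>k<card G. b k \<in> polys V"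
        unfolding gen_def by auto
      have "u = (\<lambda>l. b k0 * D k0 l) + (\<lambda>l. \<Sum>k\<in>?K. b k * D k l)"
        unfolding b(1) using k0 by (auto simp: fun_eq_iff sum.remove)
      moreover have "(\<lambda>l. b k0 * D k0 l) \<in> gen V ?K D" using gen_mult gK b(2) k0 by blast
      moreover have "(\<lambda>l. \<Sum>k\<in>?K. b k * D k l) \<in> gen V ?K D" unfolding gen_def using b(2) by auto
      ultimately show "u \<in> gen V ?K D" using gen_add by simp
    qed
    moreover have "gen V ?K D \<subseteq> U"
    proof (rule gen_subset[OF U])
      show "D k \<in> U" if "k \<in> ?K" for k using Dk[of k] that G unfolding P_def by blast
    qed simp
    ultimately have "P (G - {D k0})" using G re by (auto simp: P_def)
    then have "card G \<le> card (G - {D k0})" by (rule Gmin)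
    then show False using Dk[OF k0] finG by (metis card_Diff1_less not_le)
  qed
  then have rel: "\<forall>c\<in>free_module V (card G). \<forall>e. vec_homogeneous s' e c \<longrightarrow> (\<forall>l. (\<Sum>k<card G. c k * D k l) = 0)
      \<longrightarrow> (\<forall>k<card G. lookup (c k) 0 = 0)" by blast
  have "U = gen V {..<card G} D" using G gen_reindex[OF D, of V "\<lambda>g. g"] by (simp add: P_def)
  moreover have "D k \<in> U" if "k < card G" for k using Dk[OF that] G unfolding P_def by blast
  ultimately show ?thesis
    using s' rel by (intro exI[of _ "card G"] exI[of _ s'] exI[of _ D] conjI) simp_all
qed

section \<open>Existence of minimal graded free resolutions\<close>

lemma finsum_poly_ring:
  assumes "finite A" "\<And>k. k \<in> A \<Longrightarrow> f k \<in> polys V"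
  shows "finsum (poly_ring V) f A = sum f A"
proof -
  interpret cring "poly_ring V" by (rule poly_ring_cring)
  show ?thesis using assms
    by (induction A rule: finite_induct) (simp_all add: finsum_insert Pi_iff)
qed

lemma graded_quotient_simps:
  "carrier (graded_quotient V I) = carrier (poly_ring V Quot I)"
  "zero (graded_quotient V I) = zero (poly_ring V Quot I)"
  "module.smult (graded_quotient V I) = (\<lambda>f c. (I +>\<^bsub>poly_ring V\<^esub> f) \<otimes>\<^bsub>poly_ring V Quot I\<^esub> c)"
  "component (graded_quotient V I) j = (\<lambda>f. I +>\<^bsub>poly_ring V\<^esub> f) ` homogeneous_part V j"
  "add (graded_quotient V I) = add (poly_ring V Quot I)"
  by (simp_all add: graded_quotient_def Let_def)

lemma homogeneous_part_iff:
  "p \<in> homogeneous_part V j \<longleftrightarrow> p \<in> polys V \<and> (\<forall>t\<in>keys p. monom_degree t = j)"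
  by (auto simp: homogeneous_part_def)

context
  fixes V :: "'x set" and I :: "('x, 'a::field) mpoly set"
  assumes I: "ideal I (poly_ring V)"
begin

lemma coset_hom: "ring_hom_cring (poly_ring V) (poly_ring V Quot I) ((+>\<^bsub>poly_ring V\<^esub>) I)"
proof -
  interpret cring "poly_ring V" by (rule poly_ring_cring)
  interpret ideal I "poly_ring V" by (rule I)
  show ?thesis by (rule rcos_ring_hom_cring[OF cring_axioms])
qed

lemma coset_eq_zero_iff:
  assumes "p \<in> polys V" shows "I +>\<^bsub>poly_ring V\<^esub> p = \<zero>\<^bsub>graded_quotient V I\<^esub> \<longleftrightarrow> p \<in> I"
proof -
  interpret cring "poly_ring V" by (rule poly_ring_cring)
  interpret ideal I "poly_ring V" by (rule I)
  have "\<zero>\<^bsub>graded_quotient V I\<^esub> = I" by (simp add: graded_quotient_simps FactRing_def)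
  then show ?thesis using assms a_rcos_const a_rcos_self by blast
qed

lemma carrier_graded_quotient: "carrier (graded_quotient V I) = (\<lambda>p. I +>\<^bsub>poly_ring V\<^esub> p) ` polys V"
  by (auto simp: graded_quotient_simps FactRing_def A_RCOSETS_def')

lemma finsum_graded_quotient:
  assumes "finite A" "f \<in> A \<rightarrow> carrier (poly_ring V Quot I)"
  shows "finsum (graded_quotient V I) f A = finsum (poly_ring V Quot I) f A"
proof -
  interpret h: ring_hom_cring "poly_ring V" "poly_ring V Quot I" "(+>\<^bsub>poly_ring V\<^esub>) I" by (rule coset_hom)
  interpret N: abelian_monoid "graded_quotient V I"
    by (rule abelian_monoidI) (simp_all add: graded_quotient_simps h.S.a_ac)
  show ?thesis using assms
    by (induction A rule: finite_induct) (simp_all add: graded_quotient_simps Pi_iff)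
qed

text \<open>With representatives \<open>f k\<close> for the images of the basis, the augmentation
  becomes a computation with polynomials followed by one passage to cosets.\<close>

lemma augmentation_graded_quotient:
  assumes f: "\<And>k. k < rank F 0 \<Longrightarrow> f k \<in> polys V \<and> aug F k = I +>\<^bsub>poly_ring V\<^esub> f k"
    and v: "\<And>k. k < rank F 0 \<Longrightarrow> v k \<in> polys V"
  shows "augmentation (graded_quotient V I) F v = I +>\<^bsub>poly_ring V\<^esub> (\<Sum>k<rank F 0. v k * f k)"
proof -
  let ?S = "poly_ring V :: ('x, 'a) mpoly ring" and ?Q = "poly_ring V Quot I"
  interpret h: ring_hom_cring ?S ?Q "(+>\<^bsub>?S\<^esub>) I" by (rule coset_hom)
  have "augmentation (graded_quotient V I) F v
      = (\<Oplus>\<^bsub>?Q\<^esub>k\<in>{..<rank F 0}. (I +>\<^bsub>?S\<^esub> v k) \<otimes>\<^bsub>?Q\<^esub> aug F k)"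
    unfolding augmentation_def graded_quotient_simps
    by (rule finsum_graded_quotient) (use f v h.hom_closed in auto)
  also have "\<dots> = (\<Oplus>\<^bsub>?Q\<^esub>k\<in>{..<rank F 0}. I +>\<^bsub>?S\<^esub> (v k * f k))"
  proof (rule h.S.finsum_cong')
    show "(\<lambda>k. I +>\<^bsub>?S\<^esub> (v k * f k)) \<in> {..<rank F 0} \<rightarrow> carrier ?Q"
      using f v polys_mult h.hom_closed by blast
    fix k assume "k \<in> {..<rank F 0}"
    then show "(I +>\<^bsub>?S\<^esub> v k) \<otimes>\<^bsub>?Q\<^esub> aug F k = I +>\<^bsub>?S\<^esub> (v k * f k)"
      using f[of k] v[of k] h.hom_mult[of "v k" "f k"] by simp
  qed simp
  also have "\<dots> = I +>\<^bsub>?S\<^esub> (\<Oplus>\<^bsub>?S\<^esub>k\<in>{..<rank F 0}. v k * f k)"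
    by (subst h.hom_finsum) (use f v in \<open>auto simp: o_def intro: polys_mult\<close>)
  also have "(\<Oplus>\<^bsub>?S\<^esub>k\<in>{..<rank F 0}. v k * f k) = (\<Sum>k<rank F 0. v k * f k)"
    by (intro finsum_poly_ring) (use f v in \<open>auto intro: polys_mult\<close>)
  finally show ?thesis .
qed

end

text \<open>The shifts \<open>s'\<close> are chosen so that the map has degree 0, and such a map
  commutes with taking components.\<close>

lemma vec_part_linear_combination:
  assumes "\<And>k. k < r \<Longrightarrow> vec_homogeneous s (s' k) (D k)"
  shows "vec_part s d (\<lambda>l. \<Sum>k<r. v k * D k l) = (\<lambda>l. \<Sum>k<r. vec_part s' d v k * D k l)"
proof
  fix l
  have "part (\<lambda>t. monom_degree t + s l = d) (v k * D k l) = vec_part s' d v k * D k l" if "k < r" for k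
    unfolding vec_part_def
  proof (rule part_mult_right)
    fix u t assume "t \<in> keys (D k l)"
    then have "monom_degree t + s l = s' k" using assms[OF that] by (simp add: vec_homogeneous_def)
    then show "(monom_degree (u + t) + s l = d) = (monom_degree u + s' k = d)" by (simp add: monom_degree_add add.assoc)
  qed
  then show "vec_part s d (\<lambda>l. \<Sum>k<r. v k * D k l) l = (\<Sum>k<r. vec_part s' d v k * D k l)"
    by (simp add: vec_part_def part_sum)
qed

lemma vec_part_free_module: "v \<in> free_module V r \<Longrightarrow> vec_part s d v \<in> free_module V r"
  by (auto simp: free_module_def vec_part_def part_polys)

lemma graded_submodule_kernel:
  fixes D :: "nat \<Rightarrow> nat \<Rightarrow> ('x, 'a::field) mpoly"
  assumes D: "\<And>k. k < r \<Longrightarrow> vec_homogeneous s (s' k) (D k)"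
  shows "graded_submodule V r s' {v \<in> free_module V r. (\<lambda>l. \<Sum>k<r. v k * D k l) = (\<lambda>l. 0)}"
proof -
  have "(\<lambda>l. \<Sum>k<r. vec_part s' d v k * D k l) = (\<lambda>l. 0)"
    if "(\<lambda>l. \<Sum>k<r. v k * D k l) = (\<lambda>l. 0)" for d v
  proof -
    have "(\<lambda>l. \<Sum>k<r. vec_part s' d v k * D k l) = vec_part s d (\<lambda>l. \<Sum>k<r. v k * D k l)"
      by (rule vec_part_linear_combination[OF D, symmetric])
    then show ?thesis unfolding that by (simp add: vec_part_def)
  qed
  moreover have "(\<Sum>k<r. (p * v k) * D k l) = p * (\<Sum>k<r. v k * D k l)" for p v l
    by (simp add: sum_distrib_left mult.assoc)
  ultimately show ?thesis
    unfolding graded_submodule_def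
    by (auto simp: fun_eq_iff distrib_right sum.distrib
        intro: free_module_add free_module_mult vec_part_free_module)
qed

lemma gen_lessThan: "gen V {..<r} D = (\<lambda>v l. \<Sum>k<r. v k * D k l) ` free_module V r"
proof (intro equalityI subsetI)
  fix u assume "u \<in> gen V {..<r} D"
  then obtain c where c: "u = (\<lambda>l. \<Sum>k<r. c k * D k l)" "\<forall>k<r. c k \<in> polys V" unfolding gen_def by auto
  have "(\<lambda>k. if k < r then c k else 0) \<in> free_module V r" using c(2) by (simp add: free_module_def)
  moreover have "u = (\<lambda>l. \<Sum>k<r. (if k < r then c k else 0) * D k l)" unfolding c(1) by simp
  ultimately show "u \<in> (\<lambda>v l. \<Sum>k<r. v k * D k l) ` free_module V r"
    by (intro image_eqI[of _ _ "\<lambda>k. if k < r then c k else 0"])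
next
  fix u assume "u \<in> (\<lambda>v l. \<Sum>k<r. v k * D k l) ` free_module V r"
  then show "u \<in> gen V {..<r} D" unfolding gen_def by (auto simp: free_module_def)
qed

text \<open>The resolution is built by iterating minimal generators of kernels, starting from
  \<open>S\<close> over \<open>S/I\<close>. The assumption on constant coefficients makes the
  differential onto \<open>I\<close> minimal as well.\<close>

lemma ex_minimal_graded_free_resolution:
  fixes V :: "'x::linorder set" and I :: "('x, 'a::field) mpoly set"
  assumes V: "finite V" and I: "ideal I (poly_ring V)"
    and hom: "\<And>p d. p \<in> I \<Longrightarrow> part (\<lambda>t. monom_degree t = d) p \<in> I"
    and const: "\<And>p. p \<in> I \<Longrightarrow> lookup p 0 = 0"
  shows "\<exists>F. minimal_graded_free_resolution V (graded_quotient V I) F"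
proof -
  interpret R: cring "poly_ring V :: ('x, 'a) mpoly ring" by (rule poly_ring_cring)
  interpret I: ideal I "poly_ring V" by (rule I)
  let ?z = "\<lambda>_. 0 :: nat"
  define U0 where "U0 = {v \<in> free_module V 1. v 0 \<in> I}"
  \<comment> \<open>A state consists of the rank and shifts of the current free module and the
    submodule \<open>U\<close> to be covered by the next one. The absence of constants in
    homogeneous elements of \<open>U\<close> is the invariant that yields minimality.\<close>
  define P where "P n X \<longleftrightarrow> (case X of (r, s, U) \<Rightarrow> graded_submodule V r s U \<and>
      (\<forall>v\<in>U. \<forall>d. vec_homogeneous s d v \<longrightarrow> (\<forall>k<r. lookup (v k) 0 = 0)) \<and>
      (n = 0 \<longrightarrow> r = 1 \<and> s = ?z \<and> U = U0))"
    for n :: nat and X :: "nat \<times> (nat \<Rightarrow> nat) \<times> (nat \<Rightarrow> ('x, 'a) mpoly) set"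
  \<comment> \<open>Transition: a new free module is mapped onto \<open>U\<close>, and the kernel of
    this map is the next submodule.\<close>
  define Q where "Q X X' \<longleftrightarrow> (case X of (r, s, U) \<Rightarrow> case X' of (r', s', U') \<Rightarrow>
      \<exists>D. (\<forall>k<r'. D k \<in> U \<and> vec_homogeneous s (s' k) (D k)) \<and> U = gen V {..<r'} D \<and>
          U' = {v \<in> free_module V r'. (\<lambda>l. \<Sum>k<r'. v k * D k l) = (\<lambda>l. 0)})"
    for X X' :: "nat \<times> (nat \<Rightarrow> nat) \<times> (nat \<Rightarrow> ('x, 'a) mpoly) set"
  have "\<exists>f. \<forall>n. P n (f n) \<and> Q (f n) (f (Suc n))"
  proof (rule dependent_nat_choice)
    have "vec_part ?z d v \<in> U0" if "v \<in> U0" for v d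
      using that hom vec_part_free_module[of v V 1 ?z d] by (auto simp: U0_def vec_part_def)
    then have "graded_submodule V 1 ?z U0"
      unfolding graded_submodule_def
      using I.zero_closed I.a_closed I.I_l_closed
      by (auto simp: U0_def intro: free_module_add free_module_mult)
    then have "P 0 (1, ?z, U0)" using const by (auto simp: P_def U0_def)
    then show "\<exists>X. P 0 X" ..
  next
    fix X n assume PX: "P n X"
    obtain r s U where X: "X = (r, s, U)" by (cases X)
    then have "graded_submodule V r s U" using PX by (simp add: P_def)
    from minimal_homogeneous_generators[OF V this] obtain r' s' D where D:
      "\<forall>k<r'. D k \<in> U \<and> vec_homogeneous s (s' k) (D k)" "U = gen V {..<r'} D"
      "\<forall>c\<in>free_module V r'. \<forall>e. vec_homogeneous s' e c \<longrightarrow> (\<forall>l. (\<Sum>k<r'. c k * D k l) = 0) \<longrightarrow>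
        (\<forall>k<r'. lookup (c k) 0 = 0)" by blast
    let ?U = "{v \<in> free_module V r'. (\<lambda>l. \<Sum>k<r'. v k * D k l) = (\<lambda>l. 0)}"
    have "graded_submodule V r' s' ?U" using D(1) by (intro graded_submodule_kernel) auto
    then have "P (Suc n) (r', s', ?U)" using D(3) by (auto simp: P_def fun_eq_iff)
    moreover have "Q X (r', s', ?U)" unfolding Q_def X prod.case using D(1,2) by blast
    ultimately show "\<exists>X'. P (Suc n) X' \<and> Q X X'" by blast
  qed
  then obtain f where f: "\<And>n. P n (f n)" "\<And>n. Q (f n) (f (Suc n))" by blast
  define r s U where "r n = fst (f n)" and "s n = fst (snd (f n))" and "U n = snd (snd (f n))" for n
  have f_eq: "f n = (r n, s n, U n)" for n by (simp add: r_def s_def U_def)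
  have sub: "graded_submodule V (r n) (s n) (U n)" 
    and min: "\<And>v d k. v \<in> U n \<Longrightarrow> vec_homogeneous (s n) d v \<Longrightarrow> k < r n \<Longrightarrow> lookup (v k) 0 = 0" for n
    using f(1)[of n] by (auto simp: P_def f_eq)
  have zero: "r 0 = 1" "s 0 = ?z" "U 0 = U0" using f(1)[of 0] by (auto simp: P_def f_eq)
  have "\<forall>n. \<exists>D. (\<forall>k<r (Suc n). D k \<in> U n \<and> vec_homogeneous (s n) (s (Suc n) k) (D k)) \<and>
      U n = gen V {..<r (Suc n)} D \<and>
      U (Suc n) = {v \<in> free_module V (r (Suc n)). (\<lambda>l. \<Sum>k<r (Suc n). v k * D k l) = (\<lambda>l. 0)}"
    using f(2) by (simp add: Q_def f_eq)
  from choice[OF this] obtain D where D_all: "\<forall>n. (\<forall>k<r (Suc n). D n k \<in> U n \<and> vec_homogeneous (s n) (s (Suc n) k) (D n k)) \<and>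
      U n = gen V {..<r (Suc n)} (D n) \<and>
      U (Suc n) = {v \<in> free_module V (r (Suc n)). (\<lambda>l. \<Sum>k<r (Suc n). v k * D n k l) = (\<lambda>l. 0)}" ..
  have D: "\<And>k. k < r (Suc n) \<Longrightarrow> D n k \<in> U n \<and> vec_homogeneous (s n) (s (Suc n) k) (D n k)"
    "U n = gen V {..<r (Suc n)} (D n)"
    "U (Suc n) = {v \<in> free_module V (r (Suc n)). (\<lambda>l. \<Sum>k<r (Suc n). v k * D n k l) = (\<lambda>l. 0)}" for n
    using spec[OF D_all, of n] by blast+
  define F where "F = \<lparr>rank = r, shift = s, diff = D, aug = (\<lambda>_::nat. I +>\<^bsub>poly_ring V\<^esub> 1)\<rparr>"
  have F: "rank F = r" "shift F = s" "diff F = D" "aug F = (\<lambda>_. I +>\<^bsub>poly_ring V\<^esub> 1)" by (simp_all add: F_def)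
  have aug: "augmentation (graded_quotient V I) F v = I +>\<^bsub>poly_ring V\<^esub> v 0" if "v \<in> free_module V 1" for v
    using that augmentation_graded_quotient[OF I, of F "\<lambda>_. 1" v] by (simp add: F zero free_module_def)
  have UF: "U n \<subseteq> free_module V (r n)" for n using sub[of n] by (simp add: graded_submodule_def)
  have im: "boundary F n ` free_module V (r (Suc n)) = U n" for n
    unfolding D(2)[of n] gen_lessThan boundary_def F ..
  have "graded_free_resolution V (graded_quotient V I) F"
    unfolding graded_free_resolution_def
  proof (intro conjI allI impI)
    fix k assume "k < rank F 0"
    then show "aug F k \<in> component (graded_quotient V I) (shift F 0 k)"
      unfolding graded_quotient_simps by (intro image_eqI[of _ _ 1]) (simp_all add: F zero homogeneous_part_iff)
  next
    fix i k assume "k < rank F (Suc i)"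
    then show "diff F i k \<in> free_module V (rank F i)" using D(1) UF by (auto simp: F)
  next
    fix i k l assume "k < rank F (Suc i)" "l < rank F i"
    then show "\<forall>t\<in>keys (diff F i k l). monom_degree t + shift F i l = shift F (Suc i) k"
      using D(1)[of k i] by (simp add: F vec_homogeneous_def)
  next
    show "augmentation (graded_quotient V I) F ` free_module V (rank F 0) = carrier (graded_quotient V I)"
    proof (intro equalityI subsetI)
      fix c assume "c \<in> augmentation (graded_quotient V I) F ` free_module V (rank F 0)"
      then obtain v where "v \<in> free_module V 1" "c = I +>\<^bsub>poly_ring V\<^esub> v 0" using aug by (auto simp: F zero)
      then show "c \<in> carrier (graded_quotient V I)"
        unfolding carrier_graded_quotient[OF I] by (auto simp: free_module_def)
    next
      fix c assume "c \<in> carrier (graded_quotient V I)"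
      then obtain p where p: "p \<in> polys V" "c = I +>\<^bsub>poly_ring V\<^esub> p"
        unfolding carrier_graded_quotient[OF I] by blast
      let ?v = "\<lambda>k::nat. if k = 0 then p else 0"
      have "?v \<in> free_module V 1" using p by (simp add: free_module_def)
      then show "c \<in> augmentation (graded_quotient V I) F ` free_module V (rank F 0)"
        using aug[of ?v] p(2) by (intro image_eqI[of _ _ ?v]) (simp_all add: F zero)
    qed
  next
    have "{v \<in> free_module V 1. augmentation (graded_quotient V I) F v = \<zero>\<^bsub>graded_quotient V I\<^esub>} = U0"
      unfolding U0_def
    proof (rule Collect_cong, rule conj_cong[OF refl])
      fix v :: "nat \<Rightarrow> ('x, 'a) mpoly" assume v: "v \<in> free_module V 1"
      then have "v 0 \<in> polys V" by (simp add: free_module_def)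
      then show "(augmentation (graded_quotient V I) F v = \<zero>\<^bsub>graded_quotient V I\<^esub>) = (v 0 \<in> I)"
        unfolding aug[OF v] by (rule coset_eq_zero_iff[OF I])
    qed
    then show "{v \<in> free_module V (rank F 0). augmentation (graded_quotient V I) F v = \<zero>\<^bsub>graded_quotient V I\<^esub>}
        = boundary F 0 ` free_module V (rank F 1)"
      using im[of 0] by (simp add: F zero)
  next
    fix i
    show "{v \<in> free_module V (rank F (Suc i)). boundary F i v = (\<lambda>l. 0)}
       = boundary F (Suc i) ` free_module V (rank F (Suc (Suc i)))"
      using im[of "Suc i"] D(3)[of i] by (simp add: F boundary_def)
  qed
  moreover have "lookup (diff F i k l) 0 = 0" if "k < rank F (Suc i)" "l < rank F i" for i k l
    using that D(1)[of k i] min[of "D i k" i _ l] by (auto simp: F)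
  ultimately show ?thesis unfolding minimal_graded_free_resolution_def by blast
qed

section \<open>Minimal resolutions have finite length\<close>

text \<open>Setting a set \<open>W\<close> of indeterminates to zero keeps a resolution exact from position
  \<open>card W\<close> on: this is the long exact sequence for multiplication by one more indeterminate,
  carried out by hand. For \<open>W = V\<close> all differentials of a minimal resolution vanish.\<close>

abbreviation kill :: "'x set \<Rightarrow> ('x, 'a::field) mpoly \<Rightarrow> ('x, 'a) mpoly" where
  "kill W \<equiv> part (\<lambda>t. keys t \<inter> W = {})"

lemma kill_mult: "kill W (p * q) = kill W p * kill W q"
  by (rule part_mult_hom) (auto simp: keys_plus_nat)

lemma kill_kill: "kill W (kill W p) = kill W p"
  by (simp add: part_part)

lemma kill_insert: "kill {x} (kill W p) = kill (insert x W) p"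
  unfolding part_part by (rule arg_cong[of _ _ "\<lambda>P. part P p"]) auto

lemma kill_indet: "x \<notin> W \<Longrightarrow> kill W (indet x) = indet x"
  by (rule part_id) (auto simp: indet_def split: if_splits)

lemma kill_indet_in: "x \<in> W \<Longrightarrow> kill W (indet x) = 0"
  by (rule part_eq_zero) (auto simp: indet_def split: if_splits)

text \<open>The differentials descend to the quotient by the indeterminates in \<open>W\<close>, so
  an argument may be replaced by its image there.\<close>

lemma kill_boundary: "kill W (boundary F i (\<lambda>k. kill W (v k)) l) = kill W (boundary F i v l)"
  by (simp add: boundary_def part_sum kill_mult kill_kill)

lemma boundary_mult: "boundary F i (\<lambda>k. p * v k) l = p * boundary F i v l"
  by (simp add: boundary_def sum_distrib_left mult.assoc)

lemma boundary_diff: "boundary F i (\<lambda>k. v k - w k) l = boundary F i v l - boundary F i w l"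
  by (simp add: boundary_def sum_subtractf left_diff_distrib)

lemma boundary_free_module:
  assumes "graded_free_resolution V N F" "v \<in> free_module V (rank F (Suc i))"
  shows "boundary F i v \<in> free_module V (rank F i)"
proof -
  have D: "diff F i k \<in> free_module V (rank F i)" if "k < rank F (Suc i)" for k
    using assms(1) that by (auto simp: graded_free_resolution_def)
  show ?thesis unfolding free_module_def boundary_def
  proof (intro CollectI conjI allI impI)
    fix l show "(\<Sum>k<rank F (Suc i). v k * diff F i k l) \<in> polys V"
      using D assms(2) by (intro polys_sum polys_mult) (auto intro: free_module_polys)
  next
    fix l assume "rank F i \<le> l"
    then show "(\<Sum>k<rank F (Suc i). v k * diff F i k l) = 0" using D by (simp add: free_module_def)
  qed
qed

lemma resolution_exact:
  assumes "graded_free_resolution V N F" "v \<in> free_module V (rank F (Suc i))"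
  shows "boundary F i v = (\<lambda>l. 0) \<longleftrightarrow> (\<exists>w\<in>free_module V (rank F (Suc (Suc i))). v = boundary F (Suc i) w)"
proof -
  have "{v \<in> free_module V (rank F (Suc i)). boundary F i v = (\<lambda>l. 0)}
       = boundary F (Suc i) ` free_module V (rank F (Suc (Suc i)))"
    using assms(1) by (simp add: graded_free_resolution_def)
  then show ?thesis using assms(2) by blast
qed

lemma boundary_boundary:
  assumes "graded_free_resolution V N F" "v \<in> free_module V (rank F (Suc (Suc i)))"
  shows "boundary F i (boundary F (Suc i) v) = (\<lambda>l. 0)"
  using resolution_exact[OF assms(1) boundary_free_module[OF assms]] assms(2) by blast

text \<open>Exactness of the reduced complex is phrased with lifts to the original free modules.
  Each new indeterminate costs one position, because the induction step uses exactness at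
  \<open>i\<close> and at \<open>i - 1\<close>.\<close>

lemma kill_exact:
  fixes F :: "(('x, 'a::field) mpoly, 'b) free_complex"
  assumes F: "graded_free_resolution V N F" and "finite W"
    and "W \<subseteq> V" "card W \<le> i" "v \<in> free_module V (rank F (Suc i))" "\<And>l. kill W (boundary F i v l) = 0"
  shows "\<exists>w\<in>free_module V (rank F (Suc (Suc i))). \<forall>l. kill W (v l) = kill W (boundary F (Suc i) w l)"
  using assms(2-)
proof (induction W arbitrary: i v rule: finite_induct)
  case empty
  have id: "kill {} p = p" for p :: "('x, 'a) mpoly" by (rule part_id) simp
  have "boundary F i v l = 0" for l using empty(4)[of l] unfolding id .
  then have "boundary F i v = (\<lambda>l. 0)" ..
  then show ?case using resolution_exact[OF F empty(3)] by auto
next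
  case (insert x W)
  obtain j where i: "i = Suc j" and j: "card W \<le> j"
    using insert.prems(2) insert.hyps by (cases i) auto
  define u0 where "u0 l = kill W (boundary F i v l)" for l
  have bF: "boundary F i v \<in> free_module V (rank F i)" by (rule boundary_free_module[OF F insert.prems(3)])
  \<comment> \<open>Modulo \<open>W\<close> the boundary of \<open>v\<close> vanishes once
    \<open>x\<close> is killed too, so all its terms contain \<open>x\<close>.\<close>
  have "\<exists>q\<in>polys V. u0 l = indet x * q" for l
  proof (rule indet_dvd)
    show "u0 l \<in> polys V" unfolding u0_def using free_module_polys[OF bF] by (rule part_polys)
    have "kill {x} (u0 l) = 0" using insert.prems(4)[of l] by (simp only: u0_def kill_insert)
    then show "x \<in> keys t" if "t \<in> keys (u0 l)" for t
      using that keys_part[of "\<lambda>t. keys t \<inter> {x} = {}" "u0 l"] by auto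
  qed
  then obtain q where q: "\<And>l. q l \<in> polys V" "\<And>l. u0 l = indet x * q l" by metis
  define u where "u l = (if l < rank F i then q l else 0)" for l
  have u: "u \<in> free_module V (rank F i)" using q(1) by (simp add: u_def free_module_def)
  have u0: "u0 l = indet x * u l" for l
  proof (cases "l < rank F i")
    case False
    then have "u0 l = 0" using bF by (simp add: u0_def free_module_def)
    then show ?thesis using False by (simp add: u_def)
  qed (simp add: u_def q(2))
  \<comment> \<open>Since \<open>x\<close> times \<open>u\<close> is a boundary modulo
    \<open>W\<close> and \<open>x\<close> can be cancelled there, \<open>u\<close> is a cycle modulo
    \<open>W\<close>.\<close>
  have "kill W (boundary F j u l) = 0" for l
  proof -
    have "indet x * kill W (boundary F j u l) = kill W (boundary F j (\<lambda>l. indet x * u l) l)"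
      using insert.hyps(2) by (simp add: boundary_mult kill_mult kill_indet)
    also have "\<dots> = kill W (boundary F j (\<lambda>l. kill W (boundary F i v l)) l)"
      by (simp flip: u0 add: u0_def)
    also have "\<dots> = kill W (boundary F j (boundary F i v) l)" by (rule kill_boundary)
    also have "\<dots> = 0" using boundary_boundary[OF F] insert.prems(3) by (simp add: i)
    finally show ?thesis by (rule indet_mult_eq_zero)
  qed
  from insert.IH[OF _ j _ this] u i insert.prems(1) obtain u' where u': "u' \<in> free_module V (rank F (Suc i))"
    "\<And>l. kill W (u l) = kill W (boundary F i u' l)" by auto
  \<comment> \<open>The correction turns \<open>v\<close> into a genuine cycle modulo
    \<open>W\<close> without changing it modulo \<open>x\<close>.\<close>
  let ?v = "\<lambda>l. v l - indet x * u' l"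
  have vF: "?v \<in> free_module V (rank F (Suc i))"
  proof -
    have "indet x \<in> polys V" unfolding indet_def using insert.prems(1) by (intro polys_single) simp
    then show ?thesis
      using free_module_diff[OF insert.prems(3) free_module_mult[OF _ u'(1)]] by (simp add: fun_diff_def)
  qed
  have kuu: "kill W (indet x * u l) = indet x * u l" for l
    unfolding u0[symmetric] by (simp add: u0_def kill_kill)
  have "kill W (boundary F i ?v l) = 0" for l
  proof -
    have "kill W (boundary F i ?v l) = u0 l - kill W (indet x) * kill W (u l)"
      by (simp add: boundary_diff boundary_mult part_diff kill_mult u0_def u'(2))
    also have "kill W (indet x) * kill W (u l) = u0 l"
      unfolding kill_mult[symmetric] kuu u0 ..
    finally show ?thesis by simp
  qed
  from insert.IH[OF _ _ vF this] j i insert.prems(1) obtain w where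
    w: "w \<in> free_module V (rank F (Suc (Suc i)))" "\<And>l. kill W (?v l) = kill W (boundary F (Suc i) w l)"
    by auto
  have "kill (insert x W) (v l) = kill (insert x W) (boundary F (Suc i) w l)" for l
  proof -
    have "kill (insert x W) (?v l) = kill (insert x W) (boundary F (Suc i) w l)"
      using arg_cong[OF w(2)[of l], of "kill {x}"] by (simp only: kill_insert)
    then show ?thesis
      by (simp only: part_diff kill_mult kill_indet_in[OF insertI1] mult_zero_left diff_zero)
  qed
  then show ?case using w(1) by blast
qed

lemma minimal_resolution_finite_length:
  fixes F :: "(('x, 'a::field) mpoly, 'b) free_complex"
  assumes V: "finite V" and F: "minimal_graded_free_resolution V N F" and i: "card V \<le> i"
  shows "rank F (Suc i) = 0"
proof (rule ccontr)
  assume nz: "rank F (Suc i) \<noteq> 0"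
  have G: "graded_free_resolution V N F" using F by (simp add: minimal_graded_free_resolution_def)
  have kd: "kill V (boundary F j v l) = 0" for j l and v :: "nat \<Rightarrow> ('x, 'a) mpoly"
  proof -
    have "kill V (diff F j k l) = 0" if k: "k < rank F (Suc j)" for k
    proof (rule part_eq_zero)
      fix t assume t: "t \<in> keys (diff F j k l)"
      have D: "diff F j k \<in> free_module V (rank F j)"
        using G k by (auto simp: graded_free_resolution_def)
      have "l < rank F j" using t D by (cases "l < rank F j") (auto simp: free_module_def)
      then have "t \<noteq> 0" using F k t by (auto simp: minimal_graded_free_resolution_def in_keys_iff)
      moreover have "keys t \<subseteq> V" using free_module_polys[OF D] t by (auto simp: polys_iff)
      ultimately show "keys t \<inter> V \<noteq> {}" by (metis inf.absorb1 keys_eq_empty)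
    qed
    then show ?thesis by (simp add: boundary_def part_sum kill_mult)
  qed
  \<comment> \<open>Modulo all indeterminates the first basis vector is a cycle, hence a boundary;
    but boundaries vanish there and \<open>?e\<close> does not.\<close>
  let ?e = "\<lambda>k::nat. if k = 0 then 1 else 0 :: ('x, 'a) mpoly"
  have "?e \<in> free_module V (rank F (Suc i))" using nz by (simp add: free_module_def)
  from kill_exact[OF G V subset_refl i this kd] obtain w where
    "\<And>l. kill V (?e l) = kill V (boundary F (Suc i) w l)" by blast
  from this[of 0] have "kill V (1 :: ('x, 'a) mpoly) = 0" using kd[of "Suc i" w 0] by simp
  moreover have "kill V (1 :: ('x, 'a) mpoly) = 1" by (rule part_id) simp
  ultimately show False by simp
qed

section \<open>The Hilbert--Poincare polynomial from the Hilbert function\<close>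

abbreviation "vdim \<equiv> vector_space.dim vscale"
abbreviation fscale :: "'a::field \<Rightarrow> ('b \<Rightarrow> 'a) \<Rightarrow> 'b \<Rightarrow> 'a" where "fscale a f \<equiv> \<lambda>x. a * f x"
abbreviation "fdim \<equiv> vector_space.dim fscale"

text \<open>Let the fibres of \<open>\<phi>\<close> be classes of monomials. This is the coordinate
  at \<open>c\<close> of the image of \<open>p\<close> in the vector space with the classes as
  basis.\<close>

definition csum :: "(('x \<Rightarrow>\<^sub>0 nat) \<Rightarrow> 'c) \<Rightarrow> ('x, 'a::field) mpoly \<Rightarrow> 'c \<Rightarrow> 'a" where
  "csum \<phi> p c = (\<Sum>t\<in>{t \<in> keys p. \<phi> t = c}. lookup p t)"

lemma csum_superset:
  assumes "finite A" "keys p \<subseteq> A"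
  shows "csum \<phi> p c = (\<Sum>t\<in>A. if \<phi> t = c then lookup p t else 0)"
proof -
  have "csum \<phi> p c = (\<Sum>t\<in>keys p. if \<phi> t = c then lookup p t else 0)"
    unfolding csum_def by (simp add: sum.inter_filter)
  also have "\<dots> = (\<Sum>t\<in>A. if \<phi> t = c then lookup p t else 0)"
    by (rule sum.mono_neutral_left) (use assms in \<open>auto simp: in_keys_iff\<close>)
  finally show ?thesis .
qed

lemma csum_add: "csum \<phi> (p + q) c = csum \<phi> p c + csum \<phi> q c"
proof -
  let ?A = "keys p \<union> keys q"
  have "csum \<phi> r c = (\<Sum>t\<in>?A. if \<phi> t = c then lookup r t else 0)" if "r \<in> {p, q, p + q}" for r
    using that keys_add[of p q] by (intro csum_superset) auto
  moreover have "(\<Sum>t\<in>?A. if \<phi> t = c then lookup (p + q) t else 0)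
      = (\<Sum>t\<in>?A. if \<phi> t = c then lookup p t else 0) + (\<Sum>t\<in>?A. if \<phi> t = c then lookup q t else 0)"
    unfolding sum.distrib[symmetric] by (rule sum.cong) (auto simp: lookup_add)
  ultimately show ?thesis by simp
qed

lemma csum_uminus: "csum \<phi> (- p) c = - csum \<phi> p c"
  by (simp add: csum_def sum_negf)

lemma csum_diff: "csum \<phi> (p - q) c = csum \<phi> p c - csum \<phi> q c"
  using csum_add[of \<phi> p "- q" c] by (simp add: csum_uminus)

lemma csum_zero [simp]: "csum \<phi> 0 c = 0"
  by (simp add: csum_def)

lemma csum_sum: "csum \<phi> (\<Sum>i\<in>A. f i) c = (\<Sum>i\<in>A. csum \<phi> (f i) c)"
  by (induction A rule: infinite_finite_induct) (auto simp: csum_add)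

lemma csum_scale: "csum \<phi> (single 0 a * p) c = a * csum \<phi> p c"
proof -
  have "csum \<phi> (single 0 a * p) c = (\<Sum>t\<in>keys p. if \<phi> t = c then lookup (single 0 a * p) t else 0)"
    by (rule csum_superset) (use keys_scale_subset in auto)
  also have "\<dots> = a * (\<Sum>t\<in>keys p. if \<phi> t = c then lookup p t else 0)"
    unfolding sum_distrib_left by (rule sum.cong) auto
  finally show ?thesis using csum_superset[of "keys p" p \<phi> c] by simp
qed

lemma csum_single: "csum \<phi> (single t a) c = (if \<phi> t = c then a else 0)"
  using csum_superset[of "{t}" "single t a" \<phi> c] by simp

lemma dim_functions_supported:
  fixes M :: "'b set"
  assumes "finite M"
  shows "fdim {f :: 'b \<Rightarrow> 'a::field. \<forall>x. x \<notin> M \<longrightarrow> f x = 0} = card M"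
proof -
  interpret vector_space "fscale :: 'a \<Rightarrow> ('b \<Rightarrow> 'a) \<Rightarrow> _" by (rule vector_space_fun)
  let ?b = "\<lambda>m x. if x = m then 1 else (0::'a)"
  have s: "(\<Sum>m\<in>M. fscale (c m) (?b m)) x = (if x \<in> M then c x else 0)" for c x
    using assms by (simp add: sum_fun_apply if_distrib[of "\<lambda>y. _ * y"] cong: if_cong)
  show ?thesis
  proof (rule dim_eq_card_coordinates(1)[OF assms, where b = ?b and \<phi> = "\<lambda>m f. f m"])
    fix u :: "'b \<Rightarrow> 'a" assume "u \<in> {f. \<forall>x. x \<notin> M \<longrightarrow> f x = 0}"
    then have "u = (\<Sum>m\<in>M. fscale (u m) (?b m))" by (intro ext) (simp only: s, simp)
    then show "\<exists>c. u = (\<Sum>m\<in>M. fscale (c m) (?b m))" by (rule exI[where x = u])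
  next
    fix c and m assume "m \<in> M"
    then show "(\<Sum>m\<in>M. fscale (c m) (?b m)) m = c m" by (simp only: s if_True)
  qed auto
qed

definition graded_part :: "'x set \<Rightarrow> nat \<Rightarrow> (nat \<Rightarrow> nat) \<Rightarrow> nat \<Rightarrow> (nat \<Rightarrow> ('x, 'a::field) mpoly) set" where
  "graded_part V r s d = {v \<in> free_module V r. vec_homogeneous s d v}"

text \<open>A basis consists of the monomials of degree \<open>d - s k\<close> placed at position
  \<open>k\<close>. The case distinction guards against truncated subtraction.\<close>

lemma graded_part_dim:
  fixes V :: "'x set"
  assumes V: "finite V"
  shows "vdim (graded_part V r s d :: (nat \<Rightarrow> ('x, 'a::field) mpoly) set)
      = (\<Sum>k<r. if s k \<le> d then card (monoms V (d - s k)) else 0)" (is "?A = ?B")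
    and "\<exists>A. finite A \<and> (graded_part V r s d :: (nat \<Rightarrow> ('x, 'a) mpoly) set) \<subseteq> module.span vscale A"
proof -
  interpret vector_space "vscale :: 'a \<Rightarrow> (nat \<Rightarrow> ('x, 'a) mpoly) \<Rightarrow> _" by (rule vector_space_vscale)
  let ?U = "graded_part V r s d :: (nat \<Rightarrow> ('x, 'a) mpoly) set"
  define M where "M = (SIGMA k:{k. k < r \<and> s k \<le> d}. monoms V (d - s k))"
  have M: "finite M" using finite_monoms[OF V] by (simp add: M_def)
  let ?b = "\<lambda>(k, t) l. if l = k then single t 1 else 0 :: ('x, 'a) mpoly"
  have s: "lookup ((\<Sum>m\<in>M. vscale (c m) (?b m)) k) t = (if (k, t) \<in> M then c (k, t) else 0)" for c k t
  proof -
    have "lookup ((\<Sum>m\<in>M. vscale (c m) (?b m)) k) t = (\<Sum>m\<in>M. if m = (k, t) then c m else 0)"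
      unfolding sum_fun_apply lookup_sum
      by (rule sum.cong) (auto simp: vscale_def lookup_single when_def split: if_splits)
    then show ?thesis using M by simp
  qed
  have mem: "(k, t) \<in> M" if "v \<in> ?U" "t \<in> keys (v k)" for v k t
  proof -
    have d: "monom_degree t + s k = d" and f: "v \<in> free_module V r"
      using that by (auto simp: graded_part_def vec_homogeneous_def)
    have "k < r" using f that(2) by (cases "k < r") (auto simp: free_module_def)
    moreover have "keys t \<subseteq> V" using free_module_polys[OF f] that(2) by (auto simp: polys_iff)
    ultimately show ?thesis using d by (auto simp: M_def monoms_def)
  qed
  have 1: "?b m \<in> ?U" if "m \<in> M" for m
    using that by (auto simp: M_def graded_part_def free_module_def monoms_def vec_homogeneous_def
        intro!: polys_single split: if_splits)
  have 2: "\<exists>c. u = (\<Sum>m\<in>M. vscale (c m) (?b m))" if u: "u \<in> ?U" for u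
  proof
    show "u = (\<Sum>m\<in>M. vscale (lookup (u (fst m)) (snd m)) (?b m))"
    proof (rule ext, rule poly_mapping_eqI)
      fix k t
      show "lookup (u k) t = lookup ((\<Sum>m\<in>M. vscale (lookup (u (fst m)) (snd m)) (?b m)) k) t"
        unfolding s using mem[OF u, of t k] by (auto simp: in_keys_iff)
    qed
  qed
  have 3: "lookup ((\<Sum>m\<in>M. vscale (c m) (?b m)) (fst m)) (snd m) = c m" if "m \<in> M" for m c
    unfolding s using that by simp
  have "vdim ?U = card M"
    by (rule dim_eq_card_coordinates(1)[OF M 1 2, where \<phi> = "\<lambda>m v. lookup (v (fst m)) (snd m)"]) (use 3 in auto)
  also have "card M = (\<Sum>k\<in>{k. k < r \<and> s k \<le> d}. card (monoms V (d - s k)))"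
    unfolding M_def using finite_monoms[OF V] by (intro card_SigmaI) auto
  also have "\<dots> = ?B" by (subst sum.inter_filter[symmetric]) (auto intro: sum.cong)
  finally show "?A = ?B" .
  have "?U \<subseteq> span (?b ` M)"
    by (rule dim_eq_card_coordinates(2)[OF M 1 2, where \<phi> = "\<lambda>m v. lookup (v (fst m)) (snd m)"]) (use 3 in auto)
  then show "\<exists>A. finite A \<and> ?U \<subseteq> span A" using M by blast
qed

lemma graded_part_subspace:
  "module.subspace vscale (graded_part V r s d :: (nat \<Rightarrow> ('x, 'a::field) mpoly) set)"
proof -
  interpret vector_space "vscale :: 'a \<Rightarrow> (nat \<Rightarrow> ('x, 'a) mpoly) \<Rightarrow> _" by (rule vector_space_vscale)
  show "subspace (graded_part V r s d :: (nat \<Rightarrow> ('x, 'a) mpoly) set)"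
  proof (rule subspaceI)
    fix c :: 'a and v :: "nat \<Rightarrow> ('x, 'a) mpoly" assume v: "v \<in> graded_part V r s d"
    have "vec_homogeneous s d (vscale c v)"
      unfolding vscale_def using v by (intro vec_homogeneous_monom_mult) (auto simp: graded_part_def)
    moreover have "vscale c v \<in> free_module V r"
      unfolding vscale_def using v by (intro free_module_mult) (auto simp: graded_part_def intro: polys_single)
    ultimately show "vscale c v \<in> graded_part V r s d" by (simp add: graded_part_def)
  qed (auto simp: graded_part_def free_module_add vec_homogeneous_add)
qed

lemma graded_part_rank_nullity:
  fixes f :: "(nat \<Rightarrow> ('x, 'a::field) mpoly) \<Rightarrow> 'w::ab_group_add"
  assumes "finite V" "Vector_Spaces.linear vscale sc f"
  shows "vdim (graded_part V r s d :: (nat \<Rightarrow> ('x, 'a) mpoly) set) = vdim {u \<in> graded_part V r s d. f u = 0}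
      + vector_space.dim sc (f ` graded_part V r s d)"
proof -
  interpret vector_space_pair vscale sc
    using assms(2) vector_space_vscale by (simp add: vector_space_pair_def Vector_Spaces.linear_iff)
  obtain A where "finite A" "graded_part V r s d \<subseteq> vs1.span A"
    using graded_part_dim(2)[OF assms(1), of r s d, where 'a = 'a] by blast
  then show ?thesis by (intro rank_nullity[OF assms(2) graded_part_subspace])
qed

section \<open>Dimension counts along a minimal resolution\<close>

lemma linear_boundary: "Vector_Spaces.linear vscale vscale (boundary F i)"
  unfolding Vector_Spaces.linear_iff using vector_space_vscale
  by (auto simp: boundary_def fun_eq_iff vscale_def distrib_right sum.distrib sum_distrib_left mult.assoc)

text \<open>A boundary that is homogeneous of degree \<open>d\<close> has a preimage of degree
  \<open>d\<close>, namely the degree \<open>d\<close> component of any preimage. Exactness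
  therefore holds degree by degree.\<close>

lemma boundary_graded_part:
  assumes F: "graded_free_resolution V N F"
  shows "boundary F i ` graded_part V (rank F (Suc i)) (shift F (Suc i)) d
    = {u \<in> graded_part V (rank F i) (shift F i) d. u \<in> boundary F i ` free_module V (rank F (Suc i))}"
proof -
  have D: "vec_homogeneous (shift F i) (shift F (Suc i) k) (diff F i k)" if k: "k < rank F (Suc i)" for k
    unfolding vec_homogeneous_def
  proof (intro allI ballI)
    fix l t assume t: "t \<in> keys (diff F i k l)"
    have "diff F i k \<in> free_module V (rank F i)" using F k by (auto simp: graded_free_resolution_def)
    then have "l < rank F i" using t by (cases "l < rank F i") (auto simp: free_module_def)
    then show "monom_degree t + shift F i l = shift F (Suc i) k"
      using F k t by (auto simp: graded_free_resolution_def)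
  qed
  have vp: "vec_part (shift F i) d (boundary F i v) = boundary F i (vec_part (shift F (Suc i)) d v)" for v
    unfolding boundary_def by (rule vec_part_linear_combination[OF D])
  show ?thesis
  proof (intro equalityI subsetI)
    fix u assume "u \<in> boundary F i ` graded_part V (rank F (Suc i)) (shift F (Suc i)) d"
    then obtain v where v: "u = boundary F i v" "v \<in> graded_part V (rank F (Suc i)) (shift F (Suc i)) d" by blast
    have v': "v \<in> free_module V (rank F (Suc i))" "vec_homogeneous (shift F (Suc i)) d v"
      using v(2) by (simp_all add: graded_part_def)
    have "vec_homogeneous (shift F i) d u"
      using vec_homogeneous_vec_part[of "shift F i" d u] unfolding v(1) vp vec_part_homogeneous[OF v'(2)] .
    then show "u \<in> {u \<in> graded_part V (rank F i) (shift F i) d. u \<in> boundary F i ` free_module V (rank F (Suc i))}"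
      using v(1) v'(1) boundary_free_module[OF F v'(1)] by (simp add: graded_part_def)
  next
    fix u assume "u \<in> {u \<in> graded_part V (rank F i) (shift F i) d. u \<in> boundary F i ` free_module V (rank F (Suc i))}"
    then obtain v where v: "u = boundary F i v" "v \<in> free_module V (rank F (Suc i))"
      and u: "vec_homogeneous (shift F i) d u" by (auto simp: graded_part_def)
    have "u = boundary F i (vec_part (shift F (Suc i)) d v)"
      using vp[of v] vec_part_homogeneous[OF u] by (simp add: v(1))
    moreover have "vec_part (shift F (Suc i)) d v \<in> graded_part V (rank F (Suc i)) (shift F (Suc i)) d"
      using vec_part_free_module[OF v(2)] by (simp add: graded_part_def vec_homogeneous_vec_part)
    ultimately show "u \<in> boundary F i ` graded_part V (rank F (Suc i)) (shift F (Suc i)) d" by blast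
  qed
qed

text \<open>Exactness turns the alternating sum of the dimensions of the free modules into a telescope.\<close>

lemma alternating_sum_graded_part:
  fixes F :: "(('x, 'a::field) mpoly, 'b) free_complex"
  assumes V: "finite V" and F: "minimal_graded_free_resolution V N F"
  defines "x \<equiv> \<lambda>i d. vdim (graded_part V (rank F i) (shift F i) d :: (nat \<Rightarrow> ('x, 'a) mpoly) set)"
  shows "(\<Sum>i\<le>card V. (- 1) ^ i * int (x i d)) = int (x 0 d)
    - int (vdim {u \<in> graded_part V (rank F 0) (shift F 0) d. augmentation N F u = \<zero>\<^bsub>N\<^esub>})"
proof -
  have G: "graded_free_resolution V N F" using F by (simp add: minimal_graded_free_resolution_def)
  define y where "y i = vdim (boundary F i ` graded_part V (rank F (Suc i)) (shift F (Suc i)) d :: (nat \<Rightarrow> ('x, 'a) mpoly) set)" for i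
  have x: "x (Suc i) d = y (Suc i) + y i" for i
  proof -
    have "{u \<in> graded_part V (rank F (Suc i)) (shift F (Suc i)) d. boundary F i u = 0}
        = boundary F (Suc i) ` graded_part V (rank F (Suc (Suc i))) (shift F (Suc (Suc i))) d"
      unfolding boundary_graded_part[OF G] using resolution_exact[OF G, of _ i]
      by (auto simp: graded_part_def zero_fun_def)
    then show ?thesis
      using graded_part_rank_nullity[OF V linear_boundary[of F i], of "rank F (Suc i)" "shift F (Suc i)" d]
      by (simp add: x_def y_def)
  qed
  have tel: "(\<Sum>i\<le>n. (- 1) ^ i * int (x i d)) = int (x 0 d) - int (y 0) + (- 1) ^ n * int (y n)" for n
    by (induction n) (simp_all add: x algebra_simps)
  \<comment> \<open>The free module after position \<open>card V\<close> is zero, which removes the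
    remainder term of the telescope.\<close>
  have "x (Suc (card V)) d = 0"
    using minimal_resolution_finite_length[OF V F order.refl] unfolding x_def graded_part_dim(1)[OF V] by simp
  then have "y (card V) = 0" using x by simp
  moreover have "{u \<in> graded_part V (rank F 0) (shift F 0) d. augmentation N F u = \<zero>\<^bsub>N\<^esub>}
      = boundary F 0 ` graded_part V (rank F 1) (shift F 1) d"
  proof -
    have "{v \<in> free_module V (rank F 0). augmentation N F v = \<zero>\<^bsub>N\<^esub>} = boundary F 0 ` free_module V (rank F 1)"
      using G by (simp add: graded_free_resolution_def)
    then show ?thesis unfolding One_nat_def boundary_graded_part[OF G] by (auto simp: graded_part_def)
  qed
  ultimately show ?thesis using tel[of "card V"] by (simp add: y_def)
qed

text \<open>\<open>F\<close> has to be the resolution selected in \<open>graded_betti\<close>. Its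
  finite length confines the nonzero Betti numbers to a finite rectangle; grouping basis elements by
  their shift then replaces each Betti number by a sum of ones.\<close>

lemma hilbert_poincare_resolution:
  fixes F :: "(('x, 'a::field) mpoly, 'b) free_complex"
  assumes V: "finite V" and F: "minimal_graded_free_resolution V N F"
    and F_eq: "F = (SOME F. minimal_graded_free_resolution V N F)"
  shows "hilbert_poincare V N = (\<Sum>i\<le>card V. \<Sum>k<rank F i. Polynomial.monom ((- 1) ^ i) (shift F i k))"
proof -
  let ?b = "\<lambda>i j. card {k. k < rank F i \<and> shift F i k = j}"
  have b: "graded_betti V N i j = ?b i j" for i j
    by (simp add: graded_betti_def F_eq Let_def)
  define J where "J = (\<Union>i\<le>card V. shift F i ` {..<rank F i})"
  have finJ: "finite J" by (simp add: J_def)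
  have B: "{(i, j). graded_betti V N i j \<noteq> 0} \<subseteq> {..card V} \<times> J"
  proof (rule subsetI)
    fix ij assume "ij \<in> {(i, j). graded_betti V N i j \<noteq> 0}"
    then obtain i j where ij: "ij = (i, j)" and "graded_betti V N i j \<noteq> 0" by auto
    then obtain k where k: "k < rank F i" "shift F i k = j" unfolding b by (auto simp: card_eq_0_iff)
    have "i \<le> card V"
    proof (rule ccontr)
      assume "\<not> i \<le> card V"
      then obtain i' where "i = Suc i'" "card V \<le> i'" by (cases i) auto
      then show False using minimal_resolution_finite_length[OF V F] k by simp
    qed
    then show "ij \<in> {..card V} \<times> J" using k by (auto simp: J_def ij)
  qed
  have "hilbert_poincare V N = (\<Sum>(i, j)\<in>{..card V} \<times> J. Polynomial.monom ((- 1) ^ i * int (graded_betti V N i j)) j)"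
    unfolding hilbert_poincare_def by (rule sum.mono_neutral_left) (use B finJ in auto)
  also have "\<dots> = (\<Sum>i\<le>card V. \<Sum>j\<in>J. Polynomial.monom ((- 1) ^ i * int (?b i j)) j)"
    by (simp add: b sum.cartesian_product)
  also have "\<dots> = (\<Sum>i\<le>card V. \<Sum>k<rank F i. Polynomial.monom ((- 1) ^ i) (shift F i k))"
  proof (rule sum.cong[OF refl])
    fix i assume i: "i \<in> {..card V}"
    have "Polynomial.monom ((- 1) ^ i * int (?b i j)) j
        = (\<Sum>k\<in>{k \<in> {..<rank F i}. shift F i k = j}. Polynomial.monom ((- 1) ^ i) (shift F i k))" for j
    proof -
      have "(\<Sum>k\<in>{k \<in> {..<rank F i}. shift F i k = j}. Polynomial.monom ((- 1) ^ i :: int) (shift F i k))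
          = (\<Sum>k\<in>{k \<in> {..<rank F i}. shift F i k = j}. Polynomial.monom ((- 1) ^ i) j)"
        by (rule sum.cong) auto
      then show ?thesis by (simp add: of_nat_monom Polynomial.mult_monom mult.commute)
    qed
    moreover have "(\<Sum>j\<in>J. \<Sum>k\<in>{k \<in> {..<rank F i}. shift F i k = j}. Polynomial.monom ((- 1 :: int) ^ i) (shift F i k))
        = (\<Sum>k<rank F i. Polynomial.monom ((- 1) ^ i) (shift F i k))"
      by (rule sum.group) (use i finJ in \<open>auto simp: J_def\<close>)
    ultimately show "(\<Sum>j\<in>J. Polynomial.monom ((- 1) ^ i * int (?b i j)) j)
        = (\<Sum>k<rank F i. Polynomial.monom ((- 1) ^ i) (shift F i k))" by simp
  qed
  finally show ?thesis .
qed

section \<open>Hilbert series of rings obtained by identifying monomials\<close>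

definition degree_compatible :: "'x set \<Rightarrow> (('x \<Rightarrow>\<^sub>0 nat) \<Rightarrow> 'c) \<Rightarrow> bool" where
  "degree_compatible V \<phi> \<longleftrightarrow>
     (\<forall>t u. keys t \<subseteq> V \<longrightarrow> keys u \<subseteq> V \<longrightarrow> \<phi> t = \<phi> u \<longrightarrow> monom_degree t = monom_degree u)"

lemma degree_compatibleD:
  "degree_compatible V \<phi> \<Longrightarrow> keys t \<subseteq> V \<Longrightarrow> keys u \<subseteq> V \<Longrightarrow> \<phi> t = \<phi> u \<Longrightarrow> monom_degree t = monom_degree u"
  unfolding degree_compatible_def by iprover

text \<open>The kernel of the linear map from polynomials to functions on classes. For the classes
  generated by swaps of 2-minors it is identified with the ideal of these minors below.\<close>

definition class_ideal :: "'x set \<Rightarrow> (('x \<Rightarrow>\<^sub>0 nat) \<Rightarrow> 'c) \<Rightarrow> ('x, 'a::field) mpoly set" where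
  "class_ideal V \<phi> = {p \<in> polys V. \<forall>c. csum \<phi> p c = 0}"

lemma csum_part_degree:
  assumes deg: "degree_compatible V \<phi>"
    and p: "p \<in> polys V"
  shows "csum \<phi> (part (\<lambda>t. monom_degree t = d) p) c = (if c \<in> \<phi> ` monoms V d then csum \<phi> p c else 0)"
proof -
  have "csum \<phi> (part (\<lambda>t. monom_degree t = d) p) c
      = (\<Sum>t\<in>keys p. if \<phi> t = c then lookup (part (\<lambda>t. monom_degree t = d) p) t else 0)"
    by (rule csum_superset) (auto simp: keys_part)
  also have "\<dots> = (\<Sum>t\<in>keys p. if c \<in> \<phi> ` monoms V d \<and> \<phi> t = c then lookup p t else 0)"
  proof (rule sum.cong[OF refl])
    fix t assume "t \<in> keys p"
    then have t: "keys t \<subseteq> V" using p by (auto simp: polys_iff)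
    have "c \<in> \<phi> ` monoms V d \<longleftrightarrow> monom_degree t = d" if "\<phi> t = c"
    proof
      assume "c \<in> \<phi> ` monoms V d"
      then obtain u where "c = \<phi> u" "keys u \<subseteq> V" "monom_degree u = d" by (auto simp: monoms_def)
      then show "monom_degree t = d" using degree_compatibleD[OF deg t, of u] that by simp
    next
      assume "monom_degree t = d"
      then show "c \<in> \<phi> ` monoms V d" using that t by (auto simp: monoms_def)
    qed
    then show "(if \<phi> t = c then lookup (part (\<lambda>t. monom_degree t = d) p) t else 0)
        = (if c \<in> \<phi> ` monoms V d \<and> \<phi> t = c then lookup p t else 0)"
      by (auto simp: lookup_part)
  qed
  also have "\<dots> = (if c \<in> \<phi> ` monoms V d then csum \<phi> p c else 0)"
    using csum_superset[of "keys p" p \<phi> c] by simp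
  finally show ?thesis .
qed

text \<open>The three series are the Hilbert-Poincare polynomial, the Hilbert series of the
  polynomial ring and that of the quotient, where the latter counts classes in each degree.\<close>

theorem hilbert_poincare_class_ideal:
  fixes V :: "'x::linorder set" and \<phi> :: "('x \<Rightarrow>\<^sub>0 nat) \<Rightarrow> 'c"
  assumes V: "finite V" and I: "ideal (class_ideal V \<phi> :: ('x, 'a::field) mpoly set) (poly_ring V)"
    and deg: "degree_compatible V \<phi>"
  shows "fps_of_poly (hilbert_poincare V (graded_quotient V (class_ideal V \<phi> :: ('x, 'a) mpoly set)))
      * Abs_fps (\<lambda>d. int (card (monoms V d))) = Abs_fps (\<lambda>d. int (card (\<phi> ` monoms V d)))"
proof -
  let ?I = "class_ideal V \<phi> :: ('x, 'a) mpoly set"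
  let ?N = "graded_quotient V ?I"
  have hom: "part (\<lambda>t. monom_degree t = d) p \<in> ?I" if "p \<in> ?I" for p d
    using that csum_part_degree[OF deg, of p d] by (simp add: class_ideal_def part_polys)
  have const: "lookup p 0 = 0" if p: "p \<in> ?I" for p
  proof -
    \<comment> \<open>Only the monomial 1 has degree 0, so its class sum is the constant
      coefficient.\<close>
    have "\<phi> t = \<phi> 0 \<longleftrightarrow> t = 0" if "t \<in> keys p" for t
      proof -
      have "keys t \<subseteq> V" using that p by (auto simp: class_ideal_def polys_iff)
      moreover have "keys (0 :: 'x \<Rightarrow>\<^sub>0 nat) \<subseteq> V" by simp
      ultimately have "monom_degree t = monom_degree 0" if "\<phi> t = \<phi> 0"
        using degree_compatibleD[OF deg, of t 0] that by simp
      then show ?thesis by auto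
    qed
    then have "{t \<in> keys p. \<phi> t = \<phi> 0} = (if 0 \<in> keys p then {0} else {})" by auto
    then have "csum \<phi> p (\<phi> 0) = lookup p 0"
      unfolding csum_def by (simp add: in_keys_iff)
    then show ?thesis using p by (simp add: class_ideal_def)
  qed
  define F where "F = (SOME F. minimal_graded_free_resolution V ?N F)"
  have F: "minimal_graded_free_resolution V ?N F"
    unfolding F_def using ex_minimal_graded_free_resolution[OF V I hom const] by (rule someI_ex)
  have G: "graded_free_resolution V ?N F" using F by (simp add: minimal_graded_free_resolution_def)
  have "\<forall>k<rank F 0. \<exists>f. f \<in> homogeneous_part V (shift F 0 k) \<and> aug F k = ?I +>\<^bsub>poly_ring V\<^esub> f"
    using G by (auto simp: graded_free_resolution_def graded_quotient_simps)
  then obtain f where f: "\<And>k. k < rank F 0 \<Longrightarrow> f k \<in> homogeneous_part V (shift F 0 k)"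
    "\<And>k. k < rank F 0 \<Longrightarrow> aug F k = ?I +>\<^bsub>poly_ring V\<^esub> f k" by metis
  have fV: "f k \<in> polys V" if "k < rank F 0" for k using f(1)[OF that] by (simp add: homogeneous_part_iff)
  define g where "g v = (\<Sum>k<rank F 0. v k * f k)" for v
  have aug: "augmentation ?N F v = ?I +>\<^bsub>poly_ring V\<^esub> g v" if "v \<in> free_module V (rank F 0)" for v
    unfolding g_def by (rule augmentation_graded_quotient[OF I]) (use f(2) fV that free_module_polys in blast)+
  have gV: "g v \<in> polys V" if "v \<in> free_module V (rank F 0)" for v
    unfolding g_def using that fV by (intro polys_sum polys_mult) (auto intro: free_module_polys)
  \<comment> \<open>The kernel of the augmentation is thus the kernel of a linear map into functions
    on classes, to which rank-nullity applies.\<close>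
  have aug0: "augmentation ?N F v = \<zero>\<^bsub>?N\<^esub> \<longleftrightarrow> csum \<phi> (g v) = 0" if "v \<in> free_module V (rank F 0)" for v
    unfolding aug[OF that] coset_eq_zero_iff[OF I gV[OF that]] using gV[OF that]
    by (auto simp: class_ideal_def fun_eq_iff)
  have g_part: "part (\<lambda>t. monom_degree t = d) (g v) = g (vec_part (shift F 0) d v)" for v d
    unfolding g_def part_sum vec_part_def
    by (intro sum.cong refl part_mult_right) (use f(1) in \<open>auto simp: homogeneous_part_iff monom_degree_add\<close>)
  have lin: "Vector_Spaces.linear vscale fscale (\<lambda>v. csum \<phi> (g v))"
  proof -
    have "g (v + w) = g v + g w" for v w by (simp add: g_def distrib_right sum.distrib)
    moreover have "g (vscale c v) = single 0 c * g v" for c v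
      by (simp add: g_def vscale_def sum_distrib_left mult.assoc)
    ultimately show ?thesis
      unfolding Vector_Spaces.linear_iff using vector_space_vscale vector_space_fun
      by (auto simp: fun_eq_iff csum_add csum_scale)
  qed
  let ?X = "\<lambda>d. graded_part V (rank F 0) (shift F 0) d"
  have img: "(\<lambda>v. csum \<phi> (g v)) ` ?X d = {h. \<forall>c. c \<notin> \<phi> ` monoms V d \<longrightarrow> h c = 0}" for d
  proof (intro equalityI subsetI)
    fix h assume "h \<in> (\<lambda>v. csum \<phi> (g v)) ` ?X d"
    then obtain v where v: "h = csum \<phi> (g v)" "v \<in> free_module V (rank F 0)" "vec_homogeneous (shift F 0) d v"
      by (auto simp: graded_part_def)
    have gv: "part (\<lambda>t. monom_degree t = d) (g v) = g v"
      by (simp add: g_part vec_part_homogeneous[OF v(3)])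
    have "h c = 0" if "c \<notin> \<phi> ` monoms V d" for c
      using csum_part_degree[OF deg gV[OF v(2)], of d c] that unfolding gv v(1) by simp
    then show "h \<in> {h. \<forall>c. c \<notin> \<phi> ` monoms V d \<longrightarrow> h c = 0}" by blast
  next
    fix h :: "'c \<Rightarrow> 'a" assume h: "h \<in> {h. \<forall>c. c \<notin> \<phi> ` monoms V d \<longrightarrow> h c = 0}"
    \<comment> \<open>One monomial per class turns a prescribed function on classes into a
      homogeneous polynomial with these class sums.\<close>
    define rep where "rep c = (SOME t. t \<in> monoms V d \<and> \<phi> t = c)" for c
    have rep: "rep c \<in> monoms V d" "\<phi> (rep c) = c" if "c \<in> \<phi> ` monoms V d" for c
      using that someI_ex[of "\<lambda>t. t \<in> monoms V d \<and> \<phi> t = c"] by (auto simp: rep_def)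
    define p where "p = (\<Sum>c\<in>\<phi> ` monoms V d. single (rep c) (h c))"
    have pV: "p \<in> polys V"
      unfolding p_def using rep(1) by (intro polys_sum polys_single) (auto simp: monoms_def)
    have p_part: "part (\<lambda>t. monom_degree t = d) p = p"
    proof -
      have "part (\<lambda>t. monom_degree t = d) (single (rep c) (h c)) = single (rep c) (h c)"
        if "c \<in> \<phi> ` monoms V d" for c
        using rep(1)[OF that] by (intro part_id) (auto simp: monoms_def split: if_splits)
      then show ?thesis by (simp add: p_def part_sum)
    qed
    have ch: "csum \<phi> p = h"
    proof
      fix c
      have "csum \<phi> p c = (\<Sum>c'\<in>\<phi> ` monoms V d. if c' = c then h c' else 0)"
        unfolding p_def csum_sum by (rule sum.cong[OF refl]) (simp add: csum_single rep)
      then show "csum \<phi> p c = h c" using h finite_monoms[OF V, of d] by auto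
    qed
    \<comment> \<open>Surjectivity of the augmentation gives a preimage \<open>v\<close> of any
      degree; its component of degree \<open>d\<close> still has the class sums \<open>h\<close>, as
      these live in degree \<open>d\<close> only.\<close>
    have "?I +>\<^bsub>poly_ring V\<^esub> p \<in> augmentation ?N F ` free_module V (rank F 0)"
      using G pV by (auto simp: graded_free_resolution_def carrier_graded_quotient[OF I])
    then obtain v where v: "v \<in> free_module V (rank F 0)" "?I +>\<^bsub>poly_ring V\<^esub> p = ?I +>\<^bsub>poly_ring V\<^esub> g v"
      using aug by auto
    have "csum \<phi> p = csum \<phi> (g v)"
    proof -
      interpret cring "poly_ring V :: ('x, 'a) mpoly ring" by (rule poly_ring_cring)
      interpret ideal ?I "poly_ring V" by (rule I)
      have "p \<in> ?I +>\<^bsub>poly_ring V\<^esub> g v" using a_rcos_self[OF pV] v(2) by simp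
      then obtain q where q: "q \<in> ?I" "p = q + g v" unfolding a_r_coset_def' poly_ring_simps by blast
      have "csum \<phi> q c = 0" for c using q(1) unfolding class_ideal_def by blast
      then show ?thesis unfolding q(2) by (intro ext) (simp add: csum_add)
    qed
    then have "csum \<phi> (part (\<lambda>t. monom_degree t = d) (g v)) = h"
      using h by (intro ext) (auto simp: csum_part_degree[OF deg gV[OF v(1)]] ch)
    moreover have "vec_part (shift F 0) d v \<in> ?X d"
      using vec_part_free_module[OF v(1)] by (simp add: graded_part_def vec_homogeneous_vec_part)
    ultimately show "h \<in> (\<lambda>v. csum \<phi> (g v)) ` ?X d" unfolding g_part by blast
  qed
  define x where "x i d = vdim (graded_part V (rank F i) (shift F i) d :: (nat \<Rightarrow> ('x, 'a) mpoly) set)" for i d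
  have alt: "(\<Sum>i\<le>card V. (- 1) ^ i * int (x i d)) = int (card (\<phi> ` monoms V d))" for d
  proof -
    have "{u \<in> ?X d. augmentation ?N F u = \<zero>\<^bsub>?N\<^esub>} = {u \<in> ?X d. csum \<phi> (g u) = 0}"
      using aug0 by (auto simp: graded_part_def)
    moreover have "x 0 d = vdim {u \<in> ?X d. csum \<phi> (g u) = 0} + card (\<phi> ` monoms V d)"
      using graded_part_rank_nullity[OF V lin, of "rank F 0" "shift F 0" d]
        dim_functions_supported[of "\<phi> ` monoms V d", where 'a = 'a] finite_monoms[OF V, of d]
      by (simp add: x_def img)
    ultimately show ?thesis using alternating_sum_graded_part[OF V F, of d] by (simp add: x_def)
  qed
  show ?thesis
  proof (rule fps_ext)
    fix d
    let ?H = "Abs_fps (\<lambda>d. int (card (monoms V d)))"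
    \<comment> \<open>A shift by \<open>j\<close> multiplies the series of the ring by
      \<open>fps_X ^ j\<close>, which reproduces the dimension formula for a free module.\<close>
    have m: "fps_nth (fps_of_poly (Polynomial.monom c j) * ?H) d
        = c * int (if j \<le> d then card (monoms V (d - j)) else 0)" for c j
      by (simp add: fps_of_poly_monom mult.assoc fps_X_power_mult_nth)
    have "fps_nth (fps_of_poly (hilbert_poincare V ?N) * ?H) d
        = (\<Sum>i\<le>card V. \<Sum>k<rank F i. (- 1) ^ i * int (if shift F i k \<le> d then card (monoms V (d - shift F i k)) else 0))"
      unfolding hilbert_poincare_resolution[OF V F F_def]
      by (simp only: fps_of_poly_sum sum_distrib_right fps_sum_nth m)
    also have "\<dots> = (\<Sum>i\<le>card V. (- 1) ^ i * int (x i d))"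
      unfolding x_def graded_part_dim(1)[OF V] by (simp add: sum_distrib_left)
    also have "\<dots> = int (card (\<phi> ` monoms V d))" by (rule alt)
    finally show "fps_nth (fps_of_poly (hilbert_poincare V ?N) * ?H) d
        = fps_nth (Abs_fps (\<lambda>d. int (card (\<phi> ` monoms V d)))) d" by simp
  qed
qed

section \<open>Ideals of 2-minors and classes of monomials\<close>

text \<open>One term of a minor is replaced by the other inside a monomial. Both directions are
  included, so the reflexive transitive closure is an equivalence.\<close>

definition swap :: "(nat \<times> nat \<times> nat \<times> nat) set \<Rightarrow> (nat \<times> nat \<Rightarrow>\<^sub>0 nat) \<Rightarrow> (nat \<times> nat \<Rightarrow>\<^sub>0 nat) \<Rightarrow> bool" where
  "swap C u v \<longleftrightarrow> (\<exists>a1 a2 b1 b2 w. (a1, a2, b1, b2) \<in> C \<and>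
     (u = single (a1, b1) 1 + single (a2, b2) 1 + w \<and> v = single (a1, b2) 1 + single (a2, b1) 1 + w \<or>
      v = single (a1, b1) 1 + single (a2, b2) 1 + w \<and> u = single (a1, b2) 1 + single (a2, b1) 1 + w))"

definition swap_cong :: "(nat \<times> nat \<times> nat \<times> nat) set \<Rightarrow> (nat \<times> nat \<Rightarrow>\<^sub>0 nat) \<Rightarrow> (nat \<times> nat \<Rightarrow>\<^sub>0 nat) \<Rightarrow> bool" where
  "swap_cong C = (swap C)\<^sup>*\<^sup>*"

definition cls :: "(nat \<times> nat \<times> nat \<times> nat) set \<Rightarrow> (nat \<times> nat \<Rightarrow>\<^sub>0 nat) \<Rightarrow> (nat \<times> nat \<Rightarrow>\<^sub>0 nat) set" where
  "cls C u = {v. swap_cong C u v}"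

lemma swapI:
  assumes "(a1, a2, b1, b2) \<in> C"
  shows "swap C (single (a1, b1) 1 + single (a2, b2) 1 + w) (single (a1, b2) 1 + single (a2, b1) 1 + w)"
    and "swap C (single (a1, b2) 1 + single (a2, b1) 1 + w) (single (a1, b1) 1 + single (a2, b2) 1 + w)"
  using assms unfolding swap_def by blast+

lemma swap_cong_refl [simp]: "swap_cong C u u"
  by (simp add: swap_cong_def)

lemma swap_cong_trans [trans]: "swap_cong C u v \<Longrightarrow> swap_cong C v w \<Longrightarrow> swap_cong C u w"
  unfolding swap_cong_def by (rule rtranclp_trans)

lemma swap_sym: "swap C u v \<Longrightarrow> swap C v u"
  unfolding swap_def by blast

lemma swap_cong_sym: "swap_cong C u v \<Longrightarrow> swap_cong C v u"
proof -
  have "symp (swap C)" by (rule sympI) (rule swap_sym)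
  then show "swap_cong C u v \<Longrightarrow> swap_cong C v u" unfolding swap_cong_def by (rule sympD[OF symp_rtranclp])
qed

lemma swap_cong_swap: "swap C u v \<Longrightarrow> swap_cong C u v"
  unfolding swap_cong_def by (rule r_into_rtranclp)

lemma swap_cong_invariant:
  assumes "swap_cong C u v" "P u" "\<And>u v. swap C u v \<Longrightarrow> P u \<Longrightarrow> P v"
  shows "P v"
  using assms(1) unfolding swap_cong_def by (induction rule: rtranclp_induct) (use assms(2,3) in auto)

lemma cls_eq_iff: "cls C u = cls C v \<longleftrightarrow> swap_cong C u v"
  unfolding cls_def using swap_cong_refl swap_cong_sym swap_cong_trans by blast

lemma swap_add: "swap C u v \<Longrightarrow> swap C (w + u) (w + v)"
proof -
  assume "swap C u v"
  then obtain a1 a2 b1 b2 z where *: "(a1, a2, b1, b2) \<in> C"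
    "u = single (a1, b1) 1 + single (a2, b2) 1 + z \<and> v = single (a1, b2) 1 + single (a2, b1) 1 + z \<or>
     v = single (a1, b1) 1 + single (a2, b2) 1 + z \<and> u = single (a1, b2) 1 + single (a2, b1) 1 + z"
    unfolding swap_def by blast
  show ?thesis
    unfolding swap_def using *(1)
    by (rule_tac x = a1 in exI, rule_tac x = a2 in exI, rule_tac x = b1 in exI, rule_tac x = b2 in exI,
        rule_tac x = "w + z" in exI) (use *(2) in \<open>auto simp: ac_simps\<close>)
qed

lemma swap_cong_add:
  assumes "swap_cong C u v" shows "swap_cong C (w + u) (w + v)"
  using assms by (rule swap_cong_invariant) (auto intro: swap_cong_trans swap_cong_swap swap_add)

lemma swap_monom_degree: "swap C u v \<Longrightarrow> monom_degree u = monom_degree v"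
  unfolding swap_def by (elim exE conjE disjE) (simp_all add: monom_degree_add)

lemma swap_cong_monom_degree:
  assumes "swap_cong C u v" shows "monom_degree u = monom_degree v"
  using assms by (rule swap_cong_invariant) (simp_all add: swap_monom_degree)

lemma swap_keys: "swap C u v \<Longrightarrow> keys u \<subseteq> A \<times> B \<Longrightarrow> keys v \<subseteq> A \<times> B"
  unfolding swap_def by (elim exE conjE disjE) (simp_all add: keys_plus_nat)

lemma swap_cong_keys:
  assumes "swap_cong C u v" "keys u \<subseteq> A \<times> B" shows "keys v \<subseteq> A \<times> B"
  using assms by (rule swap_cong_invariant) (rule swap_keys)

text \<open>Both terms of a minor involve the same two rows. This invariant later separates classes
  with different first rows.\<close>

lemma swap_rows: "swap C u v \<Longrightarrow> fst ` keys u = fst ` keys v"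
  unfolding swap_def by (elim exE conjE disjE) (simp_all add: keys_plus_nat image_Un insert_commute)

lemma swap_cong_rows:
  assumes "swap_cong C u v" shows "fst ` keys u = fst ` keys v"
  using assms by (rule swap_cong_invariant) (simp_all add: swap_rows)

lemma minor_eq: "minor (a1, a2, b1, b2) = (single (single (a1, b1) 1 + single (a2, b2) 1) 1
    - single (single (a1, b2) 1 + single (a2, b1) 1) 1 :: (nat \<times> nat, 'a::field) mpoly)"
  by (simp add: minor_def indet_def mult_single)

text \<open>Since \<open>\<phi>\<close> is compatible with multiplication of monomials, a monomial
  maps each class into a single class, and class sums of a product vanish with those of
  \<open>p\<close>.\<close>

lemma class_ideal_ideal:
  assumes add: "\<And>u v w. \<phi> u = \<phi> v \<Longrightarrow> \<phi> (w + u) = \<phi> (w + v)"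
  shows "ideal (class_ideal V \<phi> :: ('x, 'a::field) mpoly set) (poly_ring V)"
proof -
  interpret R: cring "poly_ring V :: ('x, 'a) mpoly ring" by (rule poly_ring_cring)
  let ?I = "class_ideal V \<phi> :: ('x, 'a) mpoly set"
  have single: "csum \<phi> (single t a * p) c = 0" if p: "p \<in> ?I" for t a p c
  proof -
    let ?f = "\<lambda>s. if \<phi> (t + s) = c then a * lookup p s else 0"
    have "single t a * p = (\<Sum>s\<in>keys p. single (t + s) (a * lookup p s))"
      by (subst sum_singles[of p, symmetric]) (simp add: sum_distrib_left mult_single)
    then have "csum \<phi> (single t a * p) c = (\<Sum>s\<in>keys p. ?f s)"
      by (simp add: csum_sum csum_single)
    \<comment> \<open>Terms are grouped by their class before multiplication; each group contributes
      a constant times a class sum of \<open>p\<close>.\<close>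
    also have "\<dots> = (\<Sum>c'\<in>\<phi> ` keys p. \<Sum>s\<in>{s \<in> keys p. \<phi> s = c'}. ?f s)"
      by (rule sum.group[symmetric]) auto
    also have "\<dots> = 0"
    proof (rule sum.neutral, rule ballI)
      fix c' assume "c' \<in> \<phi> ` keys p"
      then obtain s0 where s0: "c' = \<phi> s0" by blast
      have "?f s = (if \<phi> (t + s0) = c then a else 0) * lookup p s" if "\<phi> s = c'" for s
        using add[of s s0 t] that s0 by simp
      then have "(\<Sum>s\<in>{s \<in> keys p. \<phi> s = c'}. ?f s) = (if \<phi> (t + s0) = c then a else 0) * csum \<phi> p c'"
        unfolding csum_def sum_distrib_left by (intro sum.cong) auto
      also have "csum \<phi> p c' = 0" using p by (simp add: class_ideal_def)
      finally show "(\<Sum>s\<in>{s \<in> keys p. \<phi> s = c'}. ?f s) = 0" by simp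
    qed
    finally show ?thesis .
  qed
  have mult: "q * p \<in> ?I" if "p \<in> ?I" "q \<in> polys V" for p q
  proof -
    have "csum \<phi> (q * p) c = 0" for c
    proof -
      have "q * p = (\<Sum>t\<in>keys q. single t (lookup q t) * p)"
        by (subst sum_singles[of q, symmetric]) (simp add: sum_distrib_right)
      then show ?thesis by (simp add: csum_sum single[OF that(1)])
    qed
    then show ?thesis using that by (simp add: class_ideal_def polys_mult)
  qed
  show ?thesis
  proof (rule idealI)
    show "ring (poly_ring V :: ('x, 'a) mpoly ring)" by (rule R.ring_axioms)
    show "subgroup ?I (add_monoid (poly_ring V))"
    proof (rule group.subgroupI)
      show "group (add_monoid (poly_ring V :: ('x, 'a) mpoly ring))" by (rule R.a_group)
      fix p assume p: "p \<in> ?I"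
      have "\<ominus>\<^bsub>poly_ring V\<^esub> p = - p"
        using p polys_uminus[of p V] by (intro R.minus_equality) (simp_all add: class_ideal_def)
      then have "inv\<^bsub>add_monoid (poly_ring V)\<^esub> p = - p" unfolding a_inv_def .
      then show "inv\<^bsub>add_monoid (poly_ring V)\<^esub> p \<in> ?I"
        using p by (simp only:) (simp add: class_ideal_def polys_uminus csum_uminus)
    qed (auto simp: class_ideal_def csum_add polys_add intro: exI[of _ 0])
  qed (use mult in \<open>auto simp: mult.commute\<close>)
qed

text \<open>Vanishing class sums exclude a class with exactly one term. Subtracting a multiple of
  the difference of two equivalent monomials of \<open>p\<close> removes a term and introduces no
  new monomial, so induction on the number of terms applies.\<close>

lemma class_ideal_subset:
  fixes J :: "('x, 'a::field) mpoly set"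
  assumes J: "ideal J (poly_ring V)"
    and diff: "\<And>u v. keys u \<subseteq> V \<Longrightarrow> keys v \<subseteq> V \<Longrightarrow> \<phi> u = \<phi> v \<Longrightarrow> single u 1 - single v 1 \<in> J"
  shows "class_ideal V \<phi> \<subseteq> J"
proof
  interpret R: cring "poly_ring V :: ('x, 'a) mpoly ring" by (rule poly_ring_cring)
  interpret J: ideal J "poly_ring V" by (rule J)
  fix p :: "('x, 'a) mpoly"
  assume "p \<in> class_ideal V \<phi>"
  then show "p \<in> J"
  proof (induction "card (keys p)" arbitrary: p rule: less_induct)
    case less
    show ?case
    proof (cases "p = 0")
      case True
      then show ?thesis using J.zero_closed by simp
    next
      case False
      then obtain t where t: "t \<in> keys p" by (metis keys_eq_empty ex_in_conv)
      have pV: "p \<in> polys V" and cs: "csum \<phi> p c = 0" for c using less.prems by (simp_all add: class_ideal_def)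
      have "\<exists>u\<in>keys p. u \<noteq> t \<and> \<phi> u = \<phi> t"
      proof (rule ccontr)
        assume "\<not> ?thesis"
        then have "{u \<in> keys p. \<phi> u = \<phi> t} = {t}" using t by auto
        then have "csum \<phi> p (\<phi> t) = lookup p t" by (simp add: csum_def)
        then show False using cs t by (simp add: in_keys_iff)
      qed
      then obtain u where u: "u \<in> keys p" "u \<noteq> t" "\<phi> u = \<phi> t" by blast
      have V: "keys t \<subseteq> V" "keys u \<subseteq> V" using pV t u(1) by (auto simp: polys_iff)
      let ?a = "lookup p t"
      let ?q = "single 0 ?a * (single t 1 - single u 1)"
      have q_eq: "?q = single t ?a - single u ?a" by (simp add: right_diff_distrib mult_single)
      have qJ: "?q \<in> J" using J.I_l_closed[OF diff[OF V]] u(3) polys_single[of 0 V ?a] by simp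
      have "keys (p - ?q) \<subseteq> keys p - {t}"
        using u(1,2) t by (auto simp: q_eq in_keys_iff lookup_minus lookup_single when_def split: if_splits)
      then have "card (keys (p - ?q)) < card (keys p)"
        using t by (intro psubset_card_mono) auto
      moreover have "p - ?q \<in> class_ideal V \<phi>"
        using pV V cs u(3) by (auto simp: class_ideal_def q_eq csum_diff csum_single intro!: polys_diff polys_single)
      ultimately have "p - ?q \<in> J" by (rule less.hyps)
      from J.a_closed[OF this qJ] show ?thesis by (simp only: poly_ring_simps diff_add_cancel)
    qed
  qed
qed

text \<open>A swap changes a monomial by plus or minus a monomial multiple of a minor, so
  differences of congruent monomials lie in the ideal; conversely the two terms of a minor are
  congruent with opposite coefficients.\<close>

lemma minor_ideal_eq_class_ideal:
  assumes C: "C \<subseteq> two_minors {1..m} {1..n}"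
  shows "(minor_ideal m n C :: (nat \<times> nat, 'a::field) mpoly set) = class_ideal (matrix_vars m n) (cls C)"
    and "ideal (class_ideal (matrix_vars m n) (cls C) :: (nat \<times> nat, 'a) mpoly set) (poly_ring (matrix_vars m n))"
proof -
  let ?V = "matrix_vars m n"
  interpret R: cring "poly_ring ?V :: (nat \<times> nat, 'a) mpoly ring" by (rule poly_ring_cring)
  let ?J = "minor_ideal m n C :: (nat \<times> nat, 'a) mpoly set"
  have minors: "minor ` C \<subseteq> (polys ?V :: (nat \<times> nat, 'a) mpoly set)"
  proof
    fix p :: "(nat \<times> nat, 'a) mpoly" assume "p \<in> minor ` C"
    then obtain a1 a2 b1 b2 where "(a1, a2, b1, b2) \<in> C" "p = minor (a1, a2, b1, b2)" by auto
    then show "p \<in> polys ?V"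
      using C unfolding minor_eq
      by (auto simp: two_minors_def matrix_vars_def keys_plus_nat intro!: polys_diff polys_single)
  qed
  have J: "ideal ?J (poly_ring ?V)" unfolding minor_ideal_def by (rule R.genideal_ideal[OF minors])
  interpret J: ideal ?J "poly_ring ?V" by (rule J)
  show I: "ideal (class_ideal ?V (cls C) :: (nat \<times> nat, 'a) mpoly set) (poly_ring ?V)"
    by (rule class_ideal_ideal) (simp add: cls_eq_iff swap_cong_add)
  have "minor ` C \<subseteq> (class_ideal ?V (cls C) :: (nat \<times> nat, 'a) mpoly set)"
  proof
    fix p :: "(nat \<times> nat, 'a) mpoly" assume "p \<in> minor ` C"
    then obtain a1 a2 b1 b2 where *: "(a1, a2, b1, b2) \<in> C" "p = minor (a1, a2, b1, b2)" by auto
    have "swap C (single (a1, b1) 1 + single (a2, b2) 1) (single (a1, b2) 1 + single (a2, b1) 1)"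
      unfolding swap_def using *(1) by (metis add.right_neutral)
    then have "cls C (single (a1, b1) 1 + single (a2, b2) 1) = cls C (single (a1, b2) 1 + single (a2, b1) 1)"
      unfolding cls_eq_iff by (rule swap_cong_swap)
    then have "csum (cls C) p c = 0" for c
      unfolding *(2) minor_eq csum_diff csum_single by simp
    moreover have "p \<in> polys ?V" using minors *(1) unfolding *(2) by blast
    ultimately show "p \<in> class_ideal ?V (cls C)" by (simp add: class_ideal_def)
  qed
  then have sub: "?J \<subseteq> class_ideal ?V (cls C)"
    unfolding minor_ideal_def by (rule R.genideal_minimal[OF I])
  have step: "single u 1 - single v 1 \<in> ?J" if uv: "swap C u v" and u: "keys u \<subseteq> ?V" for u v
  proof -
    have minor_mult: "single (z + (single (a1, b1) 1 + single (a2, b2) 1)) 1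
        - single (z + (single (a1, b2) 1 + single (a2, b1) 1)) 1 \<in> ?J"
      if "(a1, a2, b1, b2) \<in> C" "keys z \<subseteq> ?V" for a1 a2 b1 b2 z
    proof -
      have "minor (a1, a2, b1, b2) \<in> ?J"
        unfolding minor_ideal_def using R.genideal_self[OF minors] that(1) by blast
      from J.I_l_closed[OF this polys_single[OF that(2), of 1]]
      show ?thesis by (simp add: minor_eq right_diff_distrib mult_single)
    qed
    obtain a1 a2 b1 b2 z where *: "(a1, a2, b1, b2) \<in> C"
      "u = single (a1, b1) 1 + single (a2, b2) 1 + z \<and> v = single (a1, b2) 1 + single (a2, b1) 1 + z \<or>
       v = single (a1, b1) 1 + single (a2, b2) 1 + z \<and> u = single (a1, b2) 1 + single (a2, b1) 1 + z"
      using uv unfolding swap_def by blast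
    then have "keys z \<subseteq> ?V" using u by (auto simp: keys_plus_nat)
    from minor_mult[OF *(1) this] have
      "single (single (a1, b1) 1 + single (a2, b2) 1 + z) 1 - single (single (a1, b2) 1 + single (a2, b1) 1 + z) 1 \<in> ?J"
      by (simp add: add.commute)
    moreover have "- p \<in> ?J" if "p \<in> ?J" for p
      using J.I_l_closed[OF that polys_uminus[OF polys_one]] by simp
    ultimately show ?thesis using *(2) by (metis minus_diff_eq)
  qed
  have "single u 1 - single v 1 \<in> ?J" if "swap_cong C u v" "keys u \<subseteq> ?V" for u v
    using that(1)
  proof (rule swap_cong_invariant[where P = "\<lambda>v. keys v \<subseteq> ?V \<and> single u 1 - single v 1 \<in> ?J", THEN conjunct2])
    show "keys u \<subseteq> ?V \<and> single u 1 - single u 1 \<in> ?J" using that(2) J.zero_closed by simp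
  next
    fix v w assume vw: "swap C v w" and v: "keys v \<subseteq> ?V \<and> single u 1 - single v 1 \<in> ?J"
    have "(single u 1 - single v 1) + (single v 1 - single w 1) \<in> ?J"
      using J.a_closed[of "single u 1 - single v 1" "single v 1 - single w 1"] v step[OF vw] by simp
    moreover have "keys w \<subseteq> ?V" using swap_keys[OF vw] v unfolding matrix_vars_def by blast
    ultimately show "keys w \<subseteq> ?V \<and> single u 1 - single w 1 \<in> ?J" by simp
  qed
  then have "class_ideal ?V (cls C) \<subseteq> ?J"
    by (intro class_ideal_subset[OF J]) (simp add: cls_eq_iff)
  then show "?J = class_ideal ?V (cls C)" using sub by blast
qed

section \<open>Counting classes\<close>

text \<open>The set \<open>W\<close> is a parameter so that submatrices can be treated with the same
  relation.\<close>

definition class_series :: "(nat \<times> nat \<times> nat \<times> nat) set \<Rightarrow> (nat \<times> nat) set \<Rightarrow> int fps" where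
  "class_series C W = Abs_fps (\<lambda>d. int (card (cls C ` monoms W d)))"

lemma cls_empty: "cls {} u = {u}"
proof -
  have "v = u" if "swap_cong {} u v" for v
    using that by (rule swap_cong_invariant) (auto simp: swap_def)
  then show ?thesis by (auto simp: cls_def)
qed

lemma class_series_empty: "class_series {} W = Abs_fps (\<lambda>d. int (card (monoms W d)))"
  unfolding class_series_def by (subst card_image) (auto simp: cls_empty inj_on_def)

lemma card_image_same_kernel:
  assumes "\<And>a b. a \<in> A \<Longrightarrow> b \<in> A \<Longrightarrow> f a = f b \<longleftrightarrow> g a = g b"
  shows "card (f ` A) = card (g ` A)"
proof (rule bij_betw_same_card)
  have r: "inv_into A f (f a) \<in> A" "f (inv_into A f (f a)) = f a" if "a \<in> A" for a
    using that by (auto intro: inv_into_into f_inv_into_f)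
  show "bij_betw (\<lambda>y. g (inv_into A f y)) (f ` A) (g ` A)"
    unfolding bij_betw_def
  proof (intro conjI inj_onI)
    fix x y assume "x \<in> f ` A" "y \<in> f ` A" "g (inv_into A f x) = g (inv_into A f y)"
    then show "x = y" using assms r by (metis imageE)
  next
    have "g (inv_into A f (f a)) = g a" if "a \<in> A" for a using assms r that by blast
    then show "(\<lambda>y. g (inv_into A f y)) ` f ` A = g ` A" by (force simp: image_image)
  qed
qed

lemma monoms_zero: "monoms W 0 = {0}"
  by (auto simp: monoms_def)

text \<open>The exponent of \<open>x\<close> is constant on classes. Classes containing
  \<open>x\<close> correspond to all classes of one degree less, because \<open>x\<close> can be
  cancelled from a chain of swaps.\<close>

lemma class_series_remove_free:
  assumes W: "finite W" "x \<in> W"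
    and free: "\<And>a1 a2 b1 b2. (a1, a2, b1, b2) \<in> C \<Longrightarrow> x \<notin> {a1, a2} \<times> {b1, b2}"
  shows "class_series C W * (1 - fps_X) = class_series C (W - {x})"
proof -
  let ?e = "single x (1::nat)"
  have inv: "lookup u x = lookup v x" if "swap_cong C u v" for u v
    using that
  proof (rule swap_cong_invariant)
    fix v w assume "swap C v w" and v: "lookup u x = lookup v x"
    show "lookup u x = lookup w x"
    proof -
      obtain a1 a2 b1 b2 z where C: "(a1, a2, b1, b2) \<in> C" and
        *: "v = single (a1, b1) 1 + single (a2, b2) 1 + z \<and> w = single (a1, b2) 1 + single (a2, b1) 1 + z \<or>
         w = single (a1, b1) 1 + single (a2, b2) 1 + z \<and> v = single (a1, b2) 1 + single (a2, b1) 1 + z"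
        using \<open>swap C v w\<close> unfolding swap_def by blast
      have "x \<noteq> (a1, b1)" "x \<noteq> (a1, b2)" "x \<noteq> (a2, b1)" "x \<noteq> (a2, b2)" using free[OF C] by auto
      then show ?thesis using * v by (elim disjE conjE) (simp_all add: lookup_add lookup_single when_def)
    qed
  qed simp
  \<comment> \<open>No entry of the swapped minor is \<open>x\<close>, so the factor
    \<open>x\<close> sits in the cofactor of the swap and survives it.\<close>
  have step: "\<exists>z. y = ?e + z \<and> swap C u z" if uy: "swap C (?e + u) y" for u y
  proof -
    have aux: "\<exists>w'. w = ?e + w' \<and> u = p + q + w'"
      if "?e + u = p + q + w" "lookup p x = 0" "lookup q x = 0" for p q w
    proof -
      have "lookup (?e + u) x = lookup (p + q + w) x" unfolding that(1) ..
      then have "x \<in> keys w" using that(2,3) by (simp add: lookup_add in_keys_iff)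
      then obtain w' where w': "w = ?e + w'" using monom_split[of x w] by blast
      have "?e + u = ?e + (p + q + w')" unfolding that(1) w' by (simp only: ac_simps)
      then have "u = p + q + w'" by (rule add_left_imp_eq)
      then show ?thesis using w' by blast
    qed
    obtain a1 a2 b1 b2 w where C: "(a1, a2, b1, b2) \<in> C" and
      *: "?e + u = single (a1, b1) 1 + single (a2, b2) 1 + w \<and> y = single (a1, b2) 1 + single (a2, b1) 1 + w \<or>
       y = single (a1, b1) 1 + single (a2, b2) 1 + w \<and> ?e + u = single (a1, b2) 1 + single (a2, b1) 1 + w"
      using uy unfolding swap_def by blast
    have z: "lookup (single (a1, b1) (1::nat)) x = 0" "lookup (single (a1, b2) (1::nat)) x = 0"
      "lookup (single (a2, b1) (1::nat)) x = 0" "lookup (single (a2, b2) (1::nat)) x = 0"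
      using free[OF C] by (auto simp: lookup_single when_def)
    from * show ?thesis
    proof
      assume h: "?e + u = single (a1, b1) 1 + single (a2, b2) 1 + w \<and> y = single (a1, b2) 1 + single (a2, b1) 1 + w"
      then obtain w' where "w = ?e + w'" "u = single (a1, b1) 1 + single (a2, b2) 1 + w'" using aux z by blast
      with h swapI(1)[OF C] show ?thesis
        by (intro exI[of _ "single (a1, b2) 1 + single (a2, b1) 1 + w'"]) (simp add: ac_simps)
    next
      assume h: "y = single (a1, b1) 1 + single (a2, b2) 1 + w \<and> ?e + u = single (a1, b2) 1 + single (a2, b1) 1 + w"
      then obtain w' where "w = ?e + w'" "u = single (a1, b2) 1 + single (a2, b1) 1 + w'" using aux z by blast
      with h swapI(2)[OF C] show ?thesis
        by (intro exI[of _ "single (a1, b1) 1 + single (a2, b2) 1 + w'"]) (simp add: ac_simps)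
    qed
  qed
  have cancel: "swap_cong C (?e + u) (?e + v) \<longleftrightarrow> swap_cong C u v" for u v
  proof
    assume "swap_cong C (?e + u) (?e + v)"
    then have "\<exists>z. ?e + v = ?e + z \<and> swap_cong C u z"
    proof (rule swap_cong_invariant[where P = "\<lambda>y. \<exists>z. y = ?e + z \<and> swap_cong C u z"])
      fix a b assume ab: "swap C a b" and "\<exists>z. a = ?e + z \<and> swap_cong C u z"
      then obtain z where z: "a = ?e + z" "swap_cong C u z" by blast
      then obtain z' where "b = ?e + z'" "swap C z z'" using step[of z b] ab by blast
      then show "\<exists>z. b = ?e + z \<and> swap_cong C u z" using swap_cong_trans[OF z(2) swap_cong_swap] by blast
    qed (rule exI[of _ u], simp)
    then show "swap_cong C u v" by auto
  qed (rule swap_cong_add)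
  have count: "card (cls C ` monoms W (Suc d)) = card (cls C ` monoms (W - {x}) (Suc d)) + card (cls C ` monoms W d)" for d
  proof -
    have split: "monoms W (Suc d) = monoms (W - {x}) (Suc d) \<union> (\<lambda>u. ?e + u) ` monoms W d"
    proof (intro equalityI subsetI)
      fix u assume u: "u \<in> monoms W (Suc d)"
      show "u \<in> monoms (W - {x}) (Suc d) \<union> (\<lambda>u. ?e + u) ` monoms W d"
      proof (cases "x \<in> keys u")
        case True
        then obtain v where "u = ?e + v" using monom_split[OF True] by blast
        then show ?thesis using u by (auto simp: monoms_def keys_plus_nat monom_degree_add)
      next
        case False
        then show ?thesis using u by (auto simp: monoms_def)
      qed
    next
      fix u assume "u \<in> monoms (W - {x}) (Suc d) \<union> (\<lambda>u. ?e + u) ` monoms W d"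
      then show "u \<in> monoms W (Suc d)" using W(2) by (auto simp: monoms_def keys_plus_nat monom_degree_add)
    qed
    have "\<not> swap_cong C u (?e + v)" if "u \<in> monoms (W - {x}) (Suc d)" for u v
    proof
      assume "swap_cong C u (?e + v)"
      then have "lookup u x = Suc (lookup v x)" using inv by (fastforce simp: lookup_add)
      then have "x \<in> keys u" by (simp add: in_keys_iff)
      then show False using that by (auto simp: monoms_def)
    qed
    then have "cls C ` monoms (W - {x}) (Suc d) \<inter> cls C ` (\<lambda>u. ?e + u) ` monoms W d = {}"
      by (auto simp: cls_eq_iff)
    moreover have "card (cls C ` (\<lambda>u. ?e + u) ` monoms W d) = card (cls C ` monoms W d)"
      unfolding image_image by (rule card_image_same_kernel) (simp only: cls_eq_iff cancel)
    ultimately show ?thesis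
      unfolding split image_Un using W(1) by (simp add: card_Un_disjoint finite_monoms)
  qed
  have "class_series C W = class_series C (W - {x}) + fps_X * class_series C W"
  proof (rule fps_ext)
    fix d show "fps_nth (class_series C W) d = fps_nth (class_series C (W - {x}) + fps_X * class_series C W) d"
      by (cases d) (simp_all add: class_series_def count monoms_zero)
  qed
  then show ?thesis by (simp add: algebra_simps)
qed

lemma class_series_remove_free_set:
  assumes "finite A" "finite W" "A \<subseteq> W"
    and free: "\<And>x a1 a2 b1 b2. x \<in> A \<Longrightarrow> (a1, a2, b1, b2) \<in> C \<Longrightarrow> x \<notin> {a1, a2} \<times> {b1, b2}"
  shows "class_series C W * (1 - fps_X) ^ card A = class_series C (W - A)"
  using assms
proof (induction A rule: finite_induct)
  case (insert x A)
  have "class_series C W * (1 - fps_X) ^ card (insert x A) = class_series C (W - A) * (1 - fps_X)"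
  proof -
    have "class_series C W * (1 - fps_X) ^ card A = class_series C (W - A)"
      by (rule insert.IH) (use insert.prems in auto)
    then show ?thesis using insert.hyps by (simp add: mult_ac)
  qed
  also have "\<dots> = class_series C (W - A - {x})"
  proof (rule class_series_remove_free)
    show "x \<notin> {a1, a2} \<times> {b1, b2}" if "(a1, a2, b1, b2) \<in> C" for a1 a2 b1 b2
      by (rule insert.prems(3)[OF _ that]) simp
  qed (use insert.prems insert.hyps in auto)
  finally show ?case by (subst Diff_insert)
qed simp

text \<open>The Hilbert series of a polynomial ring, in the form of an inverse: without relations
  every indeterminate can be removed.\<close>

lemma class_series_empty_mult:
  assumes "finite W" shows "class_series {} W * (1 - fps_X) ^ card W = 1"
proof -
  have "class_series {} W * (1 - fps_X) ^ card W = class_series {} {}"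
    using class_series_remove_free_set[of W W "{}"] assms by simp
  also have "\<dots> = 1"
  proof (rule fps_ext)
    fix d have "monoms {} d = (if d = 0 then {0} else {} :: (nat \<times> nat \<Rightarrow>\<^sub>0 nat) set)"
      by (auto simp: monoms_def)
    then show "fps_nth (class_series {} {}) d = fps_nth 1 d" by (simp add: class_series_empty)
  qed
  finally show ?thesis .
qed

text \<open>The power of \<open>1 - fps_X\<close> inverts the series of the polynomial ring. From
  here on the problem is purely one of counting classes.\<close>

theorem hilbert_poincare_minor_ideal:
  assumes C: "C \<subseteq> two_minors {1..m} {1..n}"
  shows "fps_of_poly (hilbert_poincare (matrix_vars m n)
      (graded_quotient (matrix_vars m n) (minor_ideal m n C :: (nat \<times> nat, 'a::field) mpoly set)))
    = class_series C (matrix_vars m n) * (1 - fps_X) ^ (m * n)"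
proof -
  let ?V = "matrix_vars m n"
  let ?P = "fps_of_poly (hilbert_poincare ?V (graded_quotient ?V (minor_ideal m n C :: (nat \<times> nat, 'a) mpoly set)))"
  have V: "finite ?V" "card ?V = m * n" by (simp_all add: matrix_vars_def)
  have "degree_compatible ?V (cls C)"
    unfolding degree_compatible_def cls_eq_iff by (intro allI impI swap_cong_monom_degree)
  from hilbert_poincare_class_ideal[OF V(1) minor_ideal_eq_class_ideal(2)[OF C] this]
  have "?P * class_series {} ?V = class_series C ?V"
    unfolding minor_ideal_eq_class_ideal(1)[OF C] class_series_empty by (simp only: class_series_def)
  then have "class_series C ?V * (1 - fps_X) ^ (m * n) = ?P * (class_series {} ?V * (1 - fps_X) ^ (m * n))"
    by (simp only: mult.assoc[symmetric])
  also have "\<dots> = ?P" using class_series_empty_mult[OF V(1)] unfolding V(2) by simp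
  finally show ?thesis by (rule sym)
qed

section \<open>The classes of the corner-interval minors\<close>

text \<open>Frees the swaps from the order conditions on rows and columns; when two rows or two
  columns coincide, both sides are the same monomial.\<close>

lemma two_minors_cong:
  assumes "a \<in> A" "a' \<in> A" "b \<in> B" "b' \<in> B"
  shows "swap_cong (two_minors A B) (single (a, b) 1 + single (a', b') 1 + w) (single (a, b') 1 + single (a', b) 1 + w)"
proof -
  have lt: "swap_cong (two_minors A B) (single (a, b) 1 + single (a', b') 1 + w) (single (a, b') 1 + single (a', b) 1 + w)"
    if "a \<in> A" "a' \<in> A" "b \<in> B" "b' \<in> B" "a < a'" for a a' b b'
  proof (cases b b' rule: linorder_cases)
    case less
    then have "(a, a', b, b') \<in> two_minors A B" using that by (simp add: two_minors_def)
    then show ?thesis by (intro swap_cong_swap swapI(1))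
  next
    case greater
    then have "(a, a', b', b) \<in> two_minors A B" using that by (simp add: two_minors_def)
    then show ?thesis by (intro swap_cong_swap swapI(2))
  qed simp
  show ?thesis
  proof (cases a a' rule: linorder_cases)
    case greater
    from lt[OF assms(2,1,4,3) greater] show ?thesis by (simp add: add.commute)
  qed (use lt[OF assms] in \<open>simp_all add: add.commute\<close>)
qed

lemma corner_cong:
  assumes "a \<in> {1..m}" "a' \<in> {1..m}" "b \<in> {1..n}"
  shows "swap_cong (corner_interval_minors m n) (single (a, 1) 1 + single (a', b) 1 + w) (single (a, b) 1 + single (a', 1) 1 + w)"
proof -
  have n: "1 \<in> {1..n}" using assms(3) by simp
  have lt: "swap_cong (corner_interval_minors m n) (single (a, 1) 1 + single (a', b) 1 + w) (single (a, b) 1 + single (a', 1) 1 + w)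
      \<and> swap_cong (corner_interval_minors m n) (single (a, b) 1 + single (a', 1) 1 + w) (single (a, 1) 1 + single (a', b) 1 + w)"
    if "a \<in> {1..m}" "a' \<in> {1..m}" "a < a'" for a a'
  proof (cases "b = 1")
    case False
    then have "(a, a', 1, b) \<in> corner_interval_minors m n"
      using that assms(3) n by (simp add: corner_interval_minors_def two_minors_def)
    then show ?thesis by (intro conjI swap_cong_swap swapI)
  qed simp
  show ?thesis
  proof (cases a a' rule: linorder_cases)
    case greater
    from lt[OF assms(2,1) greater] show ?thesis by (simp add: add.commute)
  qed (use lt[OF assms(1,2)] in \<open>simp_all add: add.commute\<close>)
qed

section \<open>Congruence modulo all 2-minors, decided by row and column sums\<close>

definition row_sum :: "nat set \<Rightarrow> (nat \<times> nat \<Rightarrow>\<^sub>0 nat) \<Rightarrow> nat \<Rightarrow> nat" where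
  "row_sum B u i = (\<Sum>j\<in>B. lookup u (i, j))"

definition col_sum :: "nat set \<Rightarrow> (nat \<times> nat \<Rightarrow>\<^sub>0 nat) \<Rightarrow> nat \<Rightarrow> nat" where
  "col_sum A u j = (\<Sum>i\<in>A. lookup u (i, j))"

lemma row_sum_add: "row_sum B (u + v) i = row_sum B u i + row_sum B v i"
  by (simp add: row_sum_def lookup_add sum.distrib)

lemma col_sum_add: "col_sum A (u + v) j = col_sum A u j + col_sum A v j"
  by (simp add: col_sum_def lookup_add sum.distrib)

lemma row_sum_single: "finite B \<Longrightarrow> row_sum B (single (a, b) 1) i = (if i = a \<and> b \<in> B then 1 else 0)"
  by (auto simp: row_sum_def lookup_single when_def)

lemma col_sum_single: "finite A \<Longrightarrow> col_sum A (single (a, b) 1) j = (if j = b \<and> a \<in> A then 1 else 0)"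
  by (auto simp: col_sum_def lookup_single when_def)

text \<open>Row and column sums are the exponents of the image of a monomial under the toric map
  sending the entry at \<open>(i, j)\<close> to a product of a row variable and a column
  variable.\<close>

definition same_margins :: "nat set \<Rightarrow> nat set \<Rightarrow> (nat \<times> nat \<Rightarrow>\<^sub>0 nat) \<Rightarrow> (nat \<times> nat \<Rightarrow>\<^sub>0 nat) \<Rightarrow> bool" where
  "same_margins A B u v \<longleftrightarrow> row_sum B u = row_sum B v \<and> col_sum A u = col_sum A v"

lemma same_margins_add_cancel: "same_margins A B (w + u) (w + v) \<longleftrightarrow> same_margins A B u v"
  by (simp add: same_margins_def fun_eq_iff row_sum_add col_sum_add)

lemma swap_cong_same_margins:
  assumes "finite A" "finite B" "swap_cong (two_minors A B) u v"
  shows "same_margins A B u v"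
  using assms(3)
proof (rule swap_cong_invariant)
  fix v w assume "swap (two_minors A B) v w" and v: "same_margins A B u v"
  then have "same_margins A B v w"
    unfolding swap_def using assms(1,2)
    by (elim exE conjE disjE)
      (simp_all add: same_margins_def fun_eq_iff row_sum_add col_sum_add row_sum_single col_sum_single
        two_minors_def del: One_nat_def)
  then show "same_margins A B u w" using v by (simp add: same_margins_def)
qed (simp add: same_margins_def)

text \<open>Any indeterminate of \<open>u\<close> can be moved into \<open>v\<close> by a swap and then be cancelled.\<close>

lemma same_margins_cong:
  assumes A: "finite A" and B: "finite B"
  shows "same_margins A B u v \<Longrightarrow> keys u \<subseteq> A \<times> B \<Longrightarrow> keys v \<subseteq> A \<times> B \<Longrightarrow> swap_cong (two_minors A B) u v"
proof (induction "monom_degree u" arbitrary: u v)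
  case 0
  then have u: "u = 0" by simp
  have "v = 0"
  proof (rule ccontr)
    assume "v \<noteq> 0"
    then obtain i j where ij: "(i, j) \<in> keys v" by (metis keys_eq_empty ex_in_conv surj_pair)
    then have "j \<in> B" using 0 by auto
    then have "lookup v (i, j) \<le> row_sum B v i" unfolding row_sum_def using B by (intro member_le_sum) auto
    moreover have "row_sum B v i = 0" using 0(2) by (simp add: same_margins_def u row_sum_def fun_eq_iff)
    ultimately show False using ij by (simp add: in_keys_iff)
  qed
  then show ?case using u by simp
next
  case (Suc d)
  then have "keys u \<noteq> {}" by auto
  then obtain a b where ab: "(a, b) \<in> keys u" by (metis ex_in_conv surj_pair)
  then have aA: "a \<in> A" and bB: "b \<in> B" using Suc.prems(2) by auto
  obtain u' where u': "u = single (a, b) 1 + u'" using monom_split[OF ab] by blast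
  have "\<exists>v'. swap_cong (two_minors A B) v (single (a, b) 1 + v')"
  proof (cases "(a, b) \<in> keys v")
    case True
    then show ?thesis using monom_split[OF True] swap_cong_refl by metis
  next
    case False
    \<comment> \<open>Row \<open>a\<close> and column \<open>b\<close> occur in \<open>u\<close>,
      hence in \<open>v\<close>. As \<open>v\<close> lacks \<open>(a, b)\<close> itself, it has two
      distinct entries there, and swapping them creates \<open>(a, b)\<close>.\<close>
    have "row_sum B v a \<noteq> 0" "col_sum A v b \<noteq> 0"
    proof -
      have "row_sum B v a = row_sum B u a" "col_sum A v b = col_sum A u b"
        using Suc.prems(1) by (simp_all add: same_margins_def)
      then show "row_sum B v a \<noteq> 0" "col_sum A v b \<noteq> 0"
        using aA bB by (simp_all only: u' row_sum_add col_sum_add row_sum_single[OF B] col_sum_single[OF A]) simp_all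
    qed
    then obtain a' b' where b': "b' \<in> B" "lookup v (a, b') \<noteq> 0" and a': "a' \<in> A" "lookup v (a', b) \<noteq> 0"
      unfolding row_sum_def col_sum_def by (meson sum.neutral)
    obtain v1 where v1: "v = single (a, b') 1 + v1" using monom_split[of "(a, b')" v] b'(2) by (auto simp: in_keys_iff)
    have "(a, b') \<noteq> (a', b)" using False b'(2) a'(2) by (auto simp: in_keys_iff)
    then have "(a', b) \<in> keys v1" using a'(2) by (auto simp: v1 in_keys_iff lookup_add lookup_single when_def)
    then obtain v2 where v2: "v1 = single (a', b) 1 + v2" using monom_split by metis
    have "swap_cong (two_minors A B) v (single (a, b) 1 + (single (a', b') 1 + v2))"
      using two_minors_cong[OF aA a'(1) b'(1) bB, of v2] by (simp add: v1 v2 add.assoc)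
    then show ?thesis by blast
  qed
  then obtain v' where v': "swap_cong (two_minors A B) v (single (a, b) 1 + v')" by blast
  have k: "keys (single (a, b) 1 + v') \<subseteq> A \<times> B" by (rule swap_cong_keys[OF v' Suc.prems(3)])
  have "same_margins A B u (single (a, b) 1 + v')"
    using Suc.prems(1) swap_cong_same_margins[OF A B v'] by (simp add: same_margins_def)
  then have "same_margins A B u' v'" unfolding u' same_margins_add_cancel .
  moreover have "d = monom_degree u'" using Suc.hyps(2) by (simp add: u' monom_degree_add)
  moreover have "keys u' \<subseteq> A \<times> B" "keys v' \<subseteq> A \<times> B" using Suc.prems(2) k by (simp_all add: u' keys_plus_nat)
  ultimately have "swap_cong (two_minors A B) u' v'" by (intro Suc.hyps(1))
  then have "swap_cong (two_minors A B) u (single (a, b) 1 + v')" unfolding u' by (rule swap_cong_add)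
  then show ?case using swap_cong_trans swap_cong_sym[OF v'] by blast
qed

text \<open>Margins are additive, so \<open>w\<close> cancels in them. This is the monomial form of
  the fact that indeterminates are nonzerodivisors modulo the 2-minors.\<close>

lemma two_minors_cong_cancel:
  assumes "finite A" "finite B" "keys u \<subseteq> A \<times> B" "keys v \<subseteq> A \<times> B"
    and "swap_cong (two_minors A B) (w + u) (w + v)"
  shows "swap_cong (two_minors A B) u v"
  using swap_cong_same_margins[OF assms(1,2,5)] same_margins_cong[OF assms(1,2)] assms(3,4)
  unfolding same_margins_add_cancel by blast

text \<open>Swaps never leave the given rows, so all minors used along the chain are minors of the
  rows from \<open>t\<close> on.\<close>

lemma corner_cong_rows:
  assumes "swap_cong (corner_interval_minors m n) u v" and u: "keys u \<subseteq> {t..m} \<times> {1..n}"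
  shows "swap_cong (two_minors {t..m} {1..n}) u v"
proof -
  have "keys v \<subseteq> {t..m} \<times> {1..n} \<and> swap_cong (two_minors {t..m} {1..n}) u v"
    using assms(1)
  proof (rule swap_cong_invariant)
    fix v w assume vw: "swap (corner_interval_minors m n) v w"
      and v: "keys v \<subseteq> {t..m} \<times> {1..n} \<and> swap_cong (two_minors {t..m} {1..n}) u v"
    have w: "keys w \<subseteq> {t..m} \<times> {1..n}" using swap_keys[OF vw] v by blast
    obtain a1 a2 b1 b2 z where C: "(a1, a2, b1, b2) \<in> corner_interval_minors m n" and
      *: "v = single (a1, b1) 1 + single (a2, b2) 1 + z \<and> w = single (a1, b2) 1 + single (a2, b1) 1 + z \<or>
       w = single (a1, b1) 1 + single (a2, b2) 1 + z \<and> v = single (a1, b2) 1 + single (a2, b1) 1 + z"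
      using vw unfolding swap_def by blast
    then have "a1 \<in> {t..m}" "a2 \<in> {t..m}" using v by (auto simp: keys_plus_nat)
    then have "(a1, a2, b1, b2) \<in> two_minors {t..m} {1..n}"
      using C by (simp add: corner_interval_minors_def two_minors_def)
    then have "swap (two_minors {t..m} {1..n}) v w" using * swapI by blast
    then show "keys w \<subseteq> {t..m} \<times> {1..n} \<and> swap_cong (two_minors {t..m} {1..n}) u w"
      using w v swap_cong_trans swap_cong_swap by blast
  qed (use u in auto)
  then show ?thesis ..
qed

text \<open>Multiplied by an entry of the first column, an arbitrary minor is a combination of three minors
  that use the first column.\<close>

lemma two_minors_cong_corner:
  assumes t: "t \<in> {1..m}" and uv: "swap_cong (two_minors {t..m} {1..n}) u v"
  shows "swap_cong (corner_interval_minors m n) (single (t, 1) 1 + u) (single (t, 1) 1 + v)"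
proof -
  let ?C = "corner_interval_minors m n" and ?e = "\<lambda>i j. single (i::nat, j::nat) (1::nat)"
  have step: "swap_cong ?C (?e t 1 + (?e a1 b1 + ?e a2 b2 + z)) (?e t 1 + (?e a1 b2 + ?e a2 b1 + z))"
    if "(a1, a2, b1, b2) \<in> two_minors {t..m} {1..n}" for a1 a2 b1 b2 z
  proof -
    have r: "a1 \<in> {1..m}" "a2 \<in> {1..m}" "b1 \<in> {1..n}" "b2 \<in> {1..n}"
      using that t by (auto simp: two_minors_def)
    have "swap_cong ?C (?e t 1 + ?e a1 b1 + (?e a2 b2 + z)) (?e t b1 + ?e a1 1 + (?e a2 b2 + z))"
      by (rule corner_cong[OF t r(1) r(3)])
    also have "?e t b1 + ?e a1 1 + (?e a2 b2 + z) = ?e a1 1 + ?e a2 b2 + (?e t b1 + z)"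
      by (simp only: ac_simps)
    also have "swap_cong ?C (?e a1 1 + ?e a2 b2 + (?e t b1 + z)) (?e a1 b2 + ?e a2 1 + (?e t b1 + z))"
      by (rule corner_cong[OF r(1) r(2) r(4)])
    also have "?e a1 b2 + ?e a2 1 + (?e t b1 + z) = ?e t b1 + ?e a2 1 + (?e a1 b2 + z)"
      by (simp only: ac_simps)
    also have "swap_cong ?C (?e t b1 + ?e a2 1 + (?e a1 b2 + z)) (?e t 1 + ?e a2 b1 + (?e a1 b2 + z))"
      by (rule swap_cong_sym[OF corner_cong[OF t r(2) r(3)]])
    finally show ?thesis by (simp only: ac_simps)
  qed
  show ?thesis using uv
  proof (rule swap_cong_invariant)
    fix v w assume vw: "swap (two_minors {t..m} {1..n}) v w" and v: "swap_cong ?C (?e t 1 + u) (?e t 1 + v)"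
    have "swap_cong ?C (?e t 1 + v) (?e t 1 + w)"
      using vw unfolding swap_def using step swap_cong_sym by blast
    then show "swap_cong ?C (?e t 1 + u) (?e t 1 + w)" using v swap_cong_trans by blast
  qed simp
qed

text \<open>The factor in the first column makes all minors of the lower rows available, and after
  restriction to these rows it can be cancelled again. In terms of monomials this is the colon by
  that entry.\<close>

lemma corner_cong_iff:
  assumes t: "t \<in> {1..m}" and n: "1 \<le> n" and u: "keys u \<subseteq> {t..m} \<times> {1..n}" and v: "keys v \<subseteq> {t..m} \<times> {1..n}"
  shows "swap_cong (corner_interval_minors m n) (single (t, 1) 1 + u) (single (t, 1) 1 + v)
     \<longleftrightarrow> swap_cong (two_minors {t..m} {1..n}) u v"
proof
  assume *: "swap_cong (corner_interval_minors m n) (single (t, 1) 1 + u) (single (t, 1) 1 + v)"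
  have "keys (single (t, 1) 1 + u) \<subseteq> {t..m} \<times> {1..n}" using t n u by (simp add: keys_plus_nat)
  from two_minors_cong_cancel[OF _ _ u v corner_cong_rows[OF * this]]
  show "swap_cong (two_minors {t..m} {1..n}) u v" by simp
qed (rule two_minors_cong_corner[OF t])

text \<open>Each term of a corner-interval minor contains an entry of the first column, so no swap
  applies.\<close>

lemma corner_cong_no_first_column:
  assumes "swap_cong (corner_interval_minors m n) u v" and u: "keys u \<subseteq> {1..m} \<times> {2..n}"
  shows "v = u"
  using assms(1)
proof (rule swap_cong_invariant)
  fix v w assume "swap (corner_interval_minors m n) v w" and v: "v = u"
  obtain a where "(a, 1) \<in> keys u"
  proof -
    obtain a1 a2 b1 b2 z where "(a1, a2, b1, b2) \<in> corner_interval_minors m n" and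
      *: "v = single (a1, b1) 1 + single (a2, b2) 1 + z \<or> v = single (a1, b2) 1 + single (a2, b1) 1 + z"
      using \<open>swap (corner_interval_minors m n) v w\<close> unfolding swap_def by blast
    then have "b1 = 1" by (simp add: corner_interval_minors_def)
    then have "(a1, 1) \<in> keys u \<or> (a2, 1) \<in> keys u" using * v by (auto simp: keys_plus_nat)
    then show ?thesis using that by blast
  qed
  then show "w = u" using u by auto
qed simp

text \<open>The witness \<open>t\<close> is the first row whose entry in the first column occurs in the class.\<close>

lemma corner_class_normal_form:
  assumes u: "keys u \<subseteq> {1..m} \<times> {1..n}" and i: "(i, 1) \<in> keys u"
  obtains t w where "t \<in> {1..m}" "keys w \<subseteq> {t..m} \<times> {1..n}"
    "swap_cong (corner_interval_minors m n) u (single (t, 1) 1 + w)"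
proof -
  let ?C = "corner_interval_minors m n"
  define Q where "Q t \<longleftrightarrow> (\<exists>v. swap_cong ?C u v \<and> (t, 1) \<in> keys v)" for t
  define t where "t = (LEAST t. Q t)"
  have "Q i" unfolding Q_def using i by (intro exI[of _ u]) simp
  then have "Q t" unfolding t_def by (rule LeastI)
  then obtain v where v: "swap_cong ?C u v" "(t, 1) \<in> keys v" by (auto simp: Q_def)
  then obtain w where w: "v = single (t, 1) 1 + w" using monom_split[OF v(2)] by blast
  have kv: "keys v \<subseteq> {1..m} \<times> {1..n}" by (rule swap_cong_keys[OF v(1) u])
  then have t: "t \<in> {1..m}" using v(2) by auto
  have "keys w \<subseteq> {t..m} \<times> {1..n}"
  proof
    fix x assume x: "x \<in> keys w"
    obtain a b where ab: "x = (a, b)" by fastforce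
    have "(a, b) \<in> {1..m} \<times> {1..n}" using x kv by (auto simp: ab w keys_plus_nat)
    then have a: "a \<in> {1..m}" and b: "b \<in> {1..n}" by auto
    \<comment> \<open>An entry \<open>(a, b)\<close> of \<open>w\<close> can trade columns with
      \<open>(t, 1)\<close>, which produces \<open>(a, 1)\<close> in the class; minimality of
      \<open>t\<close> excludes smaller rows.\<close>
    have "t \<le> a"
    proof -
      obtain w' where w': "w = single (a, b) 1 + w'" using monom_split x ab by metis
      have "swap_cong ?C v (single (t, b) 1 + single (a, 1) 1 + w')"
        using corner_cong[OF t a b, of w'] by (simp only: w w' add.assoc)
      then have "swap_cong ?C u (single (t, b) 1 + single (a, 1) 1 + w')" using v(1) swap_cong_trans by blast
      then have "Q a" unfolding Q_def
        by (intro exI[of _ "single (t, b) 1 + single (a, 1) 1 + w'"]) (simp add: keys_plus_nat)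
      then show ?thesis unfolding t_def by (rule Least_le)
    qed
    then show "x \<in> {t..m} \<times> {1..n}" using a b by (simp add: ab)
  qed
  then show ?thesis using that t v(1) unfolding w by blast
qed

text \<open>Classes that avoid the first column are single monomials; the others are indexed by a
  row \<open>t\<close> and a class of \<open>w\<close> modulo the 2-minors of the lower rows, with
  \<open>fps_X\<close> accounting for the extra entry.\<close>

lemma class_series_corner:
  assumes n: "1 \<le> n"
  shows "class_series (corner_interval_minors m n) ({1..m} \<times> {1..n})
    = class_series {} ({1..m} \<times> {2..n})
      + (\<Sum>t = 1..m. fps_X * class_series (two_minors {t..m} {1..n}) ({t..m} \<times> {1..n}))"
proof (rule fps_ext)
  fix d
  let ?C = "corner_interval_minors m n" and ?W = "{1..m} \<times> {1..n}"
  let ?T = "\<lambda>t. two_minors {t..m} {1..n}" and ?R = "\<lambda>t. {t..m} \<times> {1..n}"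
  show "fps_nth (class_series ?C ?W) d = fps_nth (class_series {} ({1..m} \<times> {2..n})
      + (\<Sum>t = 1..m. fps_X * class_series (?T t) (?R t))) d"
  proof (cases d)
    case 0
    then show ?thesis by (simp add: class_series_def monoms_zero fps_sum_nth)
  next
    case (Suc e)
    let ?e = "\<lambda>t. single (t::nat, 1::nat) (1::nat)"
    let ?Z = "cls ?C ` monoms ({1..m} \<times> {2..n}) (Suc e)"
    let ?D = "\<lambda>t. (\<lambda>w. cls ?C (?e t + w)) ` monoms (?R t) e"
    have split: "cls ?C ` monoms ?W (Suc e) = ?Z \<union> (\<Union>t\<in>{1..m}. ?D t)"
    proof (intro equalityI subsetI)
      fix c assume "c \<in> cls ?C ` monoms ?W (Suc e)"
      then obtain u where u: "c = cls ?C u" "keys u \<subseteq> ?W" "monom_degree u = Suc e" by (auto simp: monoms_def)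
      show "c \<in> ?Z \<union> (\<Union>t\<in>{1..m}. ?D t)"
      proof (cases "\<exists>i. (i, 1) \<in> keys u")
        case True
        then obtain i where "(i, 1) \<in> keys u" ..
        from corner_class_normal_form[OF u(2) this] obtain t w where
          tw: "t \<in> {1..m}" "keys w \<subseteq> ?R t" "swap_cong ?C u (?e t + w)" by blast
        have "w \<in> monoms (?R t) e"
          using swap_cong_monom_degree[OF tw(3)] u(3) tw(2) by (simp add: monoms_def monom_degree_add)
        moreover have "c = cls ?C (?e t + w)" unfolding u(1) cls_eq_iff by (rule tw(3))
        ultimately show ?thesis using tw(1) by blast
      next
        case False
        have "keys u \<subseteq> {1..m} \<times> {2..n}"
        proof
          fix x assume x: "x \<in> keys u"
          obtain i j where ij: "x = (i, j)" by fastforce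
          have "j \<noteq> 1" using False x ij by blast
          then show "x \<in> {1..m} \<times> {2..n}" using x u(2) ij by auto
        qed
        then show ?thesis using u(1,3) by (auto simp: monoms_def)
      qed
    next
      fix c assume "c \<in> ?Z \<union> (\<Union>t\<in>{1..m}. ?D t)"
      then consider u where "c = cls ?C u" "u \<in> monoms ({1..m} \<times> {2..n}) (Suc e)"
        | t w where "t \<in> {1..m}" "c = cls ?C (?e t + w)" "w \<in> monoms (?R t) e" by blast
      then show "c \<in> cls ?C ` monoms ?W (Suc e)"
      proof cases
        case 1
        then have "u \<in> monoms ?W (Suc e)" by (force simp: monoms_def)
        then show ?thesis using 1 by blast
      next
        case 2
        have "keys w \<subseteq> ?W" using 2 by (force simp: monoms_def)
        then have "?e t + w \<in> monoms ?W (Suc e)"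
          using 2 n by (simp add: monoms_def keys_plus_nat monom_degree_add)
        then show ?thesis using 2 by blast
      qed
    qed
    have fin: "finite (?D t)" for t by (simp add: finite_monoms)
    have disj0: "?Z \<inter> (\<Union>t\<in>{1..m}. ?D t) = {}"
    proof -
      have "cls ?C u \<noteq> cls ?C (?e t + w)" if u: "u \<in> monoms ({1..m} \<times> {2..n}) (Suc e)" for u t w
      proof
        assume "cls ?C u = cls ?C (?e t + w)"
        then have c: "swap_cong ?C u (?e t + w)" by (simp only: cls_eq_iff)
        have k: "keys u \<subseteq> {1..m} \<times> {2..n}" using u by (simp add: monoms_def)
        have "?e t + w = u" by (rule corner_cong_no_first_column[OF c k])
        then have "(t, 1) \<in> keys u" using keys_plus_nat[of "?e t" w] by auto
        then show False using k by auto
      qed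
      then show ?thesis by blast
    qed
    \<comment> \<open>The set of occurring rows is invariant: it contains \<open>s\<close> on one
      side and only rows from \<open>t\<close> on, hence beyond \<open>s\<close>, on the
      other.\<close>
    have "cls ?C (?e s + u) \<noteq> cls ?C (?e t + w)"
      if "s < t" "w \<in> monoms (?R t) e" for s t u w
    proof
      assume "cls ?C (?e s + u) = cls ?C (?e t + w)"
      then have "swap_cong ?C (?e s + u) (?e t + w)" by (simp only: cls_eq_iff)
      from swap_cong_rows[OF this] have "s \<in> fst ` keys (?e t + w)" by (auto simp: keys_plus_nat)
      then show False using that by (auto simp: keys_plus_nat monoms_def)
    qed
    then have disj: "?D s \<inter> ?D t = {}" if "s < t" for s t using that by blast
    have cardD: "card (?D t) = card (cls (?T t) ` monoms (?R t) e)" if "t \<in> {1..m}" for t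
    proof (rule card_image_same_kernel)
      fix u v assume "u \<in> monoms (?R t) e" "v \<in> monoms (?R t) e"
      then have "keys u \<subseteq> ?R t" "keys v \<subseteq> ?R t" by (simp_all add: monoms_def)
      then show "cls ?C (?e t + u) = cls ?C (?e t + v) \<longleftrightarrow> cls (?T t) u = cls (?T t) v"
        unfolding cls_eq_iff by (rule corner_cong_iff[OF that n])
    qed
    have card0: "card ?Z = card (cls {} ` monoms ({1..m} \<times> {2..n}) (Suc e))"
    proof (rule card_image_same_kernel)
      fix u v assume "u \<in> monoms ({1..m} \<times> {2..n}) (Suc e)" "v \<in> monoms ({1..m} \<times> {2..n}) (Suc e)"
      then have k: "keys u \<subseteq> {1..m} \<times> {2..n}" by (simp add: monoms_def)
      have "swap_cong ?C u v \<longleftrightarrow> u = v" using corner_cong_no_first_column[OF _ k] swap_cong_refl by metis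
      then show "cls ?C u = cls ?C v \<longleftrightarrow> cls {} u = cls {} v" by (simp add: cls_eq_iff[of ?C] cls_empty)
    qed
    have "card (cls ?C ` monoms ?W (Suc e)) = card ?Z + card (\<Union>t\<in>{1..m}. ?D t)"
      unfolding split by (rule card_Un_disjoint) (use fin disj0 in \<open>auto simp: finite_monoms\<close>)
    also have "card (\<Union>t\<in>{1..m}. ?D t) = (\<Sum>t\<in>{1..m}. card (?D t))"
    proof (rule card_UN_disjoint)
      show "\<forall>s\<in>{1..m}. \<forall>t\<in>{1..m}. s \<noteq> t \<longrightarrow> ?D s \<inter> ?D t = {}"
      proof (intro ballI impI)
        fix s t :: nat assume "s \<noteq> t"
        then consider "s < t" | "t < s" by linarith
        then show "?D s \<inter> ?D t = {}" by cases (use disj[of s t] disj[of t s] in \<open>simp_all add: Int_commute\<close>)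
      qed
    qed (use fin in auto)
    also have "\<dots> = (\<Sum>t\<in>{1..m}. card (cls (?T t) ` monoms (?R t) e))"
      using cardD by (intro sum.cong) auto
    finally show ?thesis
      unfolding card0 by (simp add: Suc class_series_def fps_sum_nth)
  qed
qed

theorem theorem5p3:
  fixes m n :: nat
  assumes "m \<ge> 1" and "n \<ge> 1"
  shows
    "hilbert_poincare (matrix_vars m n)
       (graded_quotient (matrix_vars m n)
         (minor_ideal m n (corner_interval_minors m n) :: (nat \<times> nat, 'k::field) mpoly set))
     = (\<Sum>t = 1..m - 1.
          hilbert_poincare (matrix_vars m n)
            (graded_quotient (matrix_vars m n) (I2_lower m n t :: (nat \<times> nat, 'k) mpoly set))
          * ([:0, 1:] * [:1, - 1:] ^ (n * (t - 1))))
       + [:0, 1:] * [:1, - 1:] ^ (n * (m - 1))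
       + [:1, - 1:] ^ m"
proof -
  let ?V = "matrix_vars m n" and ?Y = "1 - fps_X :: int fps"
  let ?H = "\<lambda>C. hilbert_poincare ?V (graded_quotient ?V (minor_ideal m n C :: (nat \<times> nat, 'k) mpoly set))"
  let ?T = "\<lambda>t. two_minors {t..m} {1..n}" and ?R = "\<lambda>t. {t..m} \<times> {1..n}"
  have V: "?V = {1..m} \<times> {1..n}" by (simp add: matrix_vars_def)
  \<comment> \<open>The rows above \<open>t\<close> contain \<open>n * (t - 1)\<close>
    indeterminates that occur in no minor of the lower rows; removing them passes from the whole
    matrix to the submatrix.\<close>
  have H: "fps_of_poly (?H (?T t)) * ?Y ^ (n * (t - 1)) = class_series (?T t) (?R t) * ?Y ^ (m * n)"
    if t: "t \<in> {1..m}" for t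
  proof -
    have "class_series (?T t) ?V * ?Y ^ card ({1..<t} \<times> {1..n}) = class_series (?T t) (?V - {1..<t} \<times> {1..n})"
    proof (rule class_series_remove_free_set)
      show "x \<notin> {a1, a2} \<times> {b1, b2}" if "x \<in> {1..<t} \<times> {1..n}" "(a1, a2, b1, b2) \<in> ?T t" for x a1 a2 b1 b2
        using that by (auto simp: two_minors_def)
    qed (use t in \<open>auto simp: V\<close>)
    also have "?V - {1..<t} \<times> {1..n} = ?R t" using t by (auto simp: V)
    also have "card ({1..<t} \<times> {1..n}) = n * (t - 1)" by simp
    finally have "class_series (?T t) ?V * ?Y ^ (n * (t - 1)) = class_series (?T t) (?R t)" .
    moreover have "?T t \<subseteq> two_minors {1..m} {1..n}" using t by (auto simp: two_minors_def)
    ultimately show ?thesis by (simp add: hilbert_poincare_minor_ideal mult_ac)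
  qed
  \<comment> \<open>A single row has no 2-minors, so the series is that of a polynomial ring in
    \<open>n\<close> indeterminates, leaving the exponent \<open>m * n - n\<close>.\<close>
  have last: "class_series (?T m) (?R m) * ?Y ^ (m * n) = ?Y ^ (n * (m - 1))"
  proof -
    have "?T m = {}" by (auto simp: two_minors_def)
    moreover have "m * n = card (?R m) + n * (m - 1)" using assms(1) by (simp add: algebra_simps)
    ultimately show ?thesis
      using class_series_empty_mult[of "?R m"] by (simp add: power_add flip: mult.assoc)
  qed
  \<comment> \<open>The columns from 2 on contain \<open>m * (n - 1)\<close> indeterminates without
    relations, so \<open>m\<close> factors remain.\<close>
  have first: "class_series {} ({1..m} \<times> {2..n}) * ?Y ^ (m * n) = ?Y ^ m"
  proof -
    have "m * n = card ({1..m} \<times> {2..n}) + m" using assms(2) by (cases n) simp_all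
    then show ?thesis
      using class_series_empty_mult[of "{1..m} \<times> {2..n}"] by (simp only: power_add flip: mult.assoc) simp
  qed
  have sets: "{1..m} = insert m {1..m - 1}" "m \<notin> {1..m - 1}" using assms(1) by auto
  have "corner_interval_minors m n \<subseteq> two_minors {1..m} {1..n}" by (auto simp: corner_interval_minors_def)
  from hilbert_poincare_minor_ideal[OF this, where 'a = 'k]
  have "fps_of_poly (?H (corner_interval_minors m n))
      = (\<Sum>t\<in>{1..m}. fps_X * (class_series (?T t) (?R t) * ?Y ^ (m * n))) + ?Y ^ m"
    unfolding V class_series_corner[OF assms(2)]
    by (simp only: distrib_right sum_distrib_right mult.assoc first add.commute)
  also have "\<dots> = (\<Sum>t\<in>{1..m - 1}. fps_X * (class_series (?T t) (?R t) * ?Y ^ (m * n)))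
      + fps_X * ?Y ^ (n * (m - 1)) + ?Y ^ m"
    unfolding sets(1) using sets(2) last by (simp add: add.commute)
  also have "(\<Sum>t\<in>{1..m - 1}. fps_X * (class_series (?T t) (?R t) * ?Y ^ (m * n)))
      = (\<Sum>t\<in>{1..m - 1}. fps_of_poly (?H (?T t)) * (fps_X * ?Y ^ (n * (t - 1))))"
  proof (rule sum.cong[OF refl])
    fix t assume "t \<in> {1..m - 1}"
    then have "t \<in> {1..m}" by auto
    from H[OF this] show "fps_X * (class_series (?T t) (?R t) * ?Y ^ (m * n))
        = fps_of_poly (?H (?T t)) * (fps_X * ?Y ^ (n * (t - 1)))" by (simp add: mult_ac)
  qed
  also have "\<dots> + fps_X * ?Y ^ (n * (m - 1)) + ?Y ^ m
      = fps_of_poly ((\<Sum>t = 1..m - 1. ?H (?T t) * ([:0, 1:] * [:1, - 1:] ^ (n * (t - 1))))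
       + [:0, 1:] * [:1, - 1:] ^ (n * (m - 1)) + [:1, - 1:] ^ m)"
  proof -
    have "fps_of_poly [:1, - 1 :: int:] = ?Y" "fps_of_poly [:0, 1 :: int:] = fps_X"
      by (simp_all add: fps_of_poly_pCons)
    then show ?thesis
      by (simp only: fps_of_poly_add fps_of_poly_mult fps_of_poly_power fps_of_poly_sum)
  qed
  finally show ?thesis unfolding fps_of_poly_eq_iff I2_lower_def .
qed

end
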